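(* For all $t\in[1,\infty]$ we have (as $n$ varies, with $t$ fixed) $$R_1(B(l_t^n))\sim\left(\frac{\log n}{n}\right)^{1-\frac1{\min\{t,2\}}}.$$
   Context: Multi-index notation: $\alpha=(\alpha_1,\dots,\alpha_n)$ is an $n$-tuple of nonnegative integers, $|\alpha|=\alpha_1+\cdots+\alpha_n$, $z^\alpha=z_1^{\alpha_1}\cdots z_n^{\alpha_n}$. For $t\in[1,\infty)$, $B(l_t^n)=\{z\in\mathbb{C}^n:(\sum_{i=1}^n|z_i|^t)^{1/t}<1\}$; $B(l_\infty^n)=\mathbb{D}^n=\{z\in\mathbb{C}^n:|z_i|<1,\ 1\le i\le n\}$. $\overline{\mathbb{D}}$ is the closed unit disk in $\mathbb{C}$. A twice continuously differentiable function $f:\Omega\subset\mathbb{C}^n\to\mathbb{C}$ is pluriharmonic if its restriction to every complex line is harmonic; on a simply connected domain $\Omega$ containing the origin this is equivalent to $f=h+\overline{g}$ with $h,g$ holomorphic in $\Omega$ and $g(0)=0$. $R_1(B(l_t^n))$ is the supremum of all $r\in[0,1]$ such that $$\sup_{z\in rB(l_t^n)}\sum_{k=1}^\infty\sum_{|\alpha|=k}\left(|a_\alpha|+|b_\alpha|\right)|z^\alpha|\le1$$ holds for all pluriharmonic functions $f(z)=\sum_{k=0}^\infty\sum_{|\alpha|=k}a_\alpha z^\alpha+\overline{\sum_{k=1}^\infty\sum_{|\alpha|=k}b_\alpha z^\alpha}$ from $B(l_t^n)$ to $\overline{\mathbb{D}}$. Asymptotic notation: for sequences $\{p_n\},\{q_n\}$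 of positive reals, $p_n\sim q_n$ means there are constants $C,D>0$ independent of $n$ with $Dq_n\le p_n\le Cq_n$ for all $n>1$. *)

theory Defs
  imports "HOL-Analysis.Analysis"
begin

(* Since the dimension n varies inside the theorem, C^n is the set of sequences vanishing from
   index n on; coordinates are numbered 0, ..., n - 1. The product topology on nat => complex
   induces the Euclidean topology on it. Multi-indices are treated in the same way. *)

definition cspace :: "nat \<Rightarrow> (nat \<Rightarrow> complex) set" where
  "cspace n = {z. \<forall>i\<ge>n. z i = 0}"

definition lt_ball :: "nat \<Rightarrow> ereal \<Rightarrow> (nat \<Rightarrow> complex) set" where
  "lt_ball n t = {z \<in> cspace n.
     if t = \<infinity> then \<forall>i<n. cmod (z i) < 1
     else (\<Sum>i<n. cmod (z i) powr real_of_ereal t) powr (1 / real_of_ereal t) < 1}"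

definition multi_indices :: "nat \<Rightarrow> nat \<Rightarrow> (nat \<Rightarrow> nat) set" where
  "multi_indices n k = {\<alpha>. (\<forall>i\<ge>n. \<alpha> i = 0) \<and> (\<Sum>i<n. \<alpha> i) = k}"

lemma finite_multi_indices [simp]: "finite (multi_indices n k)"
proof -
  have "\<alpha> i \<in> {..k}" if "\<alpha> \<in> multi_indices n k" "i < n" for \<alpha> i
    using that member_le_sum[of i "{..<n}" \<alpha>] by (auto simp: multi_indices_def)
  then have "multi_indices n k \<subseteq> {\<alpha>. \<forall>i. (i \<in> {..<n} \<longrightarrow> \<alpha> i \<in> {..k}) \<and> (i \<notin> {..<n} \<longrightarrow> \<alpha> i = 0)}"
    by (auto simp: multi_indices_def)
  then show ?thesis
    by (rule finite_subset) (rule finite_set_of_finite_funs, auto)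
qed

definition monomial :: "nat \<Rightarrow> (nat \<Rightarrow> nat) \<Rightarrow> (nat \<Rightarrow> complex) \<Rightarrow> complex" where
  "monomial n \<alpha> z = (\<Prod>i<n. z i ^ \<alpha> i)"

definition homogeneous_part ::
    "nat \<Rightarrow> ((nat \<Rightarrow> nat) \<Rightarrow> complex) \<Rightarrow> nat \<Rightarrow> (nat \<Rightarrow> complex) \<Rightarrow> complex" where
  "homogeneous_part n a k z = (\<Sum>\<alpha>\<in>multi_indices n k. a \<alpha> * monomial n \<alpha> z)"

(* Partial derivatives and the class C^k, for functions on C as well as on C^n. Types such as
   nat => complex are not normed spaces in the library, so a real coordinate direction is given
   by its translation flow: m s z is the point z moved by s in that direction. *)

definition partial_deriv ::
    "(real \<Rightarrow> 'a \<Rightarrow> 'a) \<Rightarrow> ('a \<Rightarrow> complex) \<Rightarrow> 'a \<Rightarrow> complex" where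
  "partial_deriv m f z = vector_derivative (\<lambda>s. f (m s z)) (at 0)"

primrec Ck_on ::
    "nat \<Rightarrow> (real \<Rightarrow> 'a \<Rightarrow> 'a) set \<Rightarrow> ('a::topological_space \<Rightarrow> complex) \<Rightarrow> 'a set \<Rightarrow> bool" where
  "Ck_on 0 M f S \<longleftrightarrow> continuous_on S f"
| "Ck_on (Suc k) M f S \<longleftrightarrow> continuous_on S f \<and>
     (\<forall>m\<in>M. (\<forall>z\<in>S. (\<lambda>s. f (m s z)) differentiable (at 0)) \<and> Ck_on k M (partial_deriv m f) S)"

definition move1 :: "complex \<Rightarrow> real \<Rightarrow> complex \<Rightarrow> complex" where
  "move1 u s \<zeta> = \<zeta> + of_real s * u"

definition move :: "nat \<Rightarrow> complex \<Rightarrow> real \<Rightarrow> (nat \<Rightarrow> complex) \<Rightarrow> (nat \<Rightarrow> complex)" where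
  "move j u s z = z(j := z j + of_real s * u)"

(* The sets S and \<Omega> below are meant to be open, the latter relative to cspace n. *)

definition harmonic_on :: "(complex \<Rightarrow> complex) \<Rightarrow> complex set \<Rightarrow> bool" where
  "harmonic_on g S \<longleftrightarrow> Ck_on 2 {move1 1, move1 \<i>} g S \<and>
     (\<forall>\<zeta>\<in>S. partial_deriv (move1 1) (partial_deriv (move1 1) g) \<zeta>
          + partial_deriv (move1 \<i>) (partial_deriv (move1 \<i>) g) \<zeta> = 0)"

definition pluriharmonic_on ::
    "nat \<Rightarrow> ((nat \<Rightarrow> complex) \<Rightarrow> complex) \<Rightarrow> (nat \<Rightarrow> complex) set \<Rightarrow> bool" where
  "pluriharmonic_on n f \<Omega> \<longleftrightarrow> Ck_on 2 {move j u | j u. j < n \<and> u \<in> {1, \<i>}} f \<Omega> \<and>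
     (\<forall>z\<in>cspace n. \<forall>w\<in>cspace n.
        harmonic_on (\<lambda>\<zeta>. f (\<lambda>i. z i + \<zeta> * w i)) {\<zeta>. (\<lambda>i. z i + \<zeta> * w i) \<in> \<Omega>})"

(* f is the sum of the a-series and of the conjugate of the b-series on \<Omega>; the latter starts at
   degree 1, so that b is irrelevant at the zero multi-index. *)

definition has_pluriharmonic_expansion ::
    "nat \<Rightarrow> ((nat \<Rightarrow> complex) \<Rightarrow> complex) \<Rightarrow> ((nat \<Rightarrow> nat) \<Rightarrow> complex) \<Rightarrow> ((nat \<Rightarrow> nat) \<Rightarrow> complex)
      \<Rightarrow> (nat \<Rightarrow> complex) set \<Rightarrow> bool" where
  "has_pluriharmonic_expansion n f a b \<Omega> \<longleftrightarrow>
     (\<forall>z\<in>\<Omega>. \<exists>u v. (\<lambda>k. homogeneous_part n a k z) sums u \<and>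
               (\<lambda>k. homogeneous_part n b (Suc k) z) sums v \<and> f z = u + cnj v)"

definition bohr_sum ::
    "nat \<Rightarrow> ((nat \<Rightarrow> nat) \<Rightarrow> complex) \<Rightarrow> ((nat \<Rightarrow> nat) \<Rightarrow> complex) \<Rightarrow> (nat \<Rightarrow> complex) \<Rightarrow> ennreal" where
  "bohr_sum n a b z =
     (\<Sum>k. ennreal (\<Sum>\<alpha>\<in>multi_indices n (Suc k). (cmod (a \<alpha>) + cmod (b \<alpha>)) * cmod (monomial n \<alpha> z)))"

definition R1 :: "nat \<Rightarrow> (nat \<Rightarrow> complex) set \<Rightarrow> real" where
  "R1 n \<Omega> = Sup {r \<in> {0..1}. \<forall>f a b.
     pluriharmonic_on n f \<Omega> \<and> f ` \<Omega> \<subseteq> cball 0 1 \<and> has_pluriharmonic_expansion n f a b \<Omega> \<longrightarrow>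
       (SUP z \<in> (\<lambda>z i. of_real r * z i) ` \<Omega>. bohr_sum n a b z) \<le> 1}"

definition asymp_comparable :: "(nat \<Rightarrow> real) \<Rightarrow> (nat \<Rightarrow> real) \<Rightarrow> bool" where
  "asymp_comparable p q \<longleftrightarrow> (\<exists>C>0. \<exists>D>0. \<forall>n>1. D * q n \<le> p n \<and> p n \<le> C * q n)"

end

theory Submission
  imports Defs "HOL-Complex_Analysis.Conformal_Mappings"
begin

text \<open>
  Put \<open>s = 1 - 1 / min t 2\<close>.

  Lower bound: averaging over the circle shows that every homogeneous part of a pluriharmonic function
  bounded by 1 is itself bounded by 1. So it suffices to bound \<open>\<Sum>\<alpha>. \<bar>a \<alpha>\<bar> \<bar>z\<^sup>\<alpha>\<bar>\<close> by
  \<open>C ^ k * (n / ln n) powr (k * s)\<close> for a polynomial of degree \<open>k\<close> bounded by 1 on the ball. A directional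
  derivative splits off one variable, in which the bound costs no power of \<open>n\<close>; the other \<open>k - 1\<close>
  variables contribute \<open>N powr s\<close>, where \<open>N \<le> (4 n / ln n) ^ k\<close> is the number of multi-indices of degree
  \<open>k - 1\<close>. For \<open>t \<le> 2\<close> this is Cauchy's coefficient estimate followed by Hoelder's inequality; for
  \<open>t > 2\<close> one passes to the polydisc and uses that the \<open>L\<^sup>2\<close> norm of a polynomial of degree \<open>k\<close> on
  the torus is at most \<open>3 * 2 ^ k\<close> times its \<open>L\<^sup>1\<close> norm. Torus integrals are replaced by averages over
  roots of unity.

  Upper bound: for \<open>m = \<lceil>ln n\<rceil>\<close> some choice of signs makes the polynomial with coefficients
  \<open>\<plusminus> m! / \<alpha>!\<close> at most \<open>sqrt (m!) * C ^ m\<close> on the Euclidean ball, because any power of \<open>n\<close> is absorbed in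
  \<open>C ^ m\<close>. Interpolation with the trivial bound 1 on the \<open>l\<^sub>1\<close> ball (three lines theorem) covers
  \<open>t \<le> 2\<close>, inclusion of balls covers \<open>t > 2\<close>, and testing at a point with equal coordinates bounds
  the radius.\<close>

subsection \<open>Multi-indices and monomials\<close>

text \<open>Why a variable is split off: Hoelder's inequality over all monomials of degree
  \<open>k\<close> would cost \<open>card (multi_indices n k) powr s\<close>, which for
  \<open>k = 1\<close> is \<open>n powr s\<close>, with no logarithm gained. In degree
  \<open>k - 1\<close> the count is at most \<open>(4 n / ln n) ^ k\<close>: the spare power of
  \<open>n\<close> pays for the logarithms. So everything hinges on bounding the split-off variable
  at no cost in \<open>n\<close>, which comes from aligning the direction of the derivative with the
  phases of the coefficients or of the partial derivatives.

  Why \<open>m\<close> is about \<open>ln n\<close>: the test polynomial bounds the radius by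
  \<open>C * (m / n) powr s\<close>, provided that the factor polynomial in \<open>n\<close> left by
  the choice of signs is at most \<open>C ^ m\<close>. This forces \<open>m\<close> to have at least
  the order of \<open>ln n\<close>, and a larger \<open>m\<close> only weakens the bound.

  Why interpolation is possible: with multinomial weights the bound on the l1 ball holds for every
  choice of signs, so signs chosen for the Euclidean ball are automatically good at the other
  endpoint, and the same polynomial serves every \<open>t\<close>.\<close>

lemma multi_indicesD:
  assumes "\<alpha> \<in> multi_indices n k"
  shows "i \<ge> n \<Longrightarrow> \<alpha> i = 0" "(\<Sum>i<n. \<alpha> i) = k" "i < n \<Longrightarrow> \<alpha> i \<le> k"
  using assms member_le_sum[of i "{..<n}" \<alpha>] by (auto simp: multi_indices_def)

lemma multi_indices_less:
  assumes "\<alpha> \<in> multi_indices n k" "k < N"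
  shows "(i < n \<longrightarrow> \<alpha> i < N) \<and> (i \<ge> n \<longrightarrow> \<alpha> i = 0)"
  using multi_indicesD[OF assms(1)] assms(2) by (metis le_less_trans)

lemma multi_indices_0: "multi_indices 0 m = (if m = 0 then {\<lambda>_. 0} else {})"
  by (auto simp: multi_indices_def)

lemma sum_multi_indices_Suc:
  "sum F (multi_indices (Suc n) m) = (\<Sum>k\<le>m. \<Sum>\<beta>\<in>multi_indices n (m - k). F (\<beta>(n := k)))"
proof -
  have "(\<Sum>k\<le>m. \<Sum>\<beta>\<in>multi_indices n (m - k). F (\<beta>(n := k))) =
        (\<Sum>(k, \<beta>)\<in>Sigma {..m} (\<lambda>k. multi_indices n (m - k)). F (\<beta>(n := k)))"
    by (subst sum.Sigma) auto
  also have "\<dots> = sum F (multi_indices (Suc n) m)"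
    by (rule sum.reindex_bij_witness[where i = "\<lambda>\<alpha>. (\<alpha> n, \<alpha>(n := 0))"
          and j = "\<lambda>(k, \<beta>). \<beta>(n := k)"])
       (auto simp: multi_indices_def fun_eq_iff)
  finally show ?thesis ..
qed

lemma sum_multi_indices_raise:
  assumes "j < n"
  shows "sum F {\<alpha> \<in> multi_indices n (Suc m). \<alpha> j > 0} =
         (\<Sum>\<beta>\<in>multi_indices n m. F (\<beta>(j := Suc (\<beta> j))))"
proof -
  have upd: "(\<Sum>i<n. (\<beta>(j := x)) i) + \<beta> j = (\<Sum>i<n. \<beta> i) + x" for \<beta> :: "nat \<Rightarrow> nat" and x
    using assms by (simp add: sum.remove[of "{..<n}" j])
  show ?thesis
  proof (rule sum.reindex_bij_witness[where j = "\<lambda>\<alpha>. \<alpha>(j := \<alpha> j - 1)"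
        and i = "\<lambda>\<beta>. \<beta>(j := Suc (\<beta> j))"], goal_cases)
    case (2 \<alpha>)
    then show ?case using assms upd[of \<alpha> "\<alpha> j - 1"] by (auto simp: multi_indices_def)
  next
    case (4 \<beta>)
    then show ?case using assms upd[of \<beta> "Suc (\<beta> j)"] by (auto simp: multi_indices_def)
  qed (auto simp: fun_eq_iff)
qed

text \<open>A multi-index of positive degree has a nonzero entry \<open>j\<close>, so lowering that
  entry exhibits it on the right; for nonnegative terms the multiple counting only helps. This is
  the index-set side of splitting off a variable.\<close>

lemma sum_multi_indices_le_raise:
  fixes F :: "(nat \<Rightarrow> nat) \<Rightarrow> real"
  assumes "\<And>\<alpha>. F \<alpha> \<ge> 0"
  shows "sum F (multi_indices n (Suc m)) \<le>
         (\<Sum>j<n. \<Sum>\<beta>\<in>multi_indices n m. F (\<beta>(j := Suc (\<beta> j))))"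
proof -
  have "F \<alpha> \<le> (\<Sum>j<n. if \<alpha> j > 0 then F \<alpha> else 0)" if "\<alpha> \<in> multi_indices n (Suc m)" for \<alpha>
  proof -
    have "(\<Sum>i<n. \<alpha> i) \<noteq> 0"
      using that by (simp add: multi_indices_def)
    then obtain j where "j < n" "\<alpha> j > 0"
      by auto
    then have "(if \<alpha> j > 0 then F \<alpha> else 0) \<le> (\<Sum>j<n. if \<alpha> j > 0 then F \<alpha> else 0)"
      by (intro member_le_sum) (auto simp: assms)
    with \<open>\<alpha> j > 0\<close> show ?thesis by simp
  qed
  then have "sum F (multi_indices n (Suc m)) \<le>
    (\<Sum>\<alpha>\<in>multi_indices n (Suc m). \<Sum>j<n. if \<alpha> j > 0 then F \<alpha> else 0)"
    by (rule sum_mono)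
  also have "\<dots> = (\<Sum>j<n. sum F {\<alpha> \<in> multi_indices n (Suc m). \<alpha> j > 0})"
    by (subst sum.swap) (simp add: sum.If_cases Int_def)
  also have "\<dots> = (\<Sum>j<n. \<Sum>\<beta>\<in>multi_indices n m. F (\<beta>(j := Suc (\<beta> j))))"
    by (simp add: sum_multi_indices_raise)
  finally show ?thesis .
qed

section \<open>Multinomial theorem and the number of multi-indices\<close>

definition multinomial :: "nat \<Rightarrow> nat \<Rightarrow> (nat \<Rightarrow> nat) \<Rightarrow> real" where
  "multinomial n m \<alpha> = fact m / (\<Prod>i<n. fact (\<alpha> i))"

lemma multinomial_pos: "multinomial n m \<alpha> > 0"
  by (auto simp: multinomial_def intro!: divide_pos_pos prod_pos)

lemma multinomial_theorem:
  "(\<Sum>\<alpha>\<in>multi_indices n m. multinomial n m \<alpha> * (\<Prod>i<n. x i ^ \<alpha> i)) = (\<Sum>i<n. x i) ^ m"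
proof (induction n arbitrary: m)
  case 0
  then show ?case by (simp add: multi_indices_0 multinomial_def)
next
  case (Suc n)
  have "multinomial (Suc n) m (\<beta>(n := k)) * (\<Prod>i<Suc n. x i ^ (\<beta>(n := k)) i) =
        (of_nat (m choose k) * x n ^ k) * (multinomial n (m - k) \<beta> * (\<Prod>i<n. x i ^ \<beta> i))"
    if "k \<le> m" for k \<beta>
    using that by (simp add: multinomial_def binomial_fact mult_ac)
  then have "(\<Sum>\<alpha>\<in>multi_indices (Suc n) m. multinomial (Suc n) m \<alpha> * (\<Prod>i<Suc n. x i ^ \<alpha> i)) =
    (\<Sum>k\<le>m. (of_nat (m choose k) * x n ^ k) * (\<Sum>i<n. x i) ^ (m - k))"
    unfolding sum_multi_indices_Suc Suc.IH[symmetric] sum_distrib_left[of _ _ "multi_indices _ _"]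
    by (intro sum.cong refl) auto
  also have "\<dots> = (\<Sum>i<Suc n. x i) ^ m"
    by (simp add: binomial_ring add.commute)
  finally show ?case .
qed

text \<open>Generating function argument: the left side is the degree \<open>m\<close> term in the
  expansion of \<open>(1 / (1 - x)) ^ n\<close> in powers of \<open>x\<close>, all of whose terms
  are positive.\<close>

lemma card_multi_indices_le:
  fixes x :: real
  assumes "0 < x" "x < 1"
  shows "real (card (multi_indices n m)) * x ^ m \<le> (1 / (1 - x)) ^ n"
proof -
  have "(\<Sum>\<alpha>\<in>multi_indices n m. \<Prod>i<n. x ^ \<alpha> i) \<le> (1 / (1 - x)) ^ n"
  proof (induction n arbitrary: m)
    case 0
    then show ?case by (simp add: multi_indices_0)
  next
    case (Suc n)
    have "(\<Sum>\<alpha>\<in>multi_indices (Suc n) m. \<Prod>i<Suc n. x ^ \<alpha> i) =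
      (\<Sum>k\<le>m. x ^ k * (\<Sum>\<beta>\<in>multi_indices n (m - k). \<Prod>i<n. x ^ \<beta> i))"
      unfolding sum_multi_indices_Suc by (simp add: sum_distrib_left mult.commute)
    also have "\<dots> \<le> (\<Sum>k\<le>m. x ^ k * (1 / (1 - x)) ^ n)"
      using assms by (intro sum_mono mult_left_mono Suc.IH) auto
    also have "\<dots> = (\<Sum>k<Suc m. x ^ k) * (1 / (1 - x)) ^ n"
      by (simp add: sum_distrib_right lessThan_Suc_atMost)
    also have "\<dots> \<le> (1 / (1 - x)) * (1 / (1 - x)) ^ n"
    proof (rule mult_right_mono)
      have "(\<Sum>k<Suc m. x ^ k) = (1 - x ^ Suc m) / (1 - x)"
        using assms by (subst sum_gp_strict) auto
      also have "\<dots> \<le> 1 / (1 - x)"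
        using assms by (intro divide_right_mono) auto
      finally show "(\<Sum>k<Suc m. x ^ k) \<le> 1 / (1 - x)" .
    qed (use assms in auto)
    finally show ?case by simp
  qed
  moreover have "(\<Sum>\<alpha>\<in>multi_indices n m. \<Prod>i<n. x ^ \<alpha> i) = (\<Sum>\<alpha>\<in>multi_indices n m. x ^ m)"
    by (intro sum.cong) (auto simp: power_sum[symmetric] multi_indices_def)
  ultimately show ?thesis by simp
qed

text \<open>The choice \<open>x = ln n / (4 n)\<close> makes \<open>(1 / (1 - x)) ^ n\<close> smaller than
  \<open>n / ln n\<close>.\<close>

lemma card_multi_indices_le_log:
  assumes "n \<ge> 2"
  shows "real (card (multi_indices n m)) \<le> (4 * real n / ln (real n)) ^ Suc m"
proof -
  define x where "x = ln (real n) / (4 * real n)"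
  have n: "real n > 0" "ln (real n) > 0"
    using assms by auto
  have "ln (real n) \<le> real n"
    using ln_le_minus_one[of "real n"] n by linarith
  then have x: "0 < x" "x \<le> 1/4"
    using n by (auto simp: x_def field_simps)
  have "1 / (1 - x) \<le> 1 + 2 * x"
  proof -
    have "1 \<le> (1 + 2 * x) * (1 - x)"
    proof -
      have "(1 + 2 * x) * (1 - x) = 1 + x * (1 - 2 * x)"
        by (simp add: algebra_simps)
      moreover have "x * (1 - 2 * x) \<ge> 0"
        using x by (intro mult_nonneg_nonneg) auto
      ultimately show ?thesis by simp
    qed
    then show ?thesis using x by (simp add: divide_le_eq)
  qed
  also have "\<dots> \<le> exp (2 * x)"
    by (rule exp_ge_add_one_self)
  finally have "(1 / (1 - x)) ^ n \<le> exp (2 * x) ^ n"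
    using x by (intro power_mono) auto
  also have "\<dots> = exp (ln (real n) / 2)"
    using n by (simp add: exp_of_nat_mult[symmetric] x_def)
  finally have "(1 / (1 - x)) ^ n \<le> exp (ln (real n) / 2)" .
  \<comment> \<open>\<open>exp (ln n / 2)\<close> is the square root of \<open>n\<close>, and
    \<open>ln n / 2\<close> is at most that root; multiplying the two gives the claim. The factor
    \<open>1 / x\<close> raises the final exponent from \<open>m\<close> to
    \<open>Suc m\<close>.\<close>
  also have "\<dots> \<le> 1 / x"
  proof -
    have "ln (real n) / 2 \<le> exp (ln (real n) / 2)"
      using exp_ge_add_one_self[of "ln (real n) / 2"] by linarith
    then have "exp (ln (real n) / 2) * (ln (real n) / 2) \<le> exp (ln (real n) / 2) * exp (ln (real n) / 2)"
      by (intro mult_left_mono) auto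
    also have "\<dots> = real n"
      using n by (simp flip: exp_add)
    finally show ?thesis
      using n by (simp add: x_def field_simps)
  qed
  finally have "(1 / (1 - x)) ^ n \<le> 1 / x" .
  moreover have "real (card (multi_indices n m)) * x ^ m \<le> (1 / (1 - x)) ^ n"
    using x by (intro card_multi_indices_le) auto
  ultimately have "real (card (multi_indices n m)) * x ^ m \<le> 1 / x"
    by linarith
  then have "real (card (multi_indices n m)) \<le> (1 / x) ^ Suc m"
    using x by (simp add: field_simps)
  then show ?thesis by (simp add: x_def)
qed

text \<open>Hoelder's inequality against the constant 1, obtained from Jensen's inequality for the
  convex function \<open>x powr p\<close> with equal weights.\<close>

lemma power_mean_sum:
  fixes x :: "'a \<Rightarrow> real"
  assumes "finite A" "\<And>i. i \<in> A \<Longrightarrow> x i \<ge> 0" "p \<ge> 1"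
  shows "(\<Sum>i\<in>A. x i) \<le> real (card A) powr (1 - 1 / p) * (\<Sum>i\<in>A. x i powr p) powr (1 / p)"
proof (cases "{i\<in>A. x i > 0} = {}")
  case True
  then have "(\<Sum>i\<in>A. x i) = 0"
    using assms by (intro sum.neutral) force
  then show ?thesis by simp
next
  case False
  \<comment> \<open>Zero terms are dropped so that Jensen is applied to positive numbers only; at
    the end \<open>card B\<close> is enlarged to \<open>card A\<close>, the exponent
    \<open>1 - 1 / p\<close> being nonnegative.\<close>
  define B where "B = {i\<in>A. x i > 0}"
  have B: "finite B" "B \<noteq> {}" "B \<subseteq> A" using False assms by (auto simp: B_def)
  have cB: "card B > 0" "card B \<le> card A"
    using B assms by (auto simp: card_gt_0_iff intro: card_mono)
  have eq: "(\<Sum>i\<in>A. x i) = (\<Sum>i\<in>B. x i)" "(\<Sum>i\<in>A. x i powr p) = (\<Sum>i\<in>B. x i powr p)"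
    using assms by (force simp: B_def intro!: sum.mono_neutral_right)+
  have "(\<Sum>i\<in>B. (1 / card B) *\<^sub>R x i) powr p \<le> (\<Sum>i\<in>B. (1 / card B) * (x i powr p))"
    using B cB by (intro convex_on_sum[OF _ _ powr_convex[OF assms(3)]]) (auto simp: B_def)
  then have *: "((\<Sum>i\<in>B. x i) / card B) powr p \<le> (\<Sum>i\<in>B. x i powr p) / card B"
    by (simp add: sum_distrib_left sum_divide_distrib)
  have pos: "(\<Sum>i\<in>B. x i) > 0"
    using B by (intro sum_pos) (auto simp: B_def)
  have "(\<Sum>i\<in>B. x i) / card B = (((\<Sum>i\<in>B. x i) / card B) powr p) powr (1 / p)"
    using pos cB assms by (simp add: powr_powr)
  also have "\<dots> \<le> ((\<Sum>i\<in>B. x i powr p) / card B) powr (1 / p)"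
    using assms * by (intro powr_mono2) auto
  also have "\<dots> = (\<Sum>i\<in>B. x i powr p) powr (1 / p) / card B powr (1 / p)"
    using cB by (simp add: powr_divide sum_nonneg)
  finally have "(\<Sum>i\<in>B. x i) \<le> card B * ((\<Sum>i\<in>B. x i powr p) powr (1 / p) / card B powr (1 / p))"
    using cB by (simp add: field_simps)
  also have "\<dots> = card B powr (1 - 1 / p) * (\<Sum>i\<in>B. x i powr p) powr (1 / p)"
    using cB by (simp add: powr_diff)
  also have "\<dots> \<le> card A powr (1 - 1 / p) * (\<Sum>i\<in>B. x i powr p) powr (1 / p)"
    using cB assms by (intro mult_right_mono powr_mono2) auto
  finally show ?thesis by (simp add: eq)
qed

lemma monomial_scale: "monomial n \<alpha> (\<lambda>i. c * z i) = c ^ (\<Sum>i<n. \<alpha> i) * monomial n \<alpha> z"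
  by (simp add: monomial_def power_mult_distrib prod.distrib power_sum)

lemma monomial_mult: "monomial n \<alpha> (\<lambda>i. w i * z i) = monomial n \<alpha> w * monomial n \<alpha> z"
  by (simp add: monomial_def power_mult_distrib prod.distrib)

lemma cmod_monomial: "cmod (monomial n \<alpha> z) = (\<Prod>i<n. cmod (z i) ^ \<alpha> i)"
  by (simp add: monomial_def prod_norm[symmetric] norm_power)

lemma homogeneous_part_scale:
  "homogeneous_part n a k (\<lambda>i. c * z i) = c ^ k * homogeneous_part n a k z"
  by (auto simp: homogeneous_part_def monomial_scale sum_distrib_left multi_indicesD(2)
      intro!: sum.cong)

text \<open>Moves a fixed point into the coefficients: a bound on the torus or polydisc through
  \<open>z\<close> becomes a bound for the polynomial with coefficients
  \<open>a \<alpha> * monomial n \<alpha> z\<close>.\<close>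

lemma homogeneous_part_mult:
  "homogeneous_part n a k (\<lambda>i. w i * z i) = homogeneous_part n (\<lambda>\<alpha>. a \<alpha> * monomial n \<alpha> z) k w"
  by (auto simp: homogeneous_part_def monomial_mult intro!: sum.cong)

subsection \<open>Averages over roots of unity\<close>

text \<open>A geometric sum with ratio \<open>w\<close>. The bound on \<open>d\<close> excludes the
  nonzero multiples of \<open>N\<close>, the only other exponents for which
  \<open>w = 1\<close>.\<close>

lemma sum_cis_multiples:
  fixes d :: int
  assumes "\<bar>d\<bar> < int N"
  shows "(\<Sum>j<N. cis (2 * pi * real j / real N) powi d) = (if d = 0 then of_nat N else 0)"
proof (cases "d = 0")
  case False
  define w where "w = cis (2 * pi * of_int d / real N)"
  have N: "N > 0" using assms by auto
  have "w ^ N = cis (2 * pi * of_int d)"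
    using N by (simp add: w_def Complex.DeMoivre)
  then have "w ^ N = 1"
    by simp
  moreover have "w \<noteq> 1"
  proof
    assume "w = 1"
    then have "cos (2 * pi * of_int d / real N) = 1"
      by (simp add: w_def complex_eq_iff)
    then obtain k :: int where "2 * pi * of_int d / real N = of_int k * 2 * pi"
      by (auto simp: cos_one_2pi_int)
    then have "real_of_int d = real_of_int (k * int N)"
      using N by (simp add: field_simps)
    then have "d = k * int N"
      by linarith
    with False have "k \<noteq> 0" by auto
    then have "int N \<le> \<bar>k\<bar> * int N"
      using mult_right_mono[of 1 "\<bar>k\<bar>" "int N"] by auto
    with \<open>d = k * int N\<close> assms show False by (simp add: abs_mult)
  qed
  moreover have "(\<Sum>j<N. cis (2 * pi * real j / real N) powi d) = (\<Sum>j<N. w ^ j)"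
    by (intro sum.cong) (simp_all add: w_def Complex.DeMoivre cis_power_int mult_ac)
  ultimately show ?thesis
    using False by (simp add: geometric_sum)
qed (use assms in auto)

text \<open>Zero beyond \<open>n\<close>, so that the point lies in \<open>cspace n\<close>.
  Averages over \<open>torus_grid N n\<close> agree exactly with torus integrals of products of a
  monomial and a conjugate monomial as long as all exponents stay below \<open>N\<close>.\<close>

definition torus_point :: "nat \<Rightarrow> nat \<Rightarrow> (nat \<Rightarrow> nat) \<Rightarrow> nat \<Rightarrow> complex" where
  "torus_point N n \<tau> = (\<lambda>i. if i < n then cis (2 * pi * real (\<tau> i) / real N) else 0)"

abbreviation torus_grid :: "nat \<Rightarrow> nat \<Rightarrow> (nat \<Rightarrow> nat) set" where
  "torus_grid N n \<equiv> {..<n} \<rightarrow>\<^sub>E {..<N}"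

lemma finite_torus_grid [simp]: "finite (torus_grid N n)"
  by (auto intro: finite_PiE)

lemma card_torus_grid: "card (torus_grid N n) = N ^ n"
  by (simp add: card_PiE)

lemma torus_point_props [simp]:
  "torus_point N n \<tau> \<in> cspace n" "i < n \<Longrightarrow> cmod (torus_point N n \<tau> i) = 1"
  by (auto simp: torus_point_def cspace_def)

lemma torus_orthogonality:
  assumes "\<And>i. i < n \<Longrightarrow> \<alpha> i < N \<and> \<beta> i < N"
  shows "(\<Sum>\<tau>\<in>torus_grid N n. monomial n \<alpha> (torus_point N n \<tau>) * cnj (monomial n \<beta> (torus_point N n \<tau>)))
         = (if \<forall>i<n. \<alpha> i = \<beta> i then of_nat N ^ n else 0)"
proof -
  let ?e = "\<lambda>i j. cis (2 * pi * real j / real N) powi (int (\<alpha> i) - int (\<beta> i))"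
  have e: "cis x ^ a * cnj (cis x) ^ b = cis x powi (int a - int b)" for x a b
    by (simp add: power_int_diff cis_cnj field_simps flip: power_inverse)
       (simp add: Complex.DeMoivre cis_mult field_simps)
  have "(\<Sum>\<tau>\<in>torus_grid N n. monomial n \<alpha> (torus_point N n \<tau>) * cnj (monomial n \<beta> (torus_point N n \<tau>)))
      = (\<Sum>\<tau>\<in>torus_grid N n. \<Prod>i<n. ?e i (\<tau> i))"
    by (intro sum.cong refl)
       (simp add: monomial_def torus_point_def e flip: prod.distrib)
  also have "\<dots> = (\<Prod>i<n. \<Sum>j<N. ?e i j)"
    by (rule prod_sum_PiE[symmetric]) auto
  also have "\<dots> = (\<Prod>i<n. if \<alpha> i = \<beta> i then of_nat N else 0)"
  proof (intro prod.cong refl)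
    fix i assume "i \<in> {..<n}"
    then have "\<bar>int (\<alpha> i) - int (\<beta> i)\<bar> < int N"
      using assms[of i] by auto
    from sum_cis_multiples[OF this] show "(\<Sum>j<N. ?e i j) = (if \<alpha> i = \<beta> i then of_nat N else 0)"
      by simp
  qed
  also have "\<dots> = (if \<forall>i<n. \<alpha> i = \<beta> i then of_nat N ^ n else 0)"
    by (auto intro: prod_zero)
  finally show ?thesis .
qed

lemma torus_coefficient:
  assumes "finite A" "\<beta> \<in> A" "\<And>\<alpha> i. \<alpha> \<in> A \<Longrightarrow> (i < n \<longrightarrow> \<alpha> i < N) \<and> (i \<ge> n \<longrightarrow> \<alpha> i = 0)"
  shows "(\<Sum>\<tau>\<in>torus_grid N n. (\<Sum>\<alpha>\<in>A. c \<alpha> * monomial n \<alpha> (torus_point N n \<tau>)) *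
            cnj (monomial n \<beta> (torus_point N n \<tau>))) = of_nat N ^ n * c \<beta>"
proof -
  have eq: "(\<forall>i<n. \<alpha> i = \<beta> i) \<longleftrightarrow> \<alpha> = \<beta>" if "\<alpha> \<in> A" for \<alpha>
    using assms(3)[OF that] assms(3)[OF assms(2)] by (metis ext not_le)
  have "(\<Sum>\<tau>\<in>torus_grid N n. (\<Sum>\<alpha>\<in>A. c \<alpha> * monomial n \<alpha> (torus_point N n \<tau>)) *
            cnj (monomial n \<beta> (torus_point N n \<tau>)))
      = (\<Sum>\<alpha>\<in>A. c \<alpha> * (\<Sum>\<tau>\<in>torus_grid N n. monomial n \<alpha> (torus_point N n \<tau>) *
            cnj (monomial n \<beta> (torus_point N n \<tau>))))"
    unfolding sum_distrib_right sum_distrib_left by (subst sum.swap) (simp add: mult.assoc)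
  also have "\<dots> = (\<Sum>\<alpha>\<in>A. c \<alpha> * (if \<alpha> = \<beta> then of_nat N ^ n else 0))"
  proof (intro sum.cong refl, goal_cases)
    case (1 \<alpha>)
    have "\<alpha> i < N \<and> \<beta> i < N" if "i < n" for i
      using that assms(3)[OF 1] assms(3)[OF assms(2)] by blast
    from torus_orthogonality[of n \<alpha> N \<beta>, OF this] show ?case
      using eq[OF 1] by simp
  qed
  also have "\<dots> = of_nat N ^ n * c \<beta>"
    using assms(1,2) by (simp add: if_distrib cong: if_cong)
  finally show ?thesis .
qed

lemma torus_parseval:
  assumes "finite A" "\<And>\<alpha> i. \<alpha> \<in> A \<Longrightarrow> (i < n \<longrightarrow> \<alpha> i < N) \<and> (i \<ge> n \<longrightarrow> \<alpha> i = 0)"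
  shows "(\<Sum>\<tau>\<in>torus_grid N n. (cmod (\<Sum>\<alpha>\<in>A. c \<alpha> * monomial n \<alpha> (torus_point N n \<tau>)))\<^sup>2)
         = real N ^ n * (\<Sum>\<alpha>\<in>A. (cmod (c \<alpha>))\<^sup>2)" (is "?L = ?R")
proof -
  let ?Q = "\<lambda>\<tau>. \<Sum>\<alpha>\<in>A. c \<alpha> * monomial n \<alpha> (torus_point N n \<tau>)"
  have "complex_of_real ?L = (\<Sum>\<tau>\<in>torus_grid N n. ?Q \<tau> * cnj (?Q \<tau>))"
    unfolding of_real_sum by (intro sum.cong refl) (rule complex_norm_square)
  also have "\<dots> = (\<Sum>\<beta>\<in>A. cnj (c \<beta>) * (\<Sum>\<tau>\<in>torus_grid N n. ?Q \<tau> * cnj (monomial n \<beta> (torus_point N n \<tau>))))"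
    unfolding cnj_sum complex_cnj_mult sum_distrib_left[of _ _ A] sum_distrib_left[of _ _ "torus_grid N n"]
    by (subst sum.swap) (simp add: mult_ac)
  also have "\<dots> = (\<Sum>\<beta>\<in>A. cnj (c \<beta>) * (of_nat N ^ n * c \<beta>))"
    using assms by (intro sum.cong refl) (subst torus_coefficient, auto)
  also have "\<dots> = (\<Sum>\<beta>\<in>A. of_nat N ^ n * complex_of_real ((cmod (c \<beta>))\<^sup>2))"
    by (intro sum.cong refl) (simp only: complex_norm_square mult_ac)
  also have "\<dots> = complex_of_real ?R"
    by (simp add: sum_distrib_left)
  finally show ?thesis by (simp only: of_real_eq_iff)
qed

text \<open>Cauchy's estimate on the torus through \<open>x\<close>: the polynomial is averaged
  against the conjugate of the monomial \<open>\<beta>\<close>. The grid size \<open>Suc m\<close>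
  exceeds every exponent that occurs.\<close>

lemma homogeneous_coefficient_bound:
  assumes bound: "\<And>u. u \<in> cspace n \<Longrightarrow> (\<And>i. i < n \<Longrightarrow> cmod (u i) = 1) \<Longrightarrow>
      cmod (homogeneous_part n c m (\<lambda>i. u i * x i)) \<le> B"
    and \<beta>: "\<beta> \<in> multi_indices n m"
  shows "cmod (c \<beta>) * cmod (monomial n \<beta> x) \<le> B"
proof -
  define N where "N = Suc m"
  let ?Q = "\<lambda>\<tau>. homogeneous_part n c m (\<lambda>i. torus_point N n \<tau> i * x i)"
  have "real N ^ n * (cmod (c \<beta>) * cmod (monomial n \<beta> x)) =
      cmod (of_nat N ^ n * (c \<beta> * monomial n \<beta> x))"
    by (simp add: norm_mult norm_power)
  also have "\<dots> = cmod (\<Sum>\<tau>\<in>torus_grid N n. ?Q \<tau> * cnj (monomial n \<beta> (torus_point N n \<tau>)))"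
    unfolding homogeneous_part_mult unfolding homogeneous_part_def
    by (subst torus_coefficient[OF finite_multi_indices \<beta>], erule multi_indices_less)
       (simp_all add: N_def)
  also have "\<dots> \<le> (\<Sum>\<tau>\<in>torus_grid N n. B)"
  proof (rule sum_norm_le)
    fix \<tau>
    have "cmod (monomial n \<beta> (torus_point N n \<tau>)) = 1"
      by (simp add: cmod_monomial)
    then show "cmod (?Q \<tau> * cnj (monomial n \<beta> (torus_point N n \<tau>))) \<le> B"
      using bound[of "torus_point N n \<tau>"] by (simp add: norm_mult)
  qed
  also have "\<dots> = real N ^ n * B"
    by (simp add: card_torus_grid)
  finally show ?thesis
    by (simp add: N_def)
qed

section \<open>Comparison of the L1 and L2 norms on the torus\<close>

text \<open>The first summand determines the second and ranges over a box with
  \<open>\<Prod>i<n. Suc (\<gamma> i)\<close> points, where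
  \<open>Suc (\<gamma> i) \<le> 2 ^ \<gamma> i\<close>. The result does not involve
  \<open>n\<close>, which is what makes the norm comparison dimension-free.\<close>

lemma card_multi_indices_decompositions:
  assumes "\<gamma> \<in> multi_indices n k"
  shows "card {p \<in> multi_indices n l \<times> multi_indices n m. (\<lambda>i. fst p i + snd p i) = \<gamma>} \<le> 2 ^ k"
proof -
  let ?S = "{p \<in> multi_indices n l \<times> multi_indices n m. (\<lambda>i. fst p i + snd p i) = \<gamma>}"
  have "card ?S \<le> card (PiE {..<n} (\<lambda>i. {..\<gamma> i}))"
  proof (rule card_inj_on_le)
    show "inj_on (\<lambda>p. restrict (fst p) {..<n}) ?S"
    proof (rule inj_onI)
      fix p q assume p: "p \<in> ?S" and q: "q \<in> ?S"
        and eq: "restrict (fst p) {..<n} = restrict (fst q) {..<n}"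
      have fst: "fst p i = fst q i" for i
      proof (cases "i < n")
        case True
        then show ?thesis using fun_cong[OF eq, of i] by simp
      next
        case False
        then show ?thesis using p q by (auto simp: multi_indices_def)
      qed
      have "fst p i + snd p i = fst q i + snd q i" for i
        using p q by (metis (mono_tags, lifting) mem_Collect_eq)
      with fst have "snd p i = snd q i" for i by (metis add_left_cancel)
      with fst show "p = q" by (intro prod_eqI ext) auto
    qed
    show "(\<lambda>p. restrict (fst p) {..<n}) ` ?S \<subseteq> PiE {..<n} (\<lambda>i. {..\<gamma> i})"
      by force
  qed (auto intro!: finite_PiE)
  also have "\<dots> = (\<Prod>i<n. Suc (\<gamma> i))"
    by (simp add: card_PiE)
  also have "\<dots> \<le> (\<Prod>i<n. 2 ^ \<gamma> i)"
    by (intro prod_mono) (simp add: Suc_leI)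
  also have "\<dots> = 2 ^ k"
    using multi_indicesD(2)[OF assms] by (simp flip: power_sum)
  finally show ?thesis .
qed

text \<open>Parseval is applied to the square of the polynomial, of degree \<open>2 * m\<close>,
  hence the grid size. A coefficient of the square is a sum over decompositions of its index, and
  Cauchy-Schwarz loses only their number, at most \<open>4 ^ m\<close>.\<close>

lemma torus_fourth_moment:
  fixes m n
  defines "N \<equiv> Suc (2 * m)"
  shows "(\<Sum>\<tau>\<in>torus_grid N n. (cmod (homogeneous_part n c m (torus_point N n \<tau>))) ^ 4)
         \<le> 4 ^ m * (real N ^ n * (\<Sum>\<alpha>\<in>multi_indices n m. (cmod (c \<alpha>))\<^sup>2)\<^sup>2)"
proof -
  let ?J = "multi_indices n m" and ?J2 = "multi_indices n (2 * m)"
  define add :: "(nat \<Rightarrow> nat) \<times> (nat \<Rightarrow> nat) \<Rightarrow> nat \<Rightarrow> nat"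
    where "add = (\<lambda>p i. fst p i + snd p i)"
  define e where "e \<gamma> = (\<Sum>p\<in>{p \<in> ?J \<times> ?J. add p = \<gamma>}. c (fst p) * c (snd p))" for \<gamma> :: "nat \<Rightarrow> nat"
  have add: "add ` (?J \<times> ?J) \<subseteq> ?J2"
    by (auto simp: add_def multi_indices_def sum.distrib)
  have sq: "homogeneous_part n c m u ^ 2 = (\<Sum>\<gamma>\<in>?J2. e \<gamma> * monomial n \<gamma> u)" for u
  proof -
    have "homogeneous_part n c m u ^ 2 =
      (\<Sum>p\<in>?J \<times> ?J. c (fst p) * c (snd p) * monomial n (add p) u)"
      by (simp add: homogeneous_part_def power2_eq_square sum_product sum.cartesian_product
          monomial_def add_def power_add prod.distrib case_prod_unfold mult_ac)
    also have "\<dots> = (\<Sum>\<gamma>\<in>?J2. \<Sum>p\<in>{p \<in> ?J \<times> ?J. add p = \<gamma>}. c (fst p) * c (snd p) * monomial n (add p) u)"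
      using add by (intro sum.group[symmetric]) auto
    also have "\<dots> = (\<Sum>\<gamma>\<in>?J2. e \<gamma> * monomial n \<gamma> u)"
      by (auto simp: e_def sum_distrib_right intro!: sum.cong)
    finally show ?thesis .
  qed
  have "(\<Sum>\<tau>\<in>torus_grid N n. (cmod (homogeneous_part n c m (torus_point N n \<tau>))) ^ 4)
      = (\<Sum>\<tau>\<in>torus_grid N n. (cmod (\<Sum>\<gamma>\<in>?J2. e \<gamma> * monomial n \<gamma> (torus_point N n \<tau>)))\<^sup>2)"
    by (simp add: sq[symmetric] norm_power flip: power_mult)
  also have "\<dots> = real N ^ n * (\<Sum>\<gamma>\<in>?J2. (cmod (e \<gamma>))\<^sup>2)"
    by (rule torus_parseval, simp, erule multi_indices_less) (simp add: N_def)
  finally have eq: "(\<Sum>\<tau>\<in>torus_grid N n. (cmod (homogeneous_part n c m (torus_point N n \<tau>))) ^ 4)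
      = real N ^ n * (\<Sum>\<gamma>\<in>?J2. (cmod (e \<gamma>))\<^sup>2)" .
  have "(\<Sum>\<gamma>\<in>?J2. (cmod (e \<gamma>))\<^sup>2) \<le>
     (\<Sum>\<gamma>\<in>?J2. 4 ^ m * (\<Sum>p\<in>{p \<in> ?J \<times> ?J. add p = \<gamma>}. (cmod (c (fst p) * c (snd p)))\<^sup>2))"
  proof (rule sum_mono)
    fix \<gamma> assume \<gamma>: "\<gamma> \<in> ?J2"
    let ?S = "{p \<in> ?J \<times> ?J. add p = \<gamma>}"
    have "(cmod (e \<gamma>))\<^sup>2 \<le> (\<Sum>p\<in>?S. cmod (c (fst p) * c (snd p)))\<^sup>2"
      unfolding e_def by (intro power_mono norm_sum) auto
    also have "\<dots> \<le> (\<Sum>p\<in>?S. 1\<^sup>2) * (\<Sum>p\<in>?S. (cmod (c (fst p) * c (snd p)))\<^sup>2)"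
      using Cauchy_Schwarz_ineq_sum[of "\<lambda>_. 1" "\<lambda>p. cmod (c (fst p) * c (snd p))" ?S] by simp
    also have "\<dots> \<le> 4 ^ m * (\<Sum>p\<in>?S. (cmod (c (fst p) * c (snd p)))\<^sup>2)"
    proof (rule mult_right_mono)
      have "card ?S \<le> 2 ^ (2 * m)"
        unfolding add_def by (rule card_multi_indices_decompositions[OF \<gamma>])
      then have "real (card ?S) \<le> real (2 ^ (2 * m))"
        by (simp only: of_nat_le_iff)
      then show "(\<Sum>p\<in>?S. 1\<^sup>2) \<le> (4::real) ^ m"
        by (simp add: power_mult)
    qed (auto intro: sum_nonneg)
    finally show "(cmod (e \<gamma>))\<^sup>2 \<le> 4 ^ m * (\<Sum>p\<in>?S. (cmod (c (fst p) * c (snd p)))\<^sup>2)" .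
  qed
  also have "\<dots> = 4 ^ m * (\<Sum>p\<in>?J \<times> ?J. (cmod (c (fst p) * c (snd p)))\<^sup>2)"
    unfolding sum_distrib_left[symmetric] using add by (subst sum.group) auto
  also have "(\<Sum>p\<in>?J \<times> ?J. (cmod (c (fst p) * c (snd p)))\<^sup>2) = (\<Sum>\<alpha>\<in>?J. (cmod (c \<alpha>))\<^sup>2)\<^sup>2"
    unfolding power2_eq_square[of "sum _ ?J"] sum_product sum.cartesian_product
    by (intro sum.cong) (auto simp: norm_mult power_mult_distrib)
  finally show ?thesis
    unfolding eq by (subst mult.left_commute) (rule mult_left_mono, auto)
qed

text \<open>The bound on the fourth moment gives a reverse Hoelder inequality through the pointwise
  inequality \<open>y\<^sup>2 \<le> \<mu> y + y ^ 4 / \<mu>\<^sup>2\<close>.\<close>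

lemma torus_L2_le_L1:
  fixes m n
  defines "N \<equiv> Suc (2 * m)"
  shows "real N ^ n * sqrt (\<Sum>\<alpha>\<in>multi_indices n m. (cmod (c \<alpha>))\<^sup>2)
         \<le> 3 * 2 ^ m * (\<Sum>\<tau>\<in>torus_grid N n. cmod (homogeneous_part n c m (torus_point N n \<tau>)))"
proof -
  let ?S = "\<Sum>\<alpha>\<in>multi_indices n m. (cmod (c \<alpha>))\<^sup>2"
  define y where "y \<tau> = cmod (homogeneous_part n c m (torus_point N n \<tau>))" for \<tau>
  define s where "s = sqrt ?S"
  have s: "s \<ge> 0" "s\<^sup>2 = ?S"
    by (auto simp: s_def sum_nonneg)
  show ?thesis
  proof (cases "s = 0")
    case True
    then show ?thesis
      unfolding s_def[symmetric] by (simp add: sum_nonneg)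
  next
    case False
    with s have s0: "s > 0" by auto
    \<comment> \<open>Chosen so that the fourth moment divided by \<open>\<mu>\<^sup>2\<close> is at
      most half of the second moment and can be absorbed on the left.\<close>
    define \<mu> where "\<mu> = sqrt 2 * 2 ^ m * s"
    have "((2::real) ^ m)\<^sup>2 = 4 ^ m"
      by (simp add: power2_eq_square flip: power_mult_distrib)
    then have \<mu>: "\<mu> > 0" "\<mu>\<^sup>2 = 2 * 4 ^ m * s\<^sup>2"
      using s0 by (simp_all add: \<mu>_def power_mult_distrib)
    have \<mu>2: "\<mu>\<^sup>2 > 0"
      using \<mu>(1) by simp
    have 2: "(\<Sum>\<tau>\<in>torus_grid N n. y \<tau> ^ 2) = real N ^ n * s\<^sup>2"
      unfolding y_def homogeneous_part_def s
      by (rule torus_parseval, simp, erule multi_indices_less) (simp add: N_def)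
    have "(\<Sum>\<tau>\<in>torus_grid N n. y \<tau> ^ 4) \<le> 4 ^ m * (real N ^ n * (s\<^sup>2)\<^sup>2)"
      using torus_fourth_moment[of n c m] by (simp add: y_def s N_def)
    also have "\<dots> = \<mu>\<^sup>2 * (real N ^ n * s\<^sup>2 / 2)"
      unfolding \<mu>(2) by (simp add: power2_eq_square)
    finally have 4: "(\<Sum>\<tau>\<in>torus_grid N n. y \<tau> ^ 4) / \<mu>\<^sup>2 \<le> real N ^ n * s\<^sup>2 / 2"
      by (subst pos_divide_le_eq[OF \<mu>2]) (simp only: mult.commute)
    have pt: "y \<tau> ^ 2 \<le> \<mu> * y \<tau> + y \<tau> ^ 4 / \<mu>\<^sup>2" for \<tau>
    proof (cases "y \<tau> \<le> \<mu>")
      case True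
      then have "y \<tau> ^ 2 \<le> \<mu> * y \<tau>"
        by (auto simp: power2_eq_square y_def intro: mult_right_mono)
      then show ?thesis by (simp add: add_increasing2)
    next
      case False
      then have "\<mu>\<^sup>2 \<le> (y \<tau>)\<^sup>2"
        using \<mu> by (intro power_mono) auto
      then have "(y \<tau>)\<^sup>2 * \<mu>\<^sup>2 \<le> (y \<tau>)\<^sup>2 * (y \<tau>)\<^sup>2"
        by (intro mult_left_mono) auto
      then have "(y \<tau>)\<^sup>2 \<le> y \<tau> ^ 4 / \<mu>\<^sup>2"
        by (subst pos_le_divide_eq[OF \<mu>2]) (simp add: power4_eq_xxxx power2_eq_square mult.assoc)
      moreover have "\<mu> * y \<tau> \<ge> 0" using \<mu> by (simp add: y_def)
      ultimately show ?thesis by simp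
    qed
    have "real N ^ n * s\<^sup>2 \<le> (\<Sum>\<tau>\<in>torus_grid N n. \<mu> * y \<tau> + y \<tau> ^ 4 / \<mu>\<^sup>2)"
      unfolding 2[symmetric] by (intro sum_mono pt)
    also have "\<dots> = \<mu> * (\<Sum>\<tau>\<in>torus_grid N n. y \<tau>) + (\<Sum>\<tau>\<in>torus_grid N n. y \<tau> ^ 4) / \<mu>\<^sup>2"
      by (simp add: sum.distrib sum_distrib_left sum_divide_distrib)
    finally have "real N ^ n * s\<^sup>2 \<le> 2 * (\<mu> * (\<Sum>\<tau>\<in>torus_grid N n. y \<tau>))"
      using 4 by linarith
    then have "s * (real N ^ n * s) \<le> s * (2 * sqrt 2 * 2 ^ m * (\<Sum>\<tau>\<in>torus_grid N n. y \<tau>))"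
      by (simp add: \<mu>_def power2_eq_square mult_ac)
    then have "real N ^ n * s \<le> 2 * sqrt 2 * 2 ^ m * (\<Sum>\<tau>\<in>torus_grid N n. y \<tau>)"
      using s0 by (simp only: mult_le_cancel_left_pos)
    also have "\<dots> \<le> 3 * 2 ^ m * (\<Sum>\<tau>\<in>torus_grid N n. y \<tau>)"
    proof -
      have "sqrt 2 \<le> 3 / 2"
        by (rule real_le_lsqrt) (auto simp: power2_eq_square)
      then show ?thesis
        by (intro mult_right_mono sum_nonneg) (auto simp: y_def)
    qed
    finally show ?thesis
      by (simp add: s_def y_def)
  qed
qed

subsection \<open>Directional derivatives of homogeneous polynomials\<close>

text \<open>The coefficients of the partial derivative with respect to coordinate
  \<open>j\<close>.\<close>

definition deriv_coeff ::
    "nat \<Rightarrow> ((nat \<Rightarrow> nat) \<Rightarrow> complex) \<Rightarrow> (nat \<Rightarrow> nat) \<Rightarrow> complex" where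
  "deriv_coeff j a = (\<lambda>\<beta>. of_nat (Suc (\<beta> j)) * a (\<beta>(j := Suc (\<beta> j))))"

lemma norm_le_deriv_coeff: "cmod (a (\<beta>(j := Suc (\<beta> j)))) \<le> cmod (deriv_coeff j a \<beta>)"
  unfolding deriv_coeff_def norm_mult norm_of_nat
  using mult_right_mono[of 1 "real (Suc (\<beta> j))"] by fastforce

lemma homogeneous_part_has_directional_derivative:
  "((\<lambda>\<zeta>. homogeneous_part n a (Suc m) (\<lambda>i. x i + \<zeta> * w i)) has_field_derivative
     (\<Sum>j<n. w j * homogeneous_part n (deriv_coeff j a) m x)) (at 0)"
proof -
  \<comment> \<open>The truncated exponent at \<open>\<alpha> j = 0\<close> is harmless because the
    factor \<open>\<alpha> j\<close> vanishes there; this also allows the restriction to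
    \<open>\<alpha> j > 0\<close> below.\<close>
  define G where "G j \<alpha> = a \<alpha> * ((of_nat (\<alpha> j) * (x j ^ (\<alpha> j - 1) * w j)) *
      (\<Prod>i\<in>{..<n} - {j}. x i ^ \<alpha> i))" for j \<alpha>
  have mono: "((\<lambda>\<zeta>. monomial n \<alpha> (\<lambda>i. x i + \<zeta> * w i)) has_field_derivative
      (\<Sum>j<n. (of_nat (\<alpha> j) * (x j ^ (\<alpha> j - 1) * w j)) * (\<Prod>i\<in>{..<n} - {j}. x i ^ \<alpha> i))) (at 0)" for \<alpha>
  proof -
    have "((\<lambda>\<zeta>. (x i + \<zeta> * w i) ^ \<alpha> i) has_field_derivative
        of_nat (\<alpha> i) * (x i ^ (\<alpha> i - 1) * w i)) (at 0)" for i
      by (auto intro!: derivative_eq_intros)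
    from has_field_derivative_prod[OF this, where A = "{..<n}"] show ?thesis
      by (simp add: monomial_def)
  qed
  have "((\<lambda>\<zeta>. homogeneous_part n a (Suc m) (\<lambda>i. x i + \<zeta> * w i)) has_field_derivative
     (\<Sum>\<alpha>\<in>multi_indices n (Suc m). \<Sum>j<n. G j \<alpha>)) (at 0)"
    unfolding homogeneous_part_def G_def sum_distrib_left[symmetric]
    by (intro DERIV_sum DERIV_cmult mono)
  also have "(\<Sum>\<alpha>\<in>multi_indices n (Suc m). \<Sum>j<n. G j \<alpha>) =
      (\<Sum>j<n. w j * homogeneous_part n (deriv_coeff j a) m x)"
    unfolding sum.swap[of _ _ "multi_indices n (Suc m)"]
  proof (intro sum.cong refl)
    fix j assume "j \<in> {..<n}"
    then have j: "j < n" by simp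
    have "(\<Sum>\<alpha>\<in>multi_indices n (Suc m). G j \<alpha>) = (\<Sum>\<alpha>\<in>{\<alpha> \<in> multi_indices n (Suc m). \<alpha> j > 0}. G j \<alpha>)"
      by (intro sum.mono_neutral_right) (auto simp: G_def)
    also have "\<dots> = (\<Sum>\<beta>\<in>multi_indices n m. G j (\<beta>(j := Suc (\<beta> j))))"
      by (rule sum_multi_indices_raise[OF j])
    also have "\<dots> = w j * homogeneous_part n (deriv_coeff j a) m x"
      unfolding homogeneous_part_def sum_distrib_left
    proof (intro sum.cong refl)
      fix \<beta>
      have "(\<Prod>i\<in>{..<n} - {j}. x i ^ (\<beta>(j := Suc (\<beta> j))) i) = (\<Prod>i\<in>{..<n} - {j}. x i ^ \<beta> i)"
        by (intro prod.cong) auto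
      then show "G j (\<beta>(j := Suc (\<beta> j))) = w j * (deriv_coeff j a \<beta> * monomial n \<beta> x)"
        using j by (simp add: G_def deriv_coeff_def monomial_def prod.remove[of "{..<n}" j])
    qed
    finally show "(\<Sum>\<alpha>\<in>multi_indices n (Suc m). G j \<alpha>) =
        w j * homogeneous_part n (deriv_coeff j a) m x" .
  qed
  finally show ?thesis .
qed

text \<open>Cauchy's inequality for the first derivative at 0 of an entire function of
  \<open>\<zeta>\<close>, on the unit circle.\<close>

lemma directional_derivative_bound:
  assumes "\<And>\<zeta>. cmod \<zeta> = 1 \<Longrightarrow> cmod (homogeneous_part n a (Suc m) (\<lambda>i. x i + \<zeta> * w i)) \<le> B"
  shows "cmod (\<Sum>j<n. w j * homogeneous_part n (deriv_coeff j a) m x) \<le> B"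
proof -
  let ?f = "\<lambda>\<zeta>. homogeneous_part n a (Suc m) (\<lambda>i. x i + \<zeta> * w i)"
  have hol: "?f holomorphic_on UNIV"
    unfolding homogeneous_part_def monomial_def by (intro holomorphic_intros)
  have "norm ((deriv ^^ 1) ?f 0) \<le> fact 1 * B / 1 ^ 1"
  proof (rule Cauchy_inequality)
    show "?f holomorphic_on ball 0 1"
      using hol by (rule holomorphic_on_subset) auto
    show "continuous_on (cball 0 1) ?f"
      using hol by (intro holomorphic_on_imp_continuous_on) (rule holomorphic_on_subset, auto)
  qed (auto intro: assms)
  then show ?thesis
    using DERIV_imp_deriv[OF homogeneous_part_has_directional_derivative[of n a m x w]] by simp
qed

text \<open>Writes each monomial as \<open>z j\<close> times one of degree \<open>m\<close>. The
  differentiation factor \<open>Suc (\<beta> j)\<close> is at least 1, so derivative coefficients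
  dominate the original ones.\<close>

lemma sum_deriv_coeff_le:
  "(\<Sum>\<alpha>\<in>multi_indices n (Suc m). cmod (a \<alpha>) * cmod (monomial n \<alpha> z)) \<le>
   (\<Sum>\<beta>\<in>multi_indices n m. cmod (monomial n \<beta> z) * (\<Sum>j<n. cmod (z j) * cmod (deriv_coeff j a \<beta>)))"
proof -
  have "(\<Sum>\<alpha>\<in>multi_indices n (Suc m). cmod (a \<alpha>) * cmod (monomial n \<alpha> z)) \<le>
      (\<Sum>j<n. \<Sum>\<beta>\<in>multi_indices n m. cmod (a (\<beta>(j := Suc (\<beta> j)))) * cmod (monomial n (\<beta>(j := Suc (\<beta> j))) z))"
    by (intro sum_multi_indices_le_raise) auto
  also have "\<dots> \<le> (\<Sum>j<n. \<Sum>\<beta>\<in>multi_indices n m. cmod (monomial n \<beta> z) * (cmod (z j) * cmod (deriv_coeff j a \<beta>)))"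
  proof (intro sum_mono)
    fix j \<beta> assume "j \<in> {..<n}"
    then have j: "j < n" by simp
    have "(\<Prod>i\<in>{..<n} - {j}. z i ^ (\<beta>(j := Suc (\<beta> j))) i) = (\<Prod>i\<in>{..<n} - {j}. z i ^ \<beta> i)"
      by (intro prod.cong) auto
    then have "monomial n (\<beta>(j := Suc (\<beta> j))) z = z j * monomial n \<beta> z"
      using j by (simp add: monomial_def prod.remove[of "{..<n}" j])
    then have "cmod (a (\<beta>(j := Suc (\<beta> j)))) * cmod (monomial n (\<beta>(j := Suc (\<beta> j))) z) =
        cmod (a (\<beta>(j := Suc (\<beta> j)))) * (cmod (z j) * cmod (monomial n \<beta> z))"
      by (simp add: norm_mult)
    also have "\<dots> \<le> cmod (deriv_coeff j a \<beta>) * (cmod (z j) * cmod (monomial n \<beta> z))"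
      by (intro mult_right_mono norm_le_deriv_coeff) auto
    finally show "cmod (a (\<beta>(j := Suc (\<beta> j)))) * cmod (monomial n (\<beta>(j := Suc (\<beta> j))) z) \<le>
        cmod (monomial n \<beta> z) * (cmod (z j) * cmod (deriv_coeff j a \<beta>))"
      by (simp add: mult_ac)
  qed
  also have "\<dots> = (\<Sum>\<beta>\<in>multi_indices n m. cmod (monomial n \<beta> z) * (\<Sum>j<n. cmod (z j) * cmod (deriv_coeff j a \<beta>)))"
    by (subst sum.swap) (simp add: sum_distrib_left)
  finally show ?thesis .
qed

lemma power_powr: "x \<ge> 0 \<Longrightarrow> (x ^ k) powr q = (x powr q) ^ k" for x :: real
  by (induction k) (auto simp: powr_mult)

lemma mult_cnj_sgn: "z * cnj (sgn z) = of_real (cmod z)"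
proof -
  have "z * cnj (sgn z) = (z * cnj z) / of_real (cmod z)"
    by (simp add: sgn_eq)
  also have "\<dots> = of_real (cmod z)"
    by (simp add: complex_norm_square[symmetric] power2_eq_square)
  finally show ?thesis .
qed

lemma norm_cnj_sgn_le: "cmod (cnj (sgn z)) \<le> 1"
  by (simp add: norm_sgn)

subsection \<open>The unit ball of the p-norm\<close>

lemma lt_ball_real:
  assumes "p > 0"
  shows "z \<in> lt_ball n (ereal p) \<longleftrightarrow> z \<in> cspace n \<and> (\<Sum>i<n. cmod (z i) powr p) < 1"
proof -
  let ?S = "\<Sum>i<n. cmod (z i) powr p"
  have "?S \<ge> 0" by (intro sum_nonneg) auto
  then have "?S powr (1 / p) < 1 \<longleftrightarrow> ?S < 1"
    using assms powr_less_mono2[of "1 / p" ?S 1] ge_one_powr_ge_zero[of ?S "1 / p"]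
    by (cases "?S < 1") auto
  then show ?thesis by (simp add: lt_ball_def)
qed

lemma lt_ball_infinity: "z \<in> lt_ball n \<infinity> \<longleftrightarrow> z \<in> cspace n \<and> (\<forall>i<n. cmod (z i) < 1)"
  by (simp add: lt_ball_def)

lemma lt_ball_mono:
  assumes "1 \<le> t" "z \<in> lt_ball n t" "w \<in> cspace n" "\<And>i. i < n \<Longrightarrow> cmod (w i) \<le> cmod (z i)"
  shows "w \<in> lt_ball n t"
proof (cases t)
  case (real p)
  with assms(1) have p: "p \<ge> 1" by simp
  have "(\<Sum>i<n. cmod (w i) powr p) \<le> (\<Sum>i<n. cmod (z i) powr p)"
    using assms p by (intro sum_mono powr_mono2) auto
  then show ?thesis
    using assms p by (auto simp: real lt_ball_real)
qed (use assms in \<open>auto simp: lt_ball_infinity intro: le_less_trans\<close>)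

text \<open>A crude triangle inequality: the modulus is at most half of the larger of the two, and
  \<open>(1/2) powr p \<le> 1/2\<close>. Dividing by 4 affects only the base of the exponential
  constant.\<close>

lemma lt_ball_add:
  assumes "p \<ge> 1" "x \<in> lt_ball n (ereal p)" "w \<in> lt_ball n (ereal p)" "cmod \<zeta> = 1"
  shows "(\<lambda>i. (x i + \<zeta> * w i) / 4) \<in> lt_ball n (ereal p)"
proof -
  have "cmod ((x i + \<zeta> * w i) / 4) powr p \<le> (cmod (x i) powr p + cmod (w i) powr p) / 2" for i
  proof -
    have "cmod ((x i + \<zeta> * w i) / 4) \<le> (1/2) * max (cmod (x i)) (cmod (w i))"
      using norm_triangle_ineq[of "x i" "\<zeta> * w i"] assms(4) by (auto simp: norm_divide norm_mult)
    then have "cmod ((x i + \<zeta> * w i) / 4) powr p \<le> ((1/2) * max (cmod (x i)) (cmod (w i))) powr p"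
      using assms by (intro powr_mono2) auto
    also have "\<dots> = (1/2) powr p * max (cmod (x i)) (cmod (w i)) powr p"
      by (rule powr_mult)
    also have "\<dots> \<le> (1/2) powr 1 * (cmod (x i) powr p + cmod (w i) powr p)"
      using assms by (intro mult_mono powr_mono') (auto simp: max_def)
    finally show ?thesis by simp
  qed
  then have "(\<Sum>i<n. cmod ((x i + \<zeta> * w i) / 4) powr p) \<le>
      (\<Sum>i<n. (cmod (x i) powr p + cmod (w i) powr p) / 2)"
    by (intro sum_mono)
  also have "\<dots> = ((\<Sum>i<n. cmod (x i) powr p) + (\<Sum>i<n. cmod (w i) powr p)) / 2"
    by (simp add: sum.distrib flip: sum_divide_distrib)
  also have "\<dots> < 1"
    using assms by (auto simp: lt_ball_real)
  finally show ?thesis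
    using assms by (auto simp: lt_ball_real cspace_def)
qed

text \<open>On the unit sphere of the p-norm, the monomial \<open>\<beta>\<close> of degree \<open>m\<close> is largest at the point with
  coordinates \<open>(\<beta> i / m) powr (1 / p)\<close>; the product below is the p-th power of its value there.\<close>

lemma multinomial_lower_bound:
  assumes "\<beta> \<in> multi_indices n m"
  shows "1 \<le> (\<Prod>i<n. (real (\<beta> i) / real m) ^ \<beta> i) * (exp (real m) * multinomial n m \<beta>)"
proof (cases "m = 0")
  case True
  then show ?thesis
    using assms by (auto simp: multi_indices_def multinomial_def)
next
  case False
  have "real m ^ m / fact m \<le> exp (real m)"
  proof -
    have "(\<lambda>k. real m ^ k /\<^sub>R fact k) sums exp (real m)"
      by (rule exp_converges)
    then have "(\<Sum>k\<in>{m}. real m ^ k /\<^sub>R fact k) \<le> exp (real m)"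
      using sum_le_suminf[OF sums_summable[OF \<open>_ sums _\<close>], of "{m}"] by (simp add: sums_iff)
    then show ?thesis by (simp add: divide_inverse mult.commute)
  qed
  then have "real m ^ m \<le> exp (real m) * fact m"
    by (simp add: divide_le_eq)
  moreover have "(\<Prod>i<n. fact (\<beta> i)) \<le> (\<Prod>i<n. real (\<beta> i) ^ \<beta> i)"
    using fact_le_power[where 'a = real] by (intro prod_mono) simp
  ultimately have "(\<Prod>i<n. fact (\<beta> i)) * real m ^ m \<le> (\<Prod>i<n. real (\<beta> i) ^ \<beta> i) * (exp (real m) * fact m)"
    by (intro mult_mono) (auto intro: prod_nonneg)
  moreover have "(\<Prod>i<n. (real (\<beta> i) / real m) ^ \<beta> i) = (\<Prod>i<n. real (\<beta> i) ^ \<beta> i) / real m ^ m"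
    using multi_indicesD(2)[OF assms] by (simp add: power_divide prod_dividef power_sum[symmetric])
  moreover have "(\<Prod>i<n. fact (\<beta> i)) > (0::real)"
    by (intro prod_pos) auto
  ultimately show ?thesis
    unfolding multinomial_def using False by (simp only:) (simp add: field_simps)
qed

section \<open>Absolute coefficient sums of bounded homogeneous polynomials\<close>

text \<open>For fixed \<open>\<beta>\<close>, the sum over the split-off variable is a single
  coefficient of a directional derivative, so Cauchy's estimate bounds it by
  \<open>multinomial n m \<beta> powr (1 / p)\<close>. These weights are exactly those that the
  multinomial theorem sums to \<open>(\<Sum>i<n. cmod (z i) powr p) ^ m \<le> 1\<close> after
  Hoelder.\<close>

lemma homogeneous_sum_bound_small_p:
  assumes p: "p \<ge> 1" and z: "z \<in> lt_ball n (ereal p)"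
    and bound: "\<And>z. z \<in> lt_ball n (ereal p) \<Longrightarrow> cmod (homogeneous_part n a (Suc m) z) \<le> 1"
  shows "(\<Sum>\<alpha>\<in>multi_indices n (Suc m). cmod (a \<alpha>) * cmod (monomial n \<alpha> z))
         \<le> 24 ^ Suc m * real (card (multi_indices n m)) powr (1 - 1 / p)"
proof -
  have deriv: "cmod (\<Sum>j<n. w j * homogeneous_part n (deriv_coeff j a) m x) \<le> 4 ^ Suc m"
    if "x \<in> lt_ball n (ereal p)" "w \<in> lt_ball n (ereal p)" for x w
  proof (rule directional_derivative_bound)
    fix \<zeta> :: complex assume "cmod \<zeta> = 1"
    have four: "4 * (c / 4) = c" for c :: complex
      by simp
    have "homogeneous_part n a (Suc m) (\<lambda>i. x i + \<zeta> * w i) =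
        homogeneous_part n a (Suc m) (\<lambda>i. 4 * ((x i + \<zeta> * w i) / 4))"
      unfolding four ..
    also have "\<dots> = 4 ^ Suc m * homogeneous_part n a (Suc m) (\<lambda>i. (x i + \<zeta> * w i) / 4)"
      by (rule homogeneous_part_scale)
    finally show "cmod (homogeneous_part n a (Suc m) (\<lambda>i. x i + \<zeta> * w i)) \<le> 4 ^ Suc m"
      using bound[OF lt_ball_add[OF p that \<open>cmod \<zeta> = 1\<close>]]
      by (simp add: norm_mult norm_power del: power_Suc)
  qed
  have coeff: "(\<Sum>j<n. cmod (z j) * cmod (deriv_coeff j a \<beta>)) * cmod (monomial n \<beta> x) \<le> 4 ^ Suc m"
    if \<beta>: "\<beta> \<in> multi_indices n m" and x: "x \<in> lt_ball n (ereal p)" for \<beta> x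
  proof -
    \<comment> \<open>The phases cancel those of the derivative coefficients at this one
      \<open>\<beta>\<close>, while the moduli are at most those of \<open>z\<close>, so that
      \<open>w\<close> stays in the ball.\<close>
    define w where "w = (\<lambda>j. of_real (cmod (z j)) * cnj (sgn (deriv_coeff j a \<beta>)))"
    have "w \<in> lt_ball n (ereal p)"
    proof (rule lt_ball_mono[OF _ z])
      show "w \<in> cspace n"
        using z p by (simp add: w_def lt_ball_real cspace_def)
    qed (use p norm_cnj_sgn_le in \<open>auto simp: w_def norm_mult mult_left_le\<close>)
    have "cmod (\<Sum>j<n. w j * deriv_coeff j a \<beta>) * cmod (monomial n \<beta> x) \<le> 4 ^ Suc m"
    proof (rule homogeneous_coefficient_bound[OF _ \<beta>])
      fix u assume u: "u \<in> cspace n" "\<And>i. i < n \<Longrightarrow> cmod (u i) = 1"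
      have "(\<lambda>i. u i * x i) \<in> lt_ball n (ereal p)"
        by (rule lt_ball_mono[OF _ x]) (use p u in \<open>auto simp: cspace_def norm_mult\<close>)
      from deriv[OF this \<open>w \<in> lt_ball n (ereal p)\<close>]
      show "cmod (homogeneous_part n (\<lambda>\<beta>. \<Sum>j<n. w j * deriv_coeff j a \<beta>) m (\<lambda>i. u i * x i)) \<le> 4 ^ Suc m"
        by (simp add: homogeneous_part_def sum_distrib_left sum_distrib_right mult.assoc
            sum.swap[of _ "multi_indices n m"])
    qed
    moreover have "(\<Sum>j<n. w j * deriv_coeff j a \<beta>) =
        of_real (\<Sum>j<n. cmod (z j) * cmod (deriv_coeff j a \<beta>))"
      by (simp add: w_def mult.assoc mult.commute[of "cnj _"] mult_cnj_sgn)
    ultimately show ?thesis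
      by (simp add: norm_of_real sum_nonneg del: of_real_sum)
  qed
  have ball: "(\<Sum>j<n. cmod (z j) * cmod (deriv_coeff j a \<beta>)) \<le> 24 ^ Suc m * multinomial n m \<beta> powr (1 / p)"
    if \<beta>: "\<beta> \<in> multi_indices n m" for \<beta>
  proof -
    let ?S = "\<Sum>j<n. cmod (z j) * cmod (deriv_coeff j a \<beta>)"
    \<comment> \<open>The extremal point for the monomial \<open>\<beta>\<close>, halved to lie
      strictly inside the ball. For \<open>m = 0\<close> the quotient is 0 and \<open>x\<close> is
      the origin.\<close>
    define x where "x = (\<lambda>i. complex_of_real ((real (\<beta> i) / real m) powr (1 / p) / 2))"
    have xpow: "cmod (x i) powr p = (real (\<beta> i) / real m) * (1 / 2) powr p" for i
    proof -
      have "cmod (x i) = (real (\<beta> i) / real m) powr (1 / p) * (1 / 2)"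
        by (simp add: x_def norm_divide)
      then have "cmod (x i) powr p = ((real (\<beta> i) / real m) powr (1 / p)) powr p * (1 / 2) powr p"
        by (simp only:) (rule powr_mult)
      then show ?thesis
        using p by (simp add: powr_powr)
    qed
    have "(\<Sum>i<n. cmod (x i) powr p) = (\<Sum>i<n. real (\<beta> i) / real m) * (1 / 2) powr p"
      unfolding xpow by (simp add: sum_distrib_right)
    also have "(\<Sum>i<n. real (\<beta> i) / real m) = real (\<Sum>i<n. \<beta> i) / real m"
      by (simp add: sum_divide_distrib)
    also have "\<dots> \<le> 1"
      using multi_indicesD(2)[OF \<beta>] by simp
    also have "1 * (1 / 2) powr p \<le> (1 / 2) powr (1::real)"
      using p by (simp only: mult_1, intro powr_mono') auto
    finally have "(\<Sum>i<n. cmod (x i) powr p) < 1" by simp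
    moreover have "x \<in> cspace n"
      using multi_indicesD(1)[OF \<beta>] by (auto simp: x_def cspace_def)
    ultimately have "x \<in> lt_ball n (ereal p)"
      using p by (simp add: lt_ball_real)
    from coeff[OF \<beta> this] have 1: "?S * cmod (monomial n \<beta> x) \<le> 4 ^ Suc m" .
    define Q where "Q = (\<Prod>i<n. (real (\<beta> i) / real m) ^ \<beta> i)"
    have Q: "Q \<ge> 0"
      unfolding Q_def by (intro prod_nonneg) auto
    have "cmod (monomial n \<beta> x) = Q powr (1 / p) / 2 ^ m"
    proof -
      have "cmod (x i) ^ \<beta> i = ((real (\<beta> i) / real m) ^ \<beta> i) powr (1 / p) / 2 ^ \<beta> i" for i
      proof -
        have "cmod (x i) = (real (\<beta> i) / real m) powr (1 / p) / 2"
          by (simp add: x_def norm_divide)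
        then have "cmod (x i) ^ \<beta> i = ((real (\<beta> i) / real m) powr (1 / p)) ^ \<beta> i / 2 ^ \<beta> i"
          by (simp only: power_divide)
        then show ?thesis
          by (subst power_powr) simp_all
      qed
      then have "cmod (monomial n \<beta> x) = (\<Prod>i<n. ((real (\<beta> i) / real m) ^ \<beta> i) powr (1 / p)) / (\<Prod>i<n. 2 ^ \<beta> i)"
        by (simp add: cmod_monomial prod_dividef)
      also have "(\<Prod>i<n. ((real (\<beta> i) / real m) ^ \<beta> i) powr (1 / p)) = Q powr (1 / p)"
        unfolding Q_def by (rule prod_powr_distrib[symmetric])
      also have "(\<Prod>i<n. 2 ^ \<beta> i) = (2::real) ^ m"
        using multi_indicesD(2)[OF \<beta>] by (simp flip: power_sum)
      finally show ?thesis .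
    qed
    with 1 have 2: "?S * Q powr (1 / p) \<le> 4 ^ Suc m * 2 ^ m"
      by (simp add: divide_le_eq)
    have "1 powr (1 / p) \<le> (Q * (exp (real m) * multinomial n m \<beta>)) powr (1 / p)"
      using multinomial_lower_bound[OF \<beta>] p by (intro powr_mono2) (auto simp: Q_def)
    also have "\<dots> = Q powr (1 / p) * (exp (real m) powr (1 / p) * multinomial n m \<beta> powr (1 / p))"
      using Q multinomial_pos[of n m \<beta>] by (simp add: powr_mult)
    finally have 3: "1 \<le> Q powr (1 / p) * (exp (real m) powr (1 / p) * multinomial n m \<beta> powr (1 / p))"
      by simp
    have "?S \<le> ?S * (Q powr (1 / p) * (exp (real m) powr (1 / p) * multinomial n m \<beta> powr (1 / p)))"
      using mult_left_mono[OF 3, of ?S] by (simp add: sum_nonneg)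
    also have "\<dots> = (?S * Q powr (1 / p)) * (exp (real m) powr (1 / p) * multinomial n m \<beta> powr (1 / p))"
      by (simp only: mult.assoc)
    \<comment> \<open>The base 24 is 4 * 2 * 3: the 4 comes from \<open>lt_ball_add\<close>, the 2
      from halving \<open>x\<close>, and the 3 bounds \<open>exp 1\<close>.\<close>
    also have "\<dots> \<le> (4 ^ Suc m * 2 ^ m) * (3 ^ m * multinomial n m \<beta> powr (1 / p))"
    proof (rule mult_mono[OF 2 mult_right_mono])
      have "exp (real m) powr (1 / p) \<le> exp (real m) powr 1"
        using p by (intro powr_mono) auto
      also have "\<dots> = exp 1 ^ m"
        by (simp flip: exp_of_nat_mult)
      also have "\<dots> \<le> 3 ^ m"
        using exp_le by (intro power_mono) auto
      finally show "exp (real m) powr (1 / p) \<le> 3 ^ m" .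
    qed auto
    also have "\<dots> = (4 * 24 ^ m) * multinomial n m \<beta> powr (1 / p)"
    proof -
      have "(24::real) ^ m = (4 * 2 * 3) ^ m" by simp
      then show ?thesis
        by (simp only: power_mult_distrib power_Suc mult_ac)
    qed
    also have "\<dots> \<le> 24 ^ Suc m * multinomial n m \<beta> powr (1 / p)"
      by (intro mult_right_mono) auto
    finally show ?thesis .
  qed
  let ?y = "\<lambda>\<beta>. cmod (monomial n \<beta> z) * multinomial n m \<beta> powr (1 / p)"
  have "(\<Sum>\<alpha>\<in>multi_indices n (Suc m). cmod (a \<alpha>) * cmod (monomial n \<alpha> z)) \<le>
      (\<Sum>\<beta>\<in>multi_indices n m. cmod (monomial n \<beta> z) * (\<Sum>j<n. cmod (z j) * cmod (deriv_coeff j a \<beta>)))"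
    by (rule sum_deriv_coeff_le)
  also have "\<dots> \<le> (\<Sum>\<beta>\<in>multi_indices n m. cmod (monomial n \<beta> z) * (24 ^ Suc m * multinomial n m \<beta> powr (1 / p)))"
    by (intro sum_mono mult_left_mono ball) auto
  also have "\<dots> = 24 ^ Suc m * (\<Sum>\<beta>\<in>multi_indices n m. ?y \<beta>)"
    by (simp add: sum_distrib_left mult_ac)
  also have "\<dots> \<le> 24 ^ Suc m * (real (card (multi_indices n m)) powr (1 - 1 / p) * 1)"
  proof (intro mult_left_mono)
    have "(\<Sum>\<beta>\<in>multi_indices n m. ?y \<beta>) \<le> real (card (multi_indices n m)) powr (1 - 1 / p) *
        (\<Sum>\<beta>\<in>multi_indices n m. ?y \<beta> powr p) powr (1 / p)"
      using p by (intro power_mean_sum) auto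
    also have "\<dots> \<le> real (card (multi_indices n m)) powr (1 - 1 / p) * 1"
    proof (intro mult_left_mono)
      have "?y \<beta> powr p = multinomial n m \<beta> * (\<Prod>i<n. (cmod (z i) powr p) ^ \<beta> i)" for \<beta>
      proof -
        have "?y \<beta> powr p = (\<Prod>i<n. cmod (z i) ^ \<beta> i) powr p * (multinomial n m \<beta> powr (1 / p)) powr p"
          unfolding cmod_monomial by (rule powr_mult)
        also have "(\<Prod>i<n. cmod (z i) ^ \<beta> i) powr p = (\<Prod>i<n. (cmod (z i) powr p) ^ \<beta> i)"
          by (simp add: prod_powr_distrib power_powr)
        also have "(multinomial n m \<beta> powr (1 / p)) powr p = multinomial n m \<beta>"
          using p multinomial_pos[of n m \<beta>] by (simp add: powr_powr)
        finally show ?thesis by simp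
      qed
      then have "(\<Sum>\<beta>\<in>multi_indices n m. ?y \<beta> powr p) = (\<Sum>i<n. cmod (z i) powr p) ^ m"
        by (simp add: multinomial_theorem)
      also have "\<dots> \<le> 1"
        using z p by (intro power_le_one) (auto simp: lt_ball_real sum_nonneg)
      finally have "(\<Sum>\<beta>\<in>multi_indices n m. ?y \<beta> powr p) powr (1 / p) \<le> 1 powr (1 / p)"
        using p by (intro powr_mono2) (auto intro: sum_nonneg)
      then show "(\<Sum>\<beta>\<in>multi_indices n m. ?y \<beta> powr p) powr (1 / p) \<le> 1"
        by simp
    qed auto
    finally show "(\<Sum>\<beta>\<in>multi_indices n m. ?y \<beta>) \<le> real (card (multi_indices n m)) powr (1 - 1 / p) * 1" .
  qed auto
  finally show ?thesis by simp
qed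

text \<open>Here the direction is adapted to the point rather than to \<open>\<beta>\<close>, which
  bounds the sum of the moduli of all partial derivatives at each point. Averaged over the torus,
  this controls the sum over \<open>j\<close> of their L1 norms, hence of their L2 norms, without a
  factor \<open>n\<close>.\<close>

lemma homogeneous_sum_bound_polydisc:
  assumes bound: "\<And>u. u \<in> cspace n \<Longrightarrow> (\<And>i. i < n \<Longrightarrow> cmod (u i) \<le> 1) \<Longrightarrow>
      cmod (homogeneous_part n c (Suc m) u) \<le> 1"
  shows "(\<Sum>\<alpha>\<in>multi_indices n (Suc m). cmod (c \<alpha>)) \<le> 24 ^ Suc m * sqrt (card (multi_indices n m))"
proof -
  let ?H = "\<lambda>j. homogeneous_part n (deriv_coeff j c) m"
  have deriv: "(\<Sum>j<n. cmod (?H j u)) \<le> 2 ^ Suc m"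
    if u: "u \<in> cspace n" "\<And>i. i < n \<Longrightarrow> cmod (u i) \<le> 1" for u
  proof -
    define w where "w = (\<lambda>j. if j < n then cnj (sgn (?H j u)) else 0)"
    have "cmod (\<Sum>j<n. w j * ?H j u) \<le> 2 ^ Suc m"
    proof (rule directional_derivative_bound)
      fix \<zeta> :: complex assume \<zeta>: "cmod \<zeta> = 1"
      have two: "2 * (c / 2) = c" for c :: complex
        by simp
      have "homogeneous_part n c (Suc m) (\<lambda>i. u i + \<zeta> * w i) =
          homogeneous_part n c (Suc m) (\<lambda>i. 2 * ((u i + \<zeta> * w i) / 2))"
        unfolding two ..
      also have "\<dots> = 2 ^ Suc m * homogeneous_part n c (Suc m) (\<lambda>i. (u i + \<zeta> * w i) / 2)"
        by (rule homogeneous_part_scale)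
      finally have eq: "homogeneous_part n c (Suc m) (\<lambda>i. u i + \<zeta> * w i) =
          2 ^ Suc m * homogeneous_part n c (Suc m) (\<lambda>i. (u i + \<zeta> * w i) / 2)" .
      have "cmod ((u i + \<zeta> * w i) / 2) \<le> 1" if "i < n" for i
      proof -
        have "cmod (u i + \<zeta> * w i) \<le> cmod (u i) + cmod (w i)"
          using norm_triangle_ineq[of "u i" "\<zeta> * w i"] \<zeta> by (simp add: norm_mult)
        moreover have "cmod (w i) \<le> 1"
          using norm_cnj_sgn_le by (simp add: w_def)
        ultimately show ?thesis
          using u(2)[OF that] by (simp add: norm_divide)
      qed
      then have "cmod (homogeneous_part n c (Suc m) (\<lambda>i. (u i + \<zeta> * w i) / 2)) \<le> 1"
        using u by (intro bound) (auto simp: cspace_def w_def)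
      then show "cmod (homogeneous_part n c (Suc m) (\<lambda>i. u i + \<zeta> * w i)) \<le> 2 ^ Suc m"
        unfolding eq by (simp add: norm_mult norm_power del: power_Suc)
    qed
    moreover have "(\<Sum>j<n. w j * ?H j u) = of_real (\<Sum>j<n. cmod (?H j u))"
      unfolding of_real_sum
      by (intro sum.cong refl) (simp add: w_def mult.commute[of "cnj _"] mult_cnj_sgn)
    ultimately show ?thesis
      by (simp add: norm_of_real sum_nonneg del: of_real_sum)
  qed
  let ?J = "multi_indices n m"
  let ?l2 = "\<lambda>j. sqrt (\<Sum>\<beta>\<in>?J. (cmod (deriv_coeff j c \<beta>))\<^sup>2)"
  define N where "N = Suc (2 * m)"
  have N: "real N ^ n > 0" by (simp add: N_def)
  \<comment> \<open>The norm comparison is made for each \<open>j\<close> separately, and only then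
    is the sum over \<open>j\<close> taken inside the average, where the pointwise bound
    \<open>deriv\<close> applies.\<close>
  have "real N ^ n * (\<Sum>j<n. ?l2 j) \<le>
      (\<Sum>j<n. 3 * 2 ^ m * (\<Sum>\<tau>\<in>torus_grid N n. cmod (?H j (torus_point N n \<tau>))))"
    unfolding N_def sum_distrib_left[of "real (Suc (2 * m)) ^ n"] by (intro sum_mono torus_L2_le_L1)
  also have "\<dots> = 3 * 2 ^ m * (\<Sum>\<tau>\<in>torus_grid N n. \<Sum>j<n. cmod (?H j (torus_point N n \<tau>)))"
    unfolding sum_distrib_left[symmetric] by (subst sum.swap) simp
  also have "\<dots> \<le> 3 * 2 ^ m * (\<Sum>\<tau>\<in>torus_grid N n. 2 ^ Suc m)"
    by (intro mult_left_mono sum_mono deriv) auto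
  also have "\<dots> = real N ^ n * (6 * (2 ^ m * 2 ^ m))"
    by (simp add: card_torus_grid)
  also have "2 ^ m * 2 ^ m = (4::real) ^ m"
    by (simp flip: power_mult_distrib)
  finally have l2: "(\<Sum>j<n. ?l2 j) \<le> 6 * 4 ^ m"
    using N by (simp only: mult_le_cancel_left_pos)
  have "(\<Sum>\<alpha>\<in>multi_indices n (Suc m). cmod (c \<alpha>)) \<le> (\<Sum>\<beta>\<in>?J. \<Sum>j<n. cmod (deriv_coeff j c \<beta>))"
    using sum_deriv_coeff_le[where a = c and z = "\<lambda>_. 1"] by (simp add: cmod_monomial)
  also have "\<dots> = (\<Sum>j<n. \<Sum>\<beta>\<in>?J. cmod (deriv_coeff j c \<beta>))"
    by (rule sum.swap)
  also have "\<dots> \<le> (\<Sum>j<n. sqrt (card ?J) * ?l2 j)"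
  proof (rule sum_mono)
    fix j
    have "(\<Sum>\<beta>\<in>?J. 1 * cmod (deriv_coeff j c \<beta>))\<^sup>2 \<le>
        (\<Sum>\<beta>\<in>?J. 1\<^sup>2) * (\<Sum>\<beta>\<in>?J. (cmod (deriv_coeff j c \<beta>))\<^sup>2)"
      by (rule Cauchy_Schwarz_ineq_sum)
    then show "(\<Sum>\<beta>\<in>?J. cmod (deriv_coeff j c \<beta>)) \<le> sqrt (card ?J) * ?l2 j"
      by (simp add: real_le_rsqrt flip: real_sqrt_mult)
  qed
  also have "\<dots> = (\<Sum>j<n. ?l2 j) * sqrt (card ?J)"
    by (simp add: sum_distrib_left mult.commute)
  also have "\<dots> \<le> (6 * 4 ^ m) * sqrt (card ?J)"
    by (intro mult_right_mono l2) auto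
  \<comment> \<open>A generous estimate, so that both ranges of the exponent share the constant
    24.\<close>
  also have "\<dots> \<le> 24 ^ Suc m * sqrt (card ?J)"
  proof (intro mult_right_mono)
    have "(6::real) * 4 ^ m \<le> 24 * 24 ^ m"
      by (intro mult_mono power_mono) auto
    then show "(6::real) * 4 ^ m \<le> 24 ^ Suc m" by simp
  qed auto
  finally show ?thesis .
qed

text \<open>The number \<open>s\<close> of the overview. Since \<open>min t 2\<close> is finite, the
  conversion to a real is faithful also at \<open>t = \<infinity>\<close>.\<close>

definition bohr_exponent :: "ereal \<Rightarrow> real" where
  "bohr_exponent t = 1 - 1 / real_of_ereal (min t 2)"

lemma bohr_exponent_real: "bohr_exponent (ereal p) = (if p \<le> 2 then 1 - 1 / p else 1 / 2)"
  using ereal_less_eq(3)[of p 2] by (auto simp: bohr_exponent_def min_def simp del: ereal_less_eq)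

lemma bohr_exponent_infinity: "bohr_exponent \<infinity> = 1 / 2"
  by (simp add: bohr_exponent_def min_def)

lemma bohr_exponent_bounds:
  assumes "1 \<le> t"
  shows "0 \<le> bohr_exponent t" "bohr_exponent t \<le> 1 / 2"
  using assms by (cases t; auto simp: bohr_exponent_real bohr_exponent_infinity field_simps)+

text \<open>Above 2 the exponent stays at 1/2 and the polydisc estimate is used: for
  \<open>z\<close> in the ball, multiplying its coordinates by numbers of modulus at most 1 does not
  leave the ball. The constant is 96 = 24 * 4, with 4 from the count of multi-indices.\<close>

lemma homogeneous_sum_bound:
  assumes t: "1 \<le> t" and n: "n \<ge> 2" and z: "z \<in> lt_ball n t"
    and bound: "\<And>z. z \<in> lt_ball n t \<Longrightarrow> cmod (homogeneous_part n a (Suc m) z) \<le> 1"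
  shows "(\<Sum>\<alpha>\<in>multi_indices n (Suc m). cmod (a \<alpha>) * cmod (monomial n \<alpha> z))
         \<le> (96 * (real n / ln (real n)) powr bohr_exponent t) ^ Suc m"
proof -
  let ?s = "bohr_exponent t"
  let ?J = "multi_indices n m"
  have polydisc: "(\<Sum>\<alpha>\<in>multi_indices n (Suc m). cmod (a \<alpha>) * cmod (monomial n \<alpha> z))
      \<le> 24 ^ Suc m * real (card ?J) powr (1 / 2)"
  proof -
    have "(\<Sum>\<alpha>\<in>multi_indices n (Suc m). cmod (a \<alpha> * monomial n \<alpha> z)) \<le> 24 ^ Suc m * sqrt (card ?J)"
    proof (rule homogeneous_sum_bound_polydisc)
      fix u assume u: "u \<in> cspace n" "\<And>i. i < n \<Longrightarrow> cmod (u i) \<le> 1"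
      have "(\<lambda>i. u i * z i) \<in> lt_ball n t"
        by (rule lt_ball_mono[OF t z]) (use u in \<open>auto simp: cspace_def norm_mult mult_left_le_one_le\<close>)
      then show "cmod (homogeneous_part n (\<lambda>\<alpha>. a \<alpha> * monomial n \<alpha> z) (Suc m) u) \<le> 1"
        using bound by (simp flip: homogeneous_part_mult)
    qed
    then show ?thesis
      by (simp add: norm_mult powr_half_sqrt)
  qed
  have "(\<Sum>\<alpha>\<in>multi_indices n (Suc m). cmod (a \<alpha>) * cmod (monomial n \<alpha> z))
      \<le> 24 ^ Suc m * real (card ?J) powr ?s"
  proof (cases t)
    case (real p)
    show ?thesis
    proof (cases "p \<le> 2")
      case True
      then show ?thesis
        using homogeneous_sum_bound_small_p[of p z n a m] t z bound
        by (simp add: real bohr_exponent_real)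
    qed (use polydisc in \<open>simp add: real bohr_exponent_real\<close>)
  qed (use t polydisc in \<open>auto simp: bohr_exponent_infinity\<close>)
  also have "\<dots> \<le> 24 ^ Suc m * (4 * (real n / ln (real n)) powr ?s) ^ Suc m"
  proof (rule mult_left_mono)
    have "ln (real n) > 0" using n by simp
    then have L: "real n / ln (real n) \<ge> 0" by simp
    have s: "0 \<le> ?s" "?s \<le> 1"
      using bohr_exponent_bounds[OF t] by auto
    have "real (card ?J) powr ?s \<le> ((4 * (real n / ln (real n))) ^ Suc m) powr ?s"
      using card_multi_indices_le_log[OF n, of m] s by (intro powr_mono2) auto
    also have "\<dots> = (4 powr ?s * (real n / ln (real n)) powr ?s) ^ Suc m"
      by (subst power_powr, use L in simp) (simp only: powr_mult)
    also have "\<dots> \<le> (4 powr 1 * (real n / ln (real n)) powr ?s) ^ Suc m"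
      using s by (intro power_mono mult_right_mono powr_mono) auto
    finally show "real (card ?J) powr ?s \<le> (4 * (real n / ln (real n)) powr ?s) ^ Suc m"
      by simp
  qed auto
  also have "\<dots> = (96 * (real n / ln (real n)) powr ?s) ^ Suc m"
    unfolding power_mult_distrib[symmetric] by simp
  finally show ?thesis .
qed

subsection \<open>Homogeneous parts of a bounded pluriharmonic function\<close>

text \<open>\<open>p k\<close> is the \<open>k\<close>-th Fourier coefficient on the unit circle of
  a function bounded by 1. Truncating both series costs at most \<open>e\<close>, after which an
  average over roots of unity extracts the coefficient exactly.\<close>

lemma bounded_harmonic_series_coefficient:
  assumes p: "summable (\<lambda>k. cmod (p k))" and q: "summable (\<lambda>k. cmod (q k))"
    and bound: "\<And>x. cmod x = 1 \<Longrightarrow> cmod ((\<Sum>k. p k * x ^ k) + cnj (\<Sum>k. q k * x ^ k)) \<le> 1"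
    and k: "k \<ge> 1"
  shows "cmod (p k) \<le> 1"
proof (rule field_le_epsilon)
  fix e :: real assume e: "e > 0"
  have tail: "\<exists>N0. \<forall>N\<ge>N0. (\<Sum>l. cmod (c (l + N))) < e / 2"
    if sc: "summable (\<lambda>k. cmod (c k))" for c :: "nat \<Rightarrow> complex"
  proof -
    obtain N0 where "\<forall>N\<ge>N0. norm (\<Sum>l. cmod (c (l + N))) < e / 2"
      using suminf_exist_split[OF half_gt_zero[OF e] sc] by blast
    then show ?thesis by (auto intro!: exI[of _ N0] intro: le_less_trans[OF abs_ge_self])
  qed
  obtain N1 N2 where "\<forall>N\<ge>N1. (\<Sum>l. cmod (p (l + N))) < e / 2" "\<forall>N\<ge>N2. (\<Sum>l. cmod (q (l + N))) < e / 2"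
    using tail[OF p] tail[OF q] by blast
  then obtain N where N: "k < N" "(\<Sum>l. cmod (p (l + N))) < e / 2" "(\<Sum>l. cmod (q (l + N))) < e / 2"
    by (metis add_lessD1 le_add1 le_add2 less_Suc_eq_le le_trans lessI max.cobounded1 max.cobounded2 not_le)
  \<comment> \<open>With all indices below \<open>N\<close>, the frequencies \<open>l - k\<close>
    and \<open>- l - k\<close> are smaller than \<open>2 * N\<close> in modulus, so there is no
    aliasing.\<close>
  define M where "M = 2 * N"
  define x where "x j = cis (2 * pi * real j / real M)" for j :: nat
  define T where "T j = (\<Sum>l<N. p l * x j ^ l) + (\<Sum>l<N. cnj (q l * x j ^ l))" for j
  have [simp]: "cmod (x j) = 1" "x j \<noteq> 0" for j
    by (auto simp: x_def)
  have T: "cmod (T j) \<le> 1 + e" for j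
  proof -
    have split: "(\<Sum>l. c l * x j ^ l) = (\<Sum>l. c (l + N) * x j ^ (l + N)) + (\<Sum>l<N. c l * x j ^ l)"
      and rest: "cmod (\<Sum>l. c (l + N) * x j ^ (l + N)) \<le> (\<Sum>l. cmod (c (l + N)))"
      if "summable (\<lambda>k. cmod (c k))" for c :: "nat \<Rightarrow> complex"
    proof -
      have *: "summable (\<lambda>l. cmod (c l * x j ^ l))"
        using that by (simp add: norm_mult norm_power)
      show "(\<Sum>l. c l * x j ^ l) = (\<Sum>l. c (l + N) * x j ^ (l + N)) + (\<Sum>l<N. c l * x j ^ l)"
        by (rule suminf_split_initial_segment[OF summable_norm_cancel[OF *]])
      have "cmod (\<Sum>l. c (l + N) * x j ^ (l + N)) \<le> (\<Sum>l. cmod (c (l + N) * x j ^ (l + N)))"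
        using summable_ignore_initial_segment[OF *, of N] by (rule summable_norm)
      then show "cmod (\<Sum>l. c (l + N) * x j ^ (l + N)) \<le> (\<Sum>l. cmod (c (l + N)))"
        by (simp add: norm_mult norm_power)
    qed
    let ?A = "\<Sum>l. p (l + N) * x j ^ (l + N)" and ?B = "\<Sum>l. q (l + N) * x j ^ (l + N)"
    let ?X = "(\<Sum>k. p k * x j ^ k) + cnj (\<Sum>k. q k * x j ^ k)"
    have "T j = ?X - ?A - cnj ?B"
      by (simp add: split[OF p] split[OF q] T_def)
    then have "cmod (T j) = cmod (?X - ?A - cnj ?B)"
      by (rule arg_cong)
    then have "cmod (T j) \<le> cmod ?X + cmod ?A + cmod (cnj ?B)"
      using norm_triangle_ineq4[of ?X ?A] norm_triangle_ineq4[of "?X - ?A" "cnj ?B"] by linarith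
    then show ?thesis
      using bound[of "x j"] rest[OF p] rest[OF q] N by simp
  qed
  have orth: "(\<Sum>j<M. x j powi d) = (if d = 0 then of_nat M else 0)" if "\<bar>d\<bar> < int M" for d
    using sum_cis_multiples[OF that] by (simp add: x_def)
  have cnj_x: "cnj (x j) = inverse (x j)" for j
    by (simp add: x_def cis_cnj)
  have "(\<Sum>j<M. T j * x j powi (- int k)) =
      (\<Sum>l<N. p l * (\<Sum>j<M. x j powi (int l - int k))) +
      (\<Sum>l<N. cnj (q l) * (\<Sum>j<M. x j powi (- int l - int k)))"
  proof -
    have "T j * x j powi (- int k) = (\<Sum>l<N. p l * x j powi (int l - int k)) +
        (\<Sum>l<N. cnj (q l) * x j powi (- int l - int k))" for j
      by (simp add: T_def distrib_right sum_distrib_right cnj_x power_int_diff power_int_minus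
          power_inverse divide_inverse mult.assoc)
    then show ?thesis
      by (simp add: sum.distrib sum_distrib_left sum.swap[of _ _ "{..<M}"])
  qed
  also have "(\<Sum>l<N. p l * (\<Sum>j<M. x j powi (int l - int k))) = (\<Sum>l<N. if l = k then of_nat M * p l else 0)"
    using N(1) by (intro sum.cong refl) (subst orth, auto simp: M_def)
  \<comment> \<open>As \<open>k \<ge> 1\<close>, the frequency \<open>- l - k\<close> is never 0,
    not even for \<open>l = 0\<close>.\<close>
  also have "(\<Sum>l<N. cnj (q l) * (\<Sum>j<M. x j powi (- int l - int k))) = 0"
    using N(1) k by (intro sum.neutral ballI) (subst orth, auto simp: M_def)
  finally have "of_nat M * p k = (\<Sum>j<M. T j * x j powi (- int k))"
    using N(1) by simp
  then have "real M * cmod (p k) = cmod (\<Sum>j<M. T j * x j powi (- int k))"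
    by (metis norm_mult norm_of_nat)
  also have "\<dots> \<le> (\<Sum>j<M. 1 + e)"
    using T by (intro sum_norm_le) (simp add: norm_mult norm_power_int)
  finally have "real M * cmod (p k) \<le> real M * (1 + e)"
    by simp
  then show "cmod (p k) \<le> 1 + e"
    using N(1) by (simp add: M_def)
qed

text \<open>The room to dilate \<open>z\<close> inside the open ball turns convergence of the
  expansion at the dilated point into geometric decay of its homogeneous parts at
  \<open>z\<close>.\<close>

lemma lt_ball_expand:
  assumes "1 \<le> t" "z \<in> lt_ball n t"
  obtains \<rho> :: real where "\<rho> > 1" "(\<lambda>i. of_real \<rho> * z i) \<in> lt_ball n t"
proof (cases t)
  case (real p)
  with assms have p: "p \<ge> 1" by simp
  define S where "S = (\<Sum>i<n. cmod (z i) powr p)"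
  have S: "0 \<le> S" "S < 1"
    using assms p by (auto simp: S_def real lt_ball_real sum_nonneg)
  \<comment> \<open>The dilation changes \<open>S\<close> into \<open>2 * S / (1 + S)\<close>, which
    is still below 1.\<close>
  define \<rho> where "\<rho> = (2 / (1 + S)) powr (1 / p)"
  have \<rho>p: "\<rho> powr p = 2 / (1 + S)"
    using p S by (simp add: \<rho>_def powr_powr)
  have "1 powr (1 / p) < \<rho>"
    unfolding \<rho>_def using p S by (intro powr_less_mono2) auto
  then have "\<rho> > 1" by simp
  have "(\<Sum>i<n. cmod (of_real \<rho> * z i) powr p) = \<rho> powr p * S"
    using \<open>\<rho> > 1\<close> by (simp add: norm_mult powr_mult S_def sum_distrib_left)
  also have "\<dots> = 2 / (1 + S) * S"
    by (simp only: \<rho>p)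
  also have "\<dots> < 1"
    using S by (simp add: field_simps)
  finally have "(\<lambda>i. of_real \<rho> * z i) \<in> lt_ball n t"
    using assms p by (simp add: real lt_ball_real cspace_def)
  with \<open>\<rho> > 1\<close> show ?thesis by (rule that)
next
  case PInf
  define M where "M = Max (insert 0 ((\<lambda>i. cmod (z i)) ` {..<n}))"
  have M: "M \<ge> 0" "\<And>i. i < n \<Longrightarrow> cmod (z i) \<le> M"
    by (auto simp: M_def)
  have "M < 1"
    using assms by (auto simp: M_def PInf lt_ball_infinity)
  show ?thesis
  proof (rule that)
    show "2 / (1 + M) > 1"
      using M \<open>M < 1\<close> by simp
    have "cmod (of_real (2 / (1 + M)) * z i) < 1" if "i < n" for i
    proof -
      have "2 / (1 + M) * cmod (z i) \<le> 2 / (1 + M) * M"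
        using M that by (intro mult_left_mono) auto
      also have "\<dots> < 1"
        using M \<open>M < 1\<close> by (simp add: field_simps)
      finally have "2 / (1 + M) * cmod (z i) < 1" .
      moreover have "2 / (1 + M) * cmod (z i) = cmod (of_real (2 / (1 + M)) * z i)"
        unfolding norm_mult norm_of_real using M(1) by simp
      ultimately show ?thesis by simp
    qed
    then show "(\<lambda>i. of_real (2 / (1 + M)) * z i) \<in> lt_ball n t"
      using assms by (auto simp: PInf lt_ball_infinity cspace_def)
  qed
qed (use assms in auto)

text \<open>On the circle of points \<open>x * z\<close> with \<open>cmod x = 1\<close>,
  \<open>f\<close> becomes a harmonic series in \<open>x\<close> whose coefficients are the
  homogeneous parts at \<open>z\<close>. The \<open>b\<close> part follows by conjugation, which
  exchanges the two series.\<close>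

lemma expansion_part_bound:
  assumes t: "1 \<le> t" and exp: "has_pluriharmonic_expansion n f a b (lt_ball n t)"
    and f: "f ` lt_ball n t \<subseteq> cball 0 1" and z: "z \<in> lt_ball n t"
  shows "cmod (homogeneous_part n a (Suc m) z) \<le> 1" "cmod (homogeneous_part n b (Suc m) z) \<le> 1"
proof -
  obtain \<rho> where \<rho>: "\<rho> > 1" "(\<lambda>i. of_real \<rho> * z i) \<in> lt_ball n t"
    using lt_ball_expand[OF t z] .
  define p where "p k = homogeneous_part n a k z" for k
  \<comment> \<open>The value 0 at degree 0 encodes that the conjugated series starts at degree
    1.\<close>
  define q where "q k = (if k = 0 then 0 else homogeneous_part n b k z)" for k
  have geometric: "summable (\<lambda>k. cmod (c k))" if "summable (\<lambda>k. of_real \<rho> ^ k * c k)" for c :: "nat \<Rightarrow> complex"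
  proof -
    have "Bseq (\<lambda>k. of_real \<rho> ^ k * c k)"
      using summable_LIMSEQ_zero[OF that] by (intro convergent_imp_Bseq convergentI)
    then obtain K where K: "\<And>k. cmod (of_real \<rho> ^ k * c k) \<le> K"
      by (auto simp: Bseq_def)
    show ?thesis
    proof (rule summable_comparison_test')
      show "summable (\<lambda>k. K * (1 / \<rho>) ^ k)"
        using \<rho>(1) by (intro summable_mult summable_geometric) auto
      fix k
      show "norm (cmod (c k)) \<le> K * (1 / \<rho>) ^ k"
        using K[of k] \<rho>(1) by (simp add: norm_mult norm_power field_simps)
    qed
  qed
  have exp_at: "summable (\<lambda>k. x ^ k * p k) \<and> summable (\<lambda>k. x ^ k * q k) \<and>
      f (\<lambda>i. x * z i) = (\<Sum>k. x ^ k * p k) + cnj (\<Sum>k. x ^ k * q k)"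
    if xz: "(\<lambda>i. x * z i) \<in> lt_ball n t" for x
  proof -
    obtain u v where uv: "(\<lambda>k. homogeneous_part n a k (\<lambda>i. x * z i)) sums u"
        "(\<lambda>k. homogeneous_part n b (Suc k) (\<lambda>i. x * z i)) sums v" "f (\<lambda>i. x * z i) = u + cnj v"
      using exp xz unfolding has_pluriharmonic_expansion_def by blast
    have p: "(\<lambda>k. x ^ k * p k) sums u"
      using uv(1) by (simp add: homogeneous_part_scale p_def)
    have "(\<lambda>k. x ^ Suc k * q (Suc k)) sums v"
      using uv(2) by (simp add: homogeneous_part_scale q_def)
    then have "(\<lambda>k. x ^ k * q k) sums (v + x ^ 0 * q 0)"
      by (rule sums_Suc)
    then have q: "(\<lambda>k. x ^ k * q k) sums v"
      by (simp add: q_def)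
    show ?thesis
      unfolding uv(3) sums_unique[OF p, symmetric] sums_unique[OF q, symmetric]
      using p q sums_summable by blast
  qed
  have p: "summable (\<lambda>k. cmod (p k))" and q: "summable (\<lambda>k. cmod (q k))"
    using exp_at[OF \<rho>(2)] geometric by auto
  have bound: "cmod ((\<Sum>k. p k * x ^ k) + cnj (\<Sum>k. q k * x ^ k)) \<le> 1" if "cmod x = 1" for x
  proof -
    have "(\<lambda>i. x * z i) \<in> lt_ball n t"
      by (rule lt_ball_mono[OF t z]) (use z that in \<open>auto simp: norm_mult lt_ball_def cspace_def\<close>)
    with exp_at[OF this] f show ?thesis
      by (force simp: mult.commute)
  qed
  show "cmod (homogeneous_part n a (Suc m) z) \<le> 1"
    using bounded_harmonic_series_coefficient[OF p q bound, of "Suc m"] by (simp add: p_def)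
  have "cmod ((\<Sum>k. q k * x ^ k) + cnj (\<Sum>k. p k * x ^ k)) \<le> 1" if "cmod x = 1" for x
    using bound[OF that] complex_mod_cnj[of "(\<Sum>k. p k * x ^ k) + cnj (\<Sum>k. q k * x ^ k)"]
    by (simp add: add.commute)
  from bounded_harmonic_series_coefficient[OF q p this, of "Suc m"]
  show "cmod (homogeneous_part n b (Suc m) z) \<le> 1"
    by (simp add: q_def)
qed

lemma R1_ge:
  assumes "0 \<le> r" "r \<le> 1"
    and "\<And>f a b z. pluriharmonic_on n f \<Omega> \<Longrightarrow> f ` \<Omega> \<subseteq> cball 0 1 \<Longrightarrow>
      has_pluriharmonic_expansion n f a b \<Omega> \<Longrightarrow> z \<in> \<Omega> \<Longrightarrow> bohr_sum n a b (\<lambda>i. of_real r * z i) \<le> 1"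
  shows "r \<le> R1 n \<Omega>"
  unfolding R1_def
proof (rule cSup_upper)
  show "r \<in> {r \<in> {0..1}. \<forall>f a b. pluriharmonic_on n f \<Omega> \<and> f ` \<Omega> \<subseteq> cball 0 1 \<and>
      has_pluriharmonic_expansion n f a b \<Omega> \<longrightarrow>
      (SUP z\<in>(\<lambda>z i. complex_of_real r * z i) ` \<Omega>. bohr_sum n a b z) \<le> 1}"
    using assms by (auto intro!: SUP_least)
qed (auto intro!: bdd_aboveI[of _ 1])

text \<open>288 = 3 * 96: at this radius the degree \<open>k\<close> sums of \<open>a\<close> and of
  \<open>b\<close> are each at most \<open>(1/3) ^ k\<close>, and twice the sum of these over
  \<open>k \<ge> 1\<close> is exactly 1.\<close>

lemma R1_lower_bound:
  assumes t: "1 \<le> t" and n: "n \<ge> 2"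
  shows "(ln (real n) / real n) powr bohr_exponent t / 288 \<le> R1 n (lt_ball n t)"
proof (rule R1_ge)
  let ?s = "bohr_exponent t"
  define L where "L = (ln (real n) / real n) powr ?s"
  let ?r = "L / 288"
  have ln: "ln (real n) > 0" "ln (real n) \<le> real n"
    using n ln_le_minus_one[of "real n"] by auto
  have "L \<le> 1 powr ?s"
    unfolding L_def using ln n bohr_exponent_bounds[OF t] by (intro powr_mono2) auto
  then have L: "0 \<le> L" "L \<le> 1"
    by (auto simp: L_def)
  then show "0 \<le> L / 288" "L / 288 \<le> 1"
    by auto
  have inv: "L * (real n / ln (real n)) powr ?s = 1"
    unfolding L_def powr_mult[symmetric] using ln n by simp
  fix f a b z
  assume exp: "has_pluriharmonic_expansion n f a b (lt_ball n t)"
    and f: "f ` lt_ball n t \<subseteq> cball 0 1" and z: "z \<in> lt_ball n t"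
  have summand: "(\<Sum>\<alpha>\<in>multi_indices n (Suc k). (cmod (a \<alpha>) + cmod (b \<alpha>)) *
      cmod (monomial n \<alpha> (\<lambda>i. complex_of_real ?r * z i))) \<le> 2 * (1 / 3) ^ Suc k" for k
  proof -
    let ?S = "\<lambda>c. \<Sum>\<alpha>\<in>multi_indices n (Suc k). cmod (c \<alpha>) * cmod (monomial n \<alpha> z)"
    let ?K = "(96 * (real n / ln (real n)) powr ?s) ^ Suc k"
    have scale: "cmod (monomial n \<alpha> (\<lambda>i. complex_of_real ?r * z i)) = ?r ^ Suc k * cmod (monomial n \<alpha> z)"
      if "\<alpha> \<in> multi_indices n (Suc k)" for \<alpha>
      unfolding monomial_scale multi_indicesD(2)[OF that] norm_mult norm_power norm_of_real
      using L(1) by simp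
    have "(\<Sum>\<alpha>\<in>multi_indices n (Suc k). (cmod (a \<alpha>) + cmod (b \<alpha>)) *
        cmod (monomial n \<alpha> (\<lambda>i. complex_of_real ?r * z i))) =
        (\<Sum>\<alpha>\<in>multi_indices n (Suc k). ?r ^ Suc k * (cmod (a \<alpha>) * cmod (monomial n \<alpha> z)) +
          ?r ^ Suc k * (cmod (b \<alpha>) * cmod (monomial n \<alpha> z)))"
      by (intro sum.cong refl) (simp only: scale distrib_right, simp only: mult_ac)
    also have "\<dots> = ?r ^ Suc k * (?S a + ?S b)"
      by (simp only: sum.distrib sum_distrib_left distrib_left)
    also have "\<dots> \<le> ?r ^ Suc k * (?K + ?K)"
      using L(1) expansion_part_bound[OF t exp f]
      by (intro mult_left_mono add_mono homogeneous_sum_bound[OF t n z]) auto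
    also have "\<dots> = 2 * (?r * (96 * (real n / ln (real n)) powr ?s)) ^ Suc k"
      by (simp only: power_mult_distrib mult_2 distrib_left)
    also have "?r * (96 * (real n / ln (real n)) powr ?s) = 1 / 3"
      using inv by simp
    finally show ?thesis .
  qed
  have sums: "(\<lambda>k. 2 * (1 / 3) ^ Suc k) sums (1 :: real)"
    using sums_mult[OF geometric_sums[of "1 / 3 :: real"], of "2 / 3"] by simp
  have "bohr_sum n a b (\<lambda>i. complex_of_real ?r * z i) \<le> (\<Sum>k. ennreal (2 * (1 / 3) ^ Suc k))"
    unfolding bohr_sum_def by (intro suminf_le ennreal_leI summand) auto
  also have "\<dots> = ennreal 1"
    using sums by (intro suminf_ennreal_eq) auto
  finally show "bohr_sum n a b (\<lambda>i. complex_of_real ?r * z i) \<le> 1"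
    by simp
qed

subsection \<open>Polynomials with random signs\<close>

text \<open>\<open>cosh x \<le> exp (x\<^sup>2)\<close>, the subgaussian estimate for a random sign.
  For \<open>0 \<le> y \<le> 1\<close> the linear terms in the quadratic bounds of the two
  exponentials cancel; for larger \<open>y\<close> one has \<open>y \<le> y\<^sup>2\<close>.\<close>

lemma exp_plus_exp_minus_le: "exp x + exp (- x) \<le> 2 * exp (x\<^sup>2)" for x :: real
proof -
  have *: "exp y + exp (- y) \<le> 2 * exp (y\<^sup>2)" if "y \<ge> 0" for y :: real
  proof (cases "y \<le> 1")
    case True
    have "exp (- y) \<le> 1 / (1 + y)"
      using that exp_ge_add_one_self[of y] by (simp add: exp_minus inverse_eq_divide frac_le)
    also have "\<dots> \<le> 1 - y + y\<^sup>2"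
    proof -
      have "(1 - y + y\<^sup>2) * (1 + y) = 1 + y ^ 3"
        by (simp add: algebra_simps power2_eq_square power3_eq_cube)
      then have "1 \<le> (1 - y + y\<^sup>2) * (1 + y)"
        using that by simp
      then show ?thesis
        using that by (simp add: divide_le_eq)
    qed
    finally have "exp y + exp (- y) \<le> 2 * (1 + y\<^sup>2)"
      using exp_bound[OF that True] by simp
    also have "\<dots> \<le> 2 * exp (y\<^sup>2)"
      by (intro mult_left_mono exp_ge_add_one_self) auto
    finally show ?thesis .
  next
    case False
    then have "y \<le> y\<^sup>2"
      by (simp add: power2_eq_square)
    then have "exp y \<le> exp (y\<^sup>2)" "exp (- y) \<le> exp (y\<^sup>2)"
      using that by (auto intro: order_trans)
    then show ?thesis by linarith
  qed
  show ?thesis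
  proof (cases "x \<ge> 0")
    case False
    then show ?thesis using *[of "- x"] by simp
  qed (rule *)
qed

text \<open>The method of conditional expectations: of the two signs of a new coefficient, one does
  not exceed the average.\<close>

lemma exists_signs_exp_sum_le:
  fixes b :: "'a \<Rightarrow> 'w \<Rightarrow> real"
  assumes "finite A" "finite W" "\<And>w. w \<in> W \<Longrightarrow> y w \<ge> 0"
  shows "\<exists>\<epsilon>. (\<forall>\<alpha>. \<epsilon> \<alpha> \<in> {-1, 1}) \<and>
    (\<Sum>w\<in>W. y w * exp (\<Sum>\<alpha>\<in>A. \<epsilon> \<alpha> * b \<alpha> w)) \<le> (\<Sum>w\<in>W. y w * exp (\<Sum>\<alpha>\<in>A. (b \<alpha> w)\<^sup>2))"
  using assms
proof (induction A arbitrary: y rule: finite_induct)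
  case empty
  show ?case by (rule exI[of _ "\<lambda>_. 1"]) simp
next
  case (insert \<beta> A)
  \<comment> \<open>The weights are general so that the induction hypothesis can be used with the
    factor \<open>exp ((b \<beta> w)\<^sup>2)\<close> of the new index already included.\<close>
  obtain \<epsilon> where \<epsilon>: "\<forall>\<alpha>. \<epsilon> \<alpha> \<in> {-1, 1}"
    "(\<Sum>w\<in>W. (y w * exp ((b \<beta> w)\<^sup>2)) * exp (\<Sum>\<alpha>\<in>A. \<epsilon> \<alpha> * b \<alpha> w)) \<le>
     (\<Sum>w\<in>W. (y w * exp ((b \<beta> w)\<^sup>2)) * exp (\<Sum>\<alpha>\<in>A. (b \<alpha> w)\<^sup>2))"
    using insert.IH[of "\<lambda>w. y w * exp ((b \<beta> w)\<^sup>2)"] insert.prems by auto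
  let ?E = "\<lambda>w. y w * exp (\<Sum>\<alpha>\<in>A. \<epsilon> \<alpha> * b \<alpha> w)"
  have ins: "(\<Sum>w\<in>W. y w * exp (\<Sum>\<alpha>\<in>insert \<beta> A. (\<epsilon>(\<beta> := s)) \<alpha> * b \<alpha> w)) =
      (\<Sum>w\<in>W. ?E w * exp (s * b \<beta> w))" for s
  proof (intro sum.cong refl)
    fix w
    have "(\<Sum>\<alpha>\<in>A. (\<epsilon>(\<beta> := s)) \<alpha> * b \<alpha> w) = (\<Sum>\<alpha>\<in>A. \<epsilon> \<alpha> * b \<alpha> w)"
      using insert.hyps by (intro sum.cong) auto
    then show "y w * exp (\<Sum>\<alpha>\<in>insert \<beta> A. (\<epsilon>(\<beta> := s)) \<alpha> * b \<alpha> w) = ?E w * exp (s * b \<beta> w)"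
      using insert.hyps by (simp add: exp_add)
  qed
  let ?T = "\<Sum>w\<in>W. y w * exp (\<Sum>\<alpha>\<in>insert \<beta> A. (b \<alpha> w)\<^sup>2)"
  have "(\<Sum>w\<in>W. ?E w * exp (1 * b \<beta> w)) + (\<Sum>w\<in>W. ?E w * exp (-1 * b \<beta> w)) =
      (\<Sum>w\<in>W. ?E w * (exp (b \<beta> w) + exp (- b \<beta> w)))"
    by (simp add: distrib_left sum.distrib)
  also have "\<dots> \<le> (\<Sum>w\<in>W. ?E w * (2 * exp ((b \<beta> w)\<^sup>2)))"
    using insert.prems by (intro sum_mono mult_left_mono exp_plus_exp_minus_le) auto
  also have "\<dots> = 2 * (\<Sum>w\<in>W. (y w * exp ((b \<beta> w)\<^sup>2)) * exp (\<Sum>\<alpha>\<in>A. \<epsilon> \<alpha> * b \<alpha> w))"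
    by (simp add: sum_distrib_left mult_ac)
  also have "\<dots> \<le> 2 * ?T"
    using \<epsilon>(2) insert.hyps by (simp add: exp_add mult_ac)
  finally have "(\<Sum>w\<in>W. ?E w * exp (1 * b \<beta> w)) \<le> ?T \<or> (\<Sum>w\<in>W. ?E w * exp (-1 * b \<beta> w)) \<le> ?T"
    by linarith
  then obtain s :: real where "s \<in> {-1, 1}" "(\<Sum>w\<in>W. ?E w * exp (s * b \<beta> w)) \<le> ?T"
    by blast
  then show ?case
    using \<epsilon>(1) by (intro exI[of _ "\<epsilon>(\<beta> := s)"], unfold ins) simp
qed

text \<open>Each exponential is at most the whole sum, which is at most
  \<open>exp 1 * card W\<close>; after taking logarithms, control at all points of \<open>W\<close>
  at once costs only \<open>ln (card W)\<close>.\<close>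

lemma exists_signs_sum_le:
  fixes b :: "'a \<Rightarrow> 'w \<Rightarrow> real"
  assumes "finite A" "finite W" "\<And>w. w \<in> W \<Longrightarrow> (\<Sum>\<alpha>\<in>A. (b \<alpha> w)\<^sup>2) \<le> 1"
  shows "\<exists>\<epsilon>. (\<forall>\<alpha>. \<epsilon> \<alpha> \<in> {-1, 1}) \<and> (\<forall>w\<in>W. (\<Sum>\<alpha>\<in>A. \<epsilon> \<alpha> * b \<alpha> w) \<le> 1 + ln (card W))"
proof -
  obtain \<epsilon> where \<epsilon>: "\<forall>\<alpha>. \<epsilon> \<alpha> \<in> {-1, 1}"
    "(\<Sum>w\<in>W. exp (\<Sum>\<alpha>\<in>A. \<epsilon> \<alpha> * b \<alpha> w)) \<le> (\<Sum>w\<in>W. exp (\<Sum>\<alpha>\<in>A. (b \<alpha> w)\<^sup>2))"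
    using exists_signs_exp_sum_le[OF assms(1,2), of "\<lambda>_. 1" b] by auto
  have "(\<Sum>\<alpha>\<in>A. \<epsilon> \<alpha> * b \<alpha> w) \<le> 1 + ln (card W)" if w: "w \<in> W" for w
  proof -
    have card: "card W > 0"
      using w assms(2) by (auto simp: card_gt_0_iff)
    have "exp (\<Sum>\<alpha>\<in>A. \<epsilon> \<alpha> * b \<alpha> w) \<le> (\<Sum>w\<in>W. exp (\<Sum>\<alpha>\<in>A. \<epsilon> \<alpha> * b \<alpha> w))"
      using w assms(2) by (intro member_le_sum) auto
    also note \<epsilon>(2)
    also have "(\<Sum>w\<in>W. exp (\<Sum>\<alpha>\<in>A. (b \<alpha> w)\<^sup>2)) \<le> (\<Sum>w\<in>W. exp 1)"
      using assms(3) by (intro sum_mono) simp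
    also have "\<dots> = exp (1 + ln (card W))"
      using card by (simp add: exp_add)
    finally show ?thesis by simp
  qed
  with \<epsilon>(1) show ?thesis by blast
qed

text \<open>Rounding does not increase the modulus, so the grid point near a point of the Euclidean
  ball is again in the ball.\<close>

lemma round_towards_zero:
  fixes y :: real and L :: nat
  assumes "\<bar>y\<bar> \<le> 1" "L > 0"
  shows "\<exists>a::int. a \<in> {- int L..int L} \<and> \<bar>of_int a / L\<bar> \<le> \<bar>y\<bar> \<and> \<bar>y - of_int a / L\<bar> \<le> 1 / L"
proof -
  have pos: "\<exists>a::int. a \<in> {- int L..int L} \<and> \<bar>of_int a / L\<bar> \<le> \<bar>y\<bar> \<and> \<bar>y - of_int a / L\<bar> \<le> 1 / L"
    if y: "0 \<le> y" "y \<le> 1" for y :: real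
  proof (intro exI[of _ "\<lfloor>L * y\<rfloor>"] conjI)
    have f: "of_int \<lfloor>L * y\<rfloor> \<le> L * y" "L * y < of_int \<lfloor>L * y\<rfloor> + 1" "0 \<le> \<lfloor>L * y\<rfloor>"
      using y by auto
    have "L * y \<le> L" using y by (simp add: mult_left_le)
    with f show "\<lfloor>L * y\<rfloor> \<in> {- int L..int L}"
      by (auto simp: floor_le_iff) linarith
    show "\<bar>of_int \<lfloor>L * y\<rfloor> / L\<bar> \<le> \<bar>y\<bar>"
      using f y assms(2) by (simp add: divide_le_eq mult.commute)
    have "y - of_int \<lfloor>L * y\<rfloor> / L = (L * y - of_int \<lfloor>L * y\<rfloor>) / L"
      using assms(2) by (simp add: field_simps)
    moreover have "0 \<le> (L * y - of_int \<lfloor>L * y\<rfloor>) / L"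
      using f by (intro divide_nonneg_nonneg) linarith+
    moreover have "(L * y - of_int \<lfloor>L * y\<rfloor>) / L \<le> 1 / L"
      using f by (intro divide_right_mono) linarith+
    ultimately show "\<bar>y - of_int \<lfloor>L * y\<rfloor> / L\<bar> \<le> 1 / L"
      by linarith
  qed
  show ?thesis
  proof (cases "y \<ge> 0")
    case True
    then show ?thesis using pos[of y] assms(1) by simp
  next
    case False
    then obtain a :: int where "a \<in> {- int L..int L}" "\<bar>of_int a / L\<bar> \<le> \<bar>- y\<bar>" "\<bar>- y - of_int a / L\<bar> \<le> 1 / L"
      using pos[of "- y"] assms(1) by auto
    then show ?thesis
      by (intro exI[of _ "- a"]) (auto simp: abs_minus_commute, linarith?)
  qed
qed

lemma norm_monomial_diff_le:
  assumes "\<And>i. i < n \<Longrightarrow> cmod (z i) \<le> 1" "\<And>i. i < n \<Longrightarrow> cmod (w i) \<le> 1"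
    "\<And>i. i < n \<Longrightarrow> cmod (z i - w i) \<le> d" "\<alpha> \<in> multi_indices n m"
  shows "cmod (monomial n \<alpha> z - monomial n \<alpha> w) \<le> m * d"
proof -
  have "cmod (monomial n \<alpha> z - monomial n \<alpha> w) \<le> (\<Sum>i<n. cmod (z i ^ \<alpha> i - w i ^ \<alpha> i))"
    unfolding monomial_def using assms(1,2)
    by (intro norm_prod_diff) (auto simp: norm_power power_le_one)
  also have "\<dots> \<le> (\<Sum>i<n. \<alpha> i * d)"
  proof (rule sum_mono)
    fix i assume "i \<in> {..<n}"
    then have i: "i < n" by simp
    have "cmod (z i ^ \<alpha> i - w i ^ \<alpha> i) \<le> \<alpha> i * cmod (z i - w i)"
      using assms(1,2) i by (intro norm_power_diff) auto
    also have "\<dots> \<le> \<alpha> i * d"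
      using assms(3) i by (intro mult_left_mono) auto
    finally show "cmod (z i ^ \<alpha> i - w i ^ \<alpha> i) \<le> \<alpha> i * d" .
  qed
  also have "\<dots> = m * d"
    by (simp add: multi_indicesD(2)[OF assms(4), symmetric] flip: sum_distrib_right)
  finally show ?thesis .
qed

section \<open>Sign polynomials that are small on the Euclidean ball\<close>

lemma multinomial_le_fact: "multinomial n m \<alpha> \<le> fact m"
proof -
  have "(1::real) \<le> (\<Prod>i<n. fact (\<alpha> i))"
    by (intro prod_ge_1) simp
  then show ?thesis
    by (simp add: multinomial_def divide_le_eq)
qed

text \<open>With these weights the multinomial theorem evaluates the sum of the absolute values of
  the terms as a power of the l1 norm, for every choice of signs.\<close>

definition sign_poly :: "nat \<Rightarrow> nat \<Rightarrow> ((nat \<Rightarrow> nat) \<Rightarrow> real) \<Rightarrow> (nat \<Rightarrow> complex) \<Rightarrow> complex" where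
  "sign_poly n m \<epsilon> = homogeneous_part n (\<lambda>\<alpha>. of_real (\<epsilon> \<alpha> * multinomial n m \<alpha>)) m"

lemma sum_norm_sign_poly:
  assumes "\<And>\<alpha>. \<epsilon> \<alpha> \<in> {-1, 1}"
  shows "(\<Sum>\<alpha>\<in>multi_indices n m. cmod (of_real (\<epsilon> \<alpha> * multinomial n m \<alpha>)) * cmod (monomial n \<alpha> z)) =
         (\<Sum>i<n. cmod (z i)) ^ m"
proof -
  have "cmod (of_real (\<epsilon> \<alpha> * multinomial n m \<alpha>)) = multinomial n m \<alpha>" for \<alpha>
    using assms[of \<alpha>] multinomial_pos[of n m \<alpha>] by (auto simp: norm_mult)
  then show ?thesis
    by (simp add: cmod_monomial multinomial_theorem)
qed

lemma norm_sign_poly_le: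
  assumes "\<And>\<alpha>. \<epsilon> \<alpha> \<in> {-1, 1}"
  shows "cmod (sign_poly n m \<epsilon> z) \<le> (\<Sum>i<n. cmod (z i)) ^ m"
proof -
  have "cmod (sign_poly n m \<epsilon> z) \<le>
      (\<Sum>\<alpha>\<in>multi_indices n m. cmod (of_real (\<epsilon> \<alpha> * multinomial n m \<alpha>)) * cmod (monomial n \<alpha> z))"
    unfolding sign_poly_def homogeneous_part_def by (rule sum_norm_le) (simp add: norm_mult)
  also have "\<dots> = (\<Sum>i<n. cmod (z i)) ^ m"
    by (rule sum_norm_sign_poly[OF assms])
  finally show ?thesis .
qed

text \<open>After division by \<open>sqrt (fact m)\<close> the squared weights are at most
  \<open>multinomial n m \<alpha>\<close>, so the sum of squares is at most a power of the squared
  Euclidean norm, hence at most 1. \<open>V\<close> is 1 plus the logarithm of a bound for the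
  number of constraints.\<close>

lemma exists_small_sign_poly_grid:
  fixes L m n :: nat
  assumes "L > 0"
  defines "V \<equiv> 1 + ln (4 * (2 * real L + 1) ^ (2 * n))"
  shows "\<exists>\<epsilon>. (\<forall>\<alpha>. \<epsilon> \<alpha> \<in> {-1, 1}) \<and>
    (\<forall>g h. (\<forall>i<n. g i \<in> {- int L..int L} \<and> h i \<in> {- int L..int L}) \<longrightarrow>
       (\<Sum>i<n. (cmod (Complex (of_int (g i) / L) (of_int (h i) / L)))\<^sup>2) \<le> 1 \<longrightarrow>
       cmod (sign_poly n m \<epsilon> (\<lambda>i. Complex (of_int (g i) / L) (of_int (h i) / L))) \<le> sqrt (fact m) * (2 * V))"
proof -
  define pt :: "(nat \<Rightarrow> int \<times> int) \<Rightarrow> nat \<Rightarrow> complex"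
    where "pt g = (\<lambda>i. Complex (of_int (fst (g i)) / L) (of_int (snd (g i)) / L))" for g
  define G where "G = {g \<in> {..<n} \<rightarrow>\<^sub>E {- int L..int L} \<times> {- int L..int L}. (\<Sum>i<n. (cmod (pt g i))\<^sup>2) \<le> 1}"
  define T where "T \<alpha> g = of_real (multinomial n m \<alpha> / sqrt (fact m)) * monomial n \<alpha> (pt g)" for \<alpha> g
  \<comment> \<open>The four rotations bound the real and imaginary parts from both sides, which
    gives the modulus up to a factor 2.\<close>
  define W where "W = G \<times> {1, -1, \<i>, -\<i>}"
  define b where "b \<alpha> w = Re (snd w * T \<alpha> (fst w))" for \<alpha> w
  have finG: "finite G"
    unfolding G_def by (rule finite_subset[of _ "{..<n} \<rightarrow>\<^sub>E {- int L..int L} \<times> {- int L..int L}"]) (auto intro!: finite_PiE)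
  have "card G \<le> card ({..<n} \<rightarrow>\<^sub>E {- int L..int L} \<times> {- int L..int L})"
    unfolding G_def by (intro card_mono) (auto intro!: finite_PiE)
  also have "\<dots> = (2 * L + 1) ^ (2 * n)"
  proof -
    have "card {- int L..int L} = 2 * L + 1" by simp
    then have "card ({..<n} \<rightarrow>\<^sub>E {- int L..int L} \<times> {- int L..int L}) = (\<Prod>i<n. (2 * L + 1) * (2 * L + 1))"
      by (simp only: card_PiE finite_lessThan card_cartesian_product)
    then show ?thesis
      by (simp only: prod_constant card_lessThan power_mult power2_eq_square)
  qed
  finally have cardG: "card G \<le> (2 * L + 1) ^ (2 * n)" .
  have "card {1, -1, \<i>, -\<i>} \<le> 4"
    using card_length[of "[1, -1, \<i>, -\<i>]"] by (simp add: numeral_eq_Suc)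
  then have "card W \<le> (2 * L + 1) ^ (2 * n) * 4"
    unfolding W_def card_cartesian_product using cardG by (rule mult_le_mono[rotated])
  then have "real (card W) \<le> real ((2 * L + 1) ^ (2 * n) * 4)"
    by (simp only: of_nat_le_iff)
  then have cardW: "real (card W) \<le> 4 * (2 * real L + 1) ^ (2 * n)"
    by (simp add: mult.commute add.commute)
  have sq: "(\<Sum>\<alpha>\<in>multi_indices n m. (b \<alpha> w)\<^sup>2) \<le> 1" if w: "w \<in> W" for w
  proof -
    have "fst w \<in> G" using w by (auto simp: W_def)
    then have G: "(\<Sum>i<n. (cmod (pt (fst w) i))\<^sup>2) \<le> 1" by (simp add: G_def)
    have "(b \<alpha> w)\<^sup>2 \<le> multinomial n m \<alpha> * (\<Prod>i<n. ((cmod (pt (fst w) i))\<^sup>2) ^ \<alpha> i)" for \<alpha>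
    proof -
      have "cmod (snd w) = 1" using w by (auto simp: W_def)
      then have "\<bar>b \<alpha> w\<bar> \<le> cmod (T \<alpha> (fst w))"
        unfolding b_def using abs_Re_le_cmod[of "snd w * T \<alpha> (fst w)"] by (simp add: norm_mult)
      then have "\<bar>b \<alpha> w\<bar>\<^sup>2 \<le> (cmod (T \<alpha> (fst w)))\<^sup>2"
        by (intro power_mono) auto
      then have "(b \<alpha> w)\<^sup>2 \<le> (cmod (T \<alpha> (fst w)))\<^sup>2"
        by simp
      also have "\<dots> = multinomial n m \<alpha> * multinomial n m \<alpha> / fact m * (\<Prod>i<n. ((cmod (pt (fst w) i))\<^sup>2) ^ \<alpha> i)"
      proof -
        have "cmod (T \<alpha> (fst w)) = multinomial n m \<alpha> / sqrt (fact m) * (\<Prod>i<n. cmod (pt (fst w) i) ^ \<alpha> i)"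
          unfolding T_def norm_mult cmod_monomial norm_of_real using multinomial_pos[of n m \<alpha>] by simp
        then show ?thesis
          by (simp add: power_divide power2_eq_square prod.distrib power_mult_distrib)
      qed
      also have "\<dots> \<le> multinomial n m \<alpha> * (\<Prod>i<n. ((cmod (pt (fst w) i))\<^sup>2) ^ \<alpha> i)"
        using multinomial_le_fact[of n m \<alpha>] multinomial_pos[of n m \<alpha>]
        by (intro mult_right_mono prod_nonneg) (auto simp: divide_le_eq mult_left_mono)
      finally show ?thesis .
    qed
    then have "(\<Sum>\<alpha>\<in>multi_indices n m. (b \<alpha> w)\<^sup>2) \<le>
        (\<Sum>\<alpha>\<in>multi_indices n m. multinomial n m \<alpha> * (\<Prod>i<n. ((cmod (pt (fst w) i))\<^sup>2) ^ \<alpha> i))"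
      by (intro sum_mono)
    also have "\<dots> = (\<Sum>i<n. (cmod (pt (fst w) i))\<^sup>2) ^ m"
      by (rule multinomial_theorem)
    also have "\<dots> \<le> 1"
      using G by (intro power_le_one) (simp_all add: sum_nonneg)
    finally show ?thesis .
  qed
  have "finite W"
    using finG by (simp add: W_def)
  from exists_signs_sum_le[OF finite_multi_indices this sq] have "\<exists>\<epsilon>. (\<forall>\<alpha>. \<epsilon> \<alpha> \<in> {-1, 1}) \<and> (\<forall>w\<in>W. (\<Sum>\<alpha>\<in>multi_indices n m. \<epsilon> \<alpha> * b \<alpha> w) \<le> 1 + ln (card W))"
    .
  then obtain \<epsilon> where \<epsilon>: "\<forall>\<alpha>. \<epsilon> \<alpha> \<in> {-1, 1::real}"
      "\<forall>w\<in>W. (\<Sum>\<alpha>\<in>multi_indices n m. \<epsilon> \<alpha> * b \<alpha> w) \<le> 1 + ln (card W)"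
    by (elim exE conjE)
  have main: "cmod (sign_poly n m \<epsilon> (pt g)) \<le> sqrt (fact m) * (2 * V)" if g: "g \<in> G" for g
  proof -
    define S where "S = (\<Sum>\<alpha>\<in>multi_indices n m. of_real (\<epsilon> \<alpha>) * T \<alpha> g)"
    have "Re (c * S) \<le> V" if c: "c \<in> {1, -1, \<i>, -\<i>}" for c
    proof -
      have w: "(g, c) \<in> W" using g c by (simp add: W_def)
      then have "card W > 0"
        using finG by (auto simp: W_def card_gt_0_iff)
      have "Re (c * S) = (\<Sum>\<alpha>\<in>multi_indices n m. \<epsilon> \<alpha> * b \<alpha> (g, c))"
        unfolding S_def sum_distrib_left Re_sum b_def
        by (intro sum.cong refl) (simp add: algebra_simps)
      also have "\<dots> \<le> 1 + ln (card W)"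
        using \<epsilon>(2) w by blast
      also have "\<dots> \<le> V"
        unfolding V_def using cardW \<open>card W > 0\<close> by simp
      finally show ?thesis .
    qed
    from this[of 1] this[of "-1"] this[of \<i>] this[of "-\<i>"] have "\<bar>Re S\<bar> \<le> V" "\<bar>Im S\<bar> \<le> V"
      by auto
    then have "cmod S \<le> 2 * V"
      using cmod_le[of S] by linarith
    moreover have "sign_poly n m \<epsilon> (pt g) = of_real (sqrt (fact m)) * S"
      unfolding sign_poly_def homogeneous_part_def S_def T_def sum_distrib_left
      by (intro sum.cong refl) simp
    ultimately show ?thesis
      by (simp add: norm_mult mult_left_mono)
  qed
  show ?thesis
  proof (intro exI[of _ \<epsilon>] conjI allI impI)
    fix g h :: "nat \<Rightarrow> int"
    assume gh: "\<forall>i<n. g i \<in> {- int L..int L} \<and> h i \<in> {- int L..int L}"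
      and le: "(\<Sum>i<n. (cmod (Complex (of_int (g i) / L) (of_int (h i) / L)))\<^sup>2) \<le> 1"
    define k where "k = restrict (\<lambda>i. (g i, h i)) {..<n}"
    have "k \<in> G"
      using gh le by (auto simp: G_def k_def pt_def)
    moreover have "sign_poly n m \<epsilon> (\<lambda>i. Complex (of_int (g i) / L) (of_int (h i) / L)) = sign_poly n m \<epsilon> (pt k)"
      by (simp add: sign_poly_def homogeneous_part_def monomial_def pt_def k_def)
    ultimately show "cmod (sign_poly n m \<epsilon> (\<lambda>i. Complex (of_int (g i) / L) (of_int (h i) / L))) \<le> sqrt (fact m) * (2 * V)"
      using main[of k] by simp
  qed (use \<epsilon>(1) in blast)
qed

text \<open>On the polydisc a monomial of degree \<open>m\<close> is Lipschitz with constant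
  \<open>m\<close> in the maximum norm, and the moduli of the coefficients add up to
  \<open>n ^ m\<close>, the multinomial theorem at the point of all ones.\<close>

lemma sign_poly_diff_le:
  assumes \<epsilon>: "\<And>\<alpha>. \<epsilon> \<alpha> \<in> {-1, 1}"
    and "\<And>i. i < n \<Longrightarrow> cmod (z i) \<le> 1" "\<And>i. i < n \<Longrightarrow> cmod (w i) \<le> 1"
    "\<And>i. i < n \<Longrightarrow> cmod (z i - w i) \<le> d"
  shows "cmod (sign_poly n m \<epsilon> z - sign_poly n m \<epsilon> w) \<le> real n ^ m * (m * d)"
proof -
  have "cmod (sign_poly n m \<epsilon> z - sign_poly n m \<epsilon> w) \<le> (\<Sum>\<alpha>\<in>multi_indices n m. multinomial n m \<alpha> * (m * d))"
    unfolding sign_poly_def homogeneous_part_def sum_subtractf[symmetric]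
  proof (rule sum_norm_le)
    fix \<alpha> assume \<alpha>: "\<alpha> \<in> multi_indices n m"
    have "cmod (of_real (\<epsilon> \<alpha> * multinomial n m \<alpha>)) = multinomial n m \<alpha>"
      using \<epsilon>[of \<alpha>] multinomial_pos[of n m \<alpha>] by (auto simp: norm_mult)
    then show "cmod (of_real (\<epsilon> \<alpha> * multinomial n m \<alpha>) * monomial n \<alpha> z -
        of_real (\<epsilon> \<alpha> * multinomial n m \<alpha>) * monomial n \<alpha> w) \<le> multinomial n m \<alpha> * (m * d)"
      using norm_monomial_diff_le[OF assms(2-4) \<alpha>] multinomial_pos[of n m \<alpha>]
      by (simp only: right_diff_distrib[symmetric] norm_mult mult_left_mono less_imp_le)
  qed
  also have "\<dots> = real n ^ m * (m * d)"
    using multinomial_theorem[of n m "\<lambda>_. 1"] by (simp flip: sum_distrib_right)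
  finally show ?thesis .
qed

lemma exists_small_sign_poly:
  assumes n: "n \<ge> 2"
  defines "m \<equiv> nat \<lceil>ln (real n)\<rceil>"
  shows "\<exists>\<epsilon>. (\<forall>\<alpha>. \<epsilon> \<alpha> \<in> {-1, 1}) \<and>
    (\<forall>z. (\<Sum>i<n. (cmod (z i))\<^sup>2) \<le> 1 \<longrightarrow> cmod (sign_poly n m \<epsilon> z) \<le> (396 * sqrt m) ^ m)"
proof -
  have "ln (real n) > 0" using n by simp
  then have m: "m \<ge> 1" "ln (real n) \<le> m"
    by (auto simp: m_def) linarith+
  \<comment> \<open>Fine enough that passing to the grid changes the polynomial by at most
    \<open>n ^ m * (m * (2 / L)) = 1\<close>.\<close>
  define L where "L = 2 * m * n ^ m"
  have L: "L > 0" using m n by (simp add: L_def)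
  define V where "V = 1 + ln (4 * (2 * real L + 1) ^ (2 * n))"
  have "\<exists>\<epsilon>. (\<forall>\<alpha>. \<epsilon> \<alpha> \<in> {-1, 1::real}) \<and>
    (\<forall>g h. (\<forall>i<n. g i \<in> {- int L..int L} \<and> h i \<in> {- int L..int L}) \<longrightarrow>
       (\<Sum>i<n. (cmod (Complex (of_int (g i) / L) (of_int (h i) / L)))\<^sup>2) \<le> 1 \<longrightarrow>
       cmod (sign_poly n m \<epsilon> (\<lambda>i. Complex (of_int (g i) / L) (of_int (h i) / L))) \<le> sqrt (fact m) * (2 * V))"
    unfolding V_def by (rule exists_small_sign_poly_grid[OF L])
  then obtain \<epsilon> where \<epsilon>: "\<forall>\<alpha>. \<epsilon> \<alpha> \<in> {-1, 1::real}"
    and grid: "\<forall>g h. (\<forall>i<n. g i \<in> {- int L..int L} \<and> h i \<in> {- int L..int L}) \<longrightarrow>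
       (\<Sum>i<n. (cmod (Complex (of_int (g i) / L) (of_int (h i) / L)))\<^sup>2) \<le> 1 \<longrightarrow>
       cmod (sign_poly n m \<epsilon> (\<lambda>i. Complex (of_int (g i) / L) (of_int (h i) / L))) \<le> sqrt (fact m) * (2 * V)"
    by (elim exE conjE)
  \<comment> \<open>\<open>ln (2 * L + 1)\<close> is of order
    \<open>m * ln n \<le> m\<^sup>2\<close>, so \<open>V\<close> is of order
    \<open>n * m\<^sup>2\<close>. Here \<open>m \<ge> ln n\<close> enters:
    \<open>n \<le> 3 ^ m\<close>, and \<open>m\<^sup>2 \<le> 4 ^ m\<close>. The base is 396 = 33 * 3
    * 4.\<close>
  have V: "1 \<le> V" "2 * V + 1 \<le> 396 ^ m"
  proof -
    have "(1::real) \<le> (2 * real L + 1) ^ (2 * n)"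
      by (intro one_le_power) simp
    then have "0 \<le> ln (4 * (2 * real L + 1) ^ (2 * n))"
      by (intro ln_ge_zero) linarith
    then show "1 \<le> V"
      by (simp add: V_def)
    have "real n ^ m \<ge> 1" using n by (intro one_le_power) simp
    then have "real m * real n ^ m \<ge> 1"
      using m mult_mono[of 1 "real m" 1 "real n ^ m"] by simp
    then have "ln (2 * real L + 1) \<le> ln (5 * (real m * real n ^ m))"
      by (simp add: L_def)
    also have "\<dots> = ln 5 + ln (real m) + m * ln (real n)"
      using m n by (simp add: ln_mult ln_realpow)
    also have "\<dots> \<le> 4 + real m + m * real m"
      using ln_le_minus_one[of 5] ln_le_minus_one[of "real m"] m
      by (intro add_mono mult_left_mono) auto
    also have "\<dots> \<le> 6 * real m ^ 2"
    proof -
      have "1 * 1 \<le> real m * real m" "1 * real m \<le> real m * real m"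
        using m by (intro mult_mono, auto)+
      then show ?thesis by (simp add: power2_eq_square)
    qed
    finally have "real (2 * n) * ln (2 * real L + 1) \<le> real (2 * n) * (6 * real m ^ 2)"
      by (rule mult_left_mono) simp
    moreover have "ln (4 * (2 * real L + 1) ^ (2 * n)) = ln 4 + real (2 * n) * ln (2 * real L + 1)"
      by (subst ln_mult) (auto simp: ln_realpow)
    moreover have "ln (4 :: real) \<le> 3"
      using ln_le_minus_one[of "4 :: real"] by simp
    ultimately have "V \<le> 1 + (3 + real (2 * n) * (6 * real m ^ 2))"
      unfolding V_def by linarith
    moreover have nm: "1 \<le> real n * real m ^ 2"
      using n m mult_mono[of 1 "real n" 1 "real m ^ 2"] by (simp add: one_le_power)
    ultimately have "2 * V + 1 \<le> 33 * (real n * real m ^ 2)"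
      by simp
    also have "\<dots> \<le> 33 * (3 ^ m * 4 ^ m)"
    proof (intro mult_left_mono mult_mono)
      have "real n = exp (ln (real n))" using n by simp
      also have "\<dots> \<le> exp (real m)" using m by simp
      also have "\<dots> = exp 1 ^ m" by (simp flip: exp_of_nat_mult)
      also have "\<dots> \<le> 3 ^ m" using exp_le by (intro power_mono) auto
      finally show "real n \<le> 3 ^ m" .
      have "real m \<le> 2 ^ m"
        using less_exp[of m] by (metis less_imp_le of_nat_le_iff of_nat_numeral of_nat_power)
      then have "real m ^ 2 \<le> (2 ^ m) ^ 2"
        by (intro power_mono) auto
      also have "\<dots> = (4::real) ^ m"
        by (simp add: power2_eq_square flip: power_mult_distrib)
      finally show "real m ^ 2 \<le> 4 ^ m" .
    qed auto
    also have "\<dots> \<le> 33 ^ m * (3 ^ m * 4 ^ m)"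
      using m self_le_power[of "33::real" m] by (intro mult_right_mono) auto
    also have "\<dots> = 396 ^ m"
      by (simp flip: power_mult_distrib)
    finally show "2 * V + 1 \<le> 396 ^ m" .
  qed
  have "cmod (sign_poly n m \<epsilon> z) \<le> (396 * sqrt m) ^ m" if z: "(\<Sum>i<n. (cmod (z i))\<^sup>2) \<le> 1" for z
  proof -
    have z1: "cmod (z i) \<le> 1" if "i < n" for i
    proof -
      have "(cmod (z i))\<^sup>2 \<le> (\<Sum>i<n. (cmod (z i))\<^sup>2)"
        using that by (intro member_le_sum) auto
      with z have "(cmod (z i))\<^sup>2 \<le> 1\<^sup>2" by simp
      then show ?thesis by (rule power2_le_imp_le) simp
    qed
    have "\<exists>g h. i < n \<longrightarrow> g \<in> {- int L..int L} \<and> h \<in> {- int L..int L} \<and>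
        \<bar>of_int g / L\<bar> \<le> \<bar>Re (z i)\<bar> \<and> \<bar>of_int h / L\<bar> \<le> \<bar>Im (z i)\<bar> \<and>
        \<bar>Re (z i) - of_int g / L\<bar> \<le> 1 / L \<and> \<bar>Im (z i) - of_int h / L\<bar> \<le> 1 / L" for i
    proof (cases "i < n")
      case True
      have "\<bar>Re (z i)\<bar> \<le> 1" "\<bar>Im (z i)\<bar> \<le> 1"
        using abs_Re_le_cmod[of "z i"] abs_Im_le_cmod[of "z i"] z1[OF True] by linarith+
      then show ?thesis
        using round_towards_zero[OF _ L, of "Re (z i)"] round_towards_zero[OF _ L, of "Im (z i)"] by blast
    qed auto
    then obtain g h where gh: "\<And>i. i < n \<Longrightarrow> g i \<in> {- int L..int L} \<and> h i \<in> {- int L..int L} \<and>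
        \<bar>of_int (g i) / L\<bar> \<le> \<bar>Re (z i)\<bar> \<and> \<bar>of_int (h i) / L\<bar> \<le> \<bar>Im (z i)\<bar> \<and>
        \<bar>Re (z i) - of_int (g i) / L\<bar> \<le> 1 / L \<and> \<bar>Im (z i) - of_int (h i) / L\<bar> \<le> 1 / L"
      by metis
    define w where "w = (\<lambda>i. Complex (of_int (g i) / L) (of_int (h i) / L))"
    have wz: "cmod (w i) \<le> cmod (z i)" if "i < n" for i
      unfolding cmod_def w_def using gh[OF that]
      by (intro real_sqrt_le_mono add_mono abs_le_square_iff[THEN iffD1]) simp_all
    have dist: "cmod (z i - w i) \<le> 2 / L" if "i < n" for i
      using cmod_le[of "z i - w i"] gh[OF that] by (simp add: w_def)
    have "(\<Sum>i<n. (cmod (w i))\<^sup>2) \<le> (\<Sum>i<n. (cmod (z i))\<^sup>2)"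
      using wz by (intro sum_mono power_mono) auto
    with z have "(\<Sum>i<n. (cmod (w i))\<^sup>2) \<le> 1" by simp
    then have "cmod (sign_poly n m \<epsilon> w) \<le> sqrt (fact m) * (2 * V)"
      unfolding w_def using gh by (intro grid[rule_format]) auto
    moreover have "cmod (sign_poly n m \<epsilon> z - sign_poly n m \<epsilon> w) \<le> real n ^ m * (m * (2 / L))"
      using \<epsilon> z1 wz dist by (intro sign_poly_diff_le) (auto intro: order_trans)
    moreover have "real n ^ m * (m * (2 / L)) = 1"
      using m n by (simp add: L_def)
    ultimately have "cmod (sign_poly n m \<epsilon> z) \<le> sqrt (fact m) * (2 * V) + 1"
      using norm_triangle_sub[of "sign_poly n m \<epsilon> z" "sign_poly n m \<epsilon> w"] by linarith
    also have "\<dots> \<le> sqrt (fact m) * (2 * V + 1)"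
      by (simp add: distrib_left)
    also have "\<dots> \<le> sqrt (m ^ m) * 396 ^ m"
      using V fact_le_power[of m, where 'a = real] by (intro mult_mono) auto
    also have "\<dots> = (396 * sqrt m) ^ m"
      by (simp add: power_mult_distrib real_sqrt_power)
    finally show ?thesis .
  qed
  with \<epsilon> show ?thesis by blast
qed

subsection \<open>Interpolation\<close>

text \<open>The maximum principle on a rectangle, for \<open>F\<close> divided by \<open>M\<close>
  to the power \<open>s\<close> and damped by a Gaussian factor that tends to 1 with
  \<open>\<delta>\<close>. The bound \<open>B\<close> only has to be finite: it fixes the height of
  the rectangle and leaves no trace in the result.\<close>

lemma three_lines:
  assumes hol: "F holomorphic_on UNIV"
    and B: "\<And>s. 0 \<le> Re s \<Longrightarrow> Re s \<le> 1 \<Longrightarrow> cmod (F s) \<le> B"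
    and M0: "\<And>s. Re s = 0 \<Longrightarrow> cmod (F s) \<le> 1"
    and M1: "\<And>s. Re s = 1 \<Longrightarrow> cmod (F s) \<le> M"
    and M: "M \<ge> 1" and \<theta>: "0 \<le> \<theta>" "\<theta> \<le> 1"
  shows "cmod (F (of_real \<theta>)) \<le> M powr \<theta>"
proof (cases "\<theta> = 0 \<or> \<theta> = 1")
  case True
  then show ?thesis using M0[of 0] M1[of 1] M by auto
next
  case False
  with \<theta> have \<theta>': "0 < \<theta>" "\<theta> < 1" by auto
  have main: "cmod (F (of_real \<theta>)) \<le> M powr \<theta> * exp \<delta>" if \<delta>: "\<delta> > 0" for \<delta>
  proof -
    define G where "G s = F s * exp (- s * of_real (ln M)) * exp (of_real \<delta> * (s\<^sup>2 - 1))" for s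
    have normG: "cmod (G s) = cmod (F s) * exp (- Re s * ln M) * exp (\<delta> * ((Re s)\<^sup>2 - (Im s)\<^sup>2 - 1))" for s
      by (simp add: G_def norm_mult power2_eq_square)
    have lnM: "ln M \<ge> 0" using M by simp
    have strip: "exp (\<delta> * ((Re s)\<^sup>2 - (Im s)\<^sup>2 - 1)) \<le> exp (- \<delta> * (Im s)\<^sup>2)" if "0 \<le> Re s" "Re s \<le> 1" for s
    proof -
      have "(Re s)\<^sup>2 \<le> 1" using that by (intro power_le_one) auto
      then have "\<delta> * ((Re s)\<^sup>2 - (Im s)\<^sup>2 - 1) \<le> \<delta> * (- (Im s)\<^sup>2)"
        using \<delta> by (intro mult_left_mono) auto
      then show ?thesis by simp
    qed
    define B' where "B' = max B 1"
    \<comment> \<open>At height \<open>R\<close> the damping factor is at most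
      \<open>1 / B'\<close>, which compensates the a priori bound on the horizontal sides. The
      rectangle uses \<open>R + 1\<close>, so it is nonempty even if \<open>R = 0\<close>.\<close>
    define R where "R = sqrt (ln B' / \<delta>)"
    have B': "B' \<ge> 1" "B \<le> B'" by (auto simp: B'_def)
    have R: "R \<ge> 0" "\<delta> * R\<^sup>2 = ln B'"
      using \<delta> B' by (auto simp: R_def)
    let ?S = "box (Complex 0 (- (R + 1))) (Complex 1 (R + 1))"
    have in_S: "of_real \<theta> \<in> ?S"
      using \<theta>' R by (simp add: in_box_complex_iff)
    have "cmod (G (of_real \<theta>)) \<le> 1"
    proof (rule maximum_modulus_frontier[where S = ?S and f = G and \<xi> = "of_real \<theta>"])
      show "G holomorphic_on interior ?S"
        unfolding G_def by (intro holomorphic_intros holomorphic_on_subset[OF hol]) auto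
      have "G holomorphic_on UNIV"
        unfolding G_def by (intro holomorphic_intros hol)
      then show "continuous_on (closure ?S) G"
        by (meson continuous_on_subset holomorphic_on_imp_continuous_on subset_UNIV)
      show "cmod (G s) \<le> 1" if "s \<in> frontier ?S" for s
      proof -
        have s: "0 \<le> Re s" "Re s \<le> 1" "\<bar>Im s\<bar> \<le> R + 1"
          "Re s = 0 \<or> Re s = 1 \<or> \<bar>Im s\<bar> = R + 1"
          using that in_S
          by (auto simp: frontier_box in_box_complex_iff in_cbox_complex_iff split: if_splits)
        have e1: "exp (- Re s * ln M) \<le> 1"
          using s lnM by simp
        have e2: "exp (\<delta> * ((Re s)\<^sup>2 - (Im s)\<^sup>2 - 1)) \<le> 1"
        proof -
          have "exp (- \<delta> * (Im s)\<^sup>2) \<le> 1" using \<delta> by simp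
          with strip[OF s(1,2)] show ?thesis by linarith
        qed
        from s(4) show ?thesis
        proof (elim disjE)
          assume "Re s = 0"
          then have "cmod (F s) * exp (- Re s * ln M) \<le> 1"
            using M0 by simp
          from mult_le_one[OF this _ e2] show ?thesis
            by (simp add: normG)
        next
          assume 1: "Re s = 1"
          have "cmod (F s) * exp (- Re s * ln M) = cmod (F s) / M"
            using 1 M by (simp add: exp_minus divide_inverse)
          also have "\<dots> \<le> 1"
            using M1[OF 1] M by (simp add: divide_le_eq)
          finally have "cmod (F s) * exp (- Re s * ln M) \<le> 1" .
          from mult_le_one[OF this _ e2] show ?thesis
            by (simp add: normG)
        next
          assume i: "\<bar>Im s\<bar> = R + 1"
          have "R\<^sup>2 \<le> \<bar>Im s\<bar>\<^sup>2"
            unfolding i using R by (intro power_mono) auto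
          then have "exp (- \<delta> * (Im s)\<^sup>2) \<le> exp (- \<delta> * R\<^sup>2)"
            using \<delta> by simp
          also have "\<dots> = 1 / B'"
            using B' R by (simp add: exp_minus inverse_eq_divide)
          finally have e3: "exp (\<delta> * ((Re s)\<^sup>2 - (Im s)\<^sup>2 - 1)) \<le> 1 / B'"
            using strip[OF s(1,2)] by linarith
          have "cmod (F s) * exp (- Re s * ln M) \<le> B' * 1"
            using B[OF s(1,2)] B' e1 by (intro mult_mono) auto
          from mult_mono[OF this e3] have "cmod (G s) \<le> B' * 1 * (1 / B')"
            using B' by (simp add: normG)
          then show ?thesis using B' by simp
        qed
      qed
    qed (use in_S in auto)
    then have *: "cmod (F (of_real \<theta>)) * exp (- \<theta> * ln M) * exp (\<delta> * (\<theta>\<^sup>2 - 1)) \<le> 1"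
      by (simp add: normG)
    have "cmod (F (of_real \<theta>)) \<le> exp (\<theta> * ln M) * exp (\<delta> * (1 - \<theta>\<^sup>2))"
    proof -
      have "cmod (F (of_real \<theta>)) * exp (- \<theta> * ln M) * exp (\<delta> * (\<theta>\<^sup>2 - 1)) *
          (exp (\<theta> * ln M) * exp (\<delta> * (1 - \<theta>\<^sup>2))) \<le> 1 * (exp (\<theta> * ln M) * exp (\<delta> * (1 - \<theta>\<^sup>2)))"
        using * by (intro mult_right_mono) auto
      moreover have "exp (- \<theta> * ln M) * exp (\<delta> * (\<theta>\<^sup>2 - 1)) * (exp (\<theta> * ln M) * exp (\<delta> * (1 - \<theta>\<^sup>2))) = 1"
        by (simp add: algebra_simps flip: exp_add)
      ultimately show ?thesis
        by (metis mult.assoc mult.right_neutral mult_1)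
    qed
    also have "\<dots> \<le> exp (\<theta> * ln M) * exp \<delta>"
      using \<delta> by (intro mult_left_mono) (auto simp: mult_left_le)
    also have "exp (\<theta> * ln M) = M powr \<theta>"
      using M by (simp add: powr_def)
    finally show ?thesis .
  qed
  have "((\<lambda>\<delta>. M powr \<theta> * exp \<delta>) \<longlongrightarrow> M powr \<theta> * exp 0) (at_right 0)"
    by (intro tendsto_intros)
  moreover have "\<forall>\<^sub>F \<delta> in at_right 0. cmod (F (of_real \<theta>)) \<le> M powr \<theta> * exp \<delta>"
    using eventually_at_right_less[of 0] by eventually_elim (rule main)
  ultimately show ?thesis
    using tendsto_lowerbound[of _ _ "at_right 0"] by force
qed

text \<open>An analytic curve \<open>\<zeta>\<close> through \<open>z\<close> lies in the closed l1
  ball when \<open>Re s = 0\<close> and in the closed Euclidean ball when \<open>Re s = 1\<close>;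
  it passes through \<open>z\<close> at \<open>s = 2 * (1 - 1 / p)\<close>, which therefore is the
  exponent of \<open>M\<close>.\<close>

lemma sign_poly_interpolation:
  assumes \<epsilon>: "\<And>\<alpha>. \<epsilon> \<alpha> \<in> {-1, 1}" and M: "M \<ge> 1"
    and l2: "\<And>z. (\<Sum>i<n. (cmod (z i))\<^sup>2) \<le> 1 \<Longrightarrow> cmod (sign_poly n m \<epsilon> z) \<le> M"
    and p: "1 \<le> p" "p \<le> 2" and z: "(\<Sum>i<n. cmod (z i) powr p) \<le> 1"
  shows "cmod (sign_poly n m \<epsilon> z) \<le> M powr (2 * (1 - 1 / p))"
proof -
  define \<theta> where "\<theta> = 2 * (1 - 1 / p)"
  \<comment> \<open>The modulus is \<open>cmod (z i) powr (p * (1 - Re s / 2))\<close>. Where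
    \<open>z i = 0\<close> the factor \<open>sgn (z i)\<close> keeps the coordinate at 0.\<close>
  define \<zeta> where "\<zeta> s i = sgn (z i) * exp (of_real (p * ln (cmod (z i))) * (1 - s / 2))" for s i
  have norm_\<zeta>: "cmod (\<zeta> s i) = cmod (z i) powr (p * (1 - Re s / 2))" for s i
    by (cases "z i = 0") (simp_all add: \<zeta>_def norm_mult norm_sgn powr_def mult_ac)
  have z1: "cmod (z i) \<le> 1" if "i < n" for i
  proof -
    have "cmod (z i) powr p \<le> (\<Sum>i<n. cmod (z i) powr p)"
      using that by (intro member_le_sum) auto
    with z have "cmod (z i) powr p \<le> 1" by linarith
    then show ?thesis
      using p by (metis gr_one_powr less_le_trans not_le zero_less_one)
  qed
  have "cmod (sign_poly n m \<epsilon> (\<zeta> (of_real \<theta>))) \<le> M powr \<theta>"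
  proof (rule three_lines[where F = "\<lambda>s. sign_poly n m \<epsilon> (\<zeta> s)" and B = "real n ^ m"])
    show "(\<lambda>s. sign_poly n m \<epsilon> (\<zeta> s)) holomorphic_on UNIV"
      unfolding sign_poly_def homogeneous_part_def monomial_def \<zeta>_def by (intro holomorphic_intros) auto
    show "cmod (sign_poly n m \<epsilon> (\<zeta> s)) \<le> real n ^ m" if s: "0 \<le> Re s" "Re s \<le> 1" for s
    proof -
      have "cmod (\<zeta> s i) \<le> 1" if "i < n" for i
        unfolding norm_\<zeta> using z1[OF that] s p by (intro powr_le1 mult_nonneg_nonneg) auto
      then have "(\<Sum>i<n. cmod (\<zeta> s i)) \<le> (\<Sum>i<n. 1)"
        by (intro sum_mono) auto
      then have "(\<Sum>i<n. cmod (\<zeta> s i)) ^ m \<le> real n ^ m"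
        by (intro power_mono sum_nonneg) auto
      then show ?thesis
        using norm_sign_poly_le[of \<epsilon>, OF \<epsilon>, of n m "\<zeta> s"] by linarith
    qed
    show "cmod (sign_poly n m \<epsilon> (\<zeta> s)) \<le> 1" if s: "Re s = 0" for s
    proof -
      have "(\<Sum>i<n. cmod (\<zeta> s i)) \<le> 1"
        using z by (simp add: norm_\<zeta> s)
      then have "(\<Sum>i<n. cmod (\<zeta> s i)) ^ m \<le> 1"
        by (intro power_le_one sum_nonneg) auto
      then show ?thesis
        using norm_sign_poly_le[of \<epsilon>, OF \<epsilon>, of n m "\<zeta> s"] by linarith
    qed
    show "cmod (sign_poly n m \<epsilon> (\<zeta> s)) \<le> M" if s: "Re s = 1" for s
    proof (rule l2)
      have "(cmod (\<zeta> s i))\<^sup>2 = cmod (z i) powr p" for i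
      proof -
        have "(cmod (\<zeta> s i))\<^sup>2 = cmod (z i) powr (p / 2) * cmod (z i) powr (p / 2)"
          by (simp add: norm_\<zeta> s power2_eq_square)
        also have "\<dots> = cmod (z i) powr p"
          by (simp flip: powr_add)
        finally show ?thesis .
      qed
      then show "(\<Sum>i<n. (cmod (\<zeta> s i))\<^sup>2) \<le> 1"
        using z by simp
    qed
  qed (use p M in \<open>auto simp: \<theta>_def field_simps\<close>)
  moreover have "\<zeta> (of_real \<theta>) = z"
  proof
    fix i
    have "p * (1 - \<theta> / 2) = 1"
      using p by (simp add: \<theta>_def field_simps)
    then have "p * ln (cmod (z i)) * (1 - \<theta> / 2) = ln (cmod (z i))"
      by (simp add: mult.commute mult.left_commute)
    moreover have "of_real (p * ln (cmod (z i))) * (1 - of_real \<theta> / 2) =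
        complex_of_real (p * ln (cmod (z i)) * (1 - \<theta> / 2))"
      by simp
    ultimately have "of_real (p * ln (cmod (z i))) * (1 - of_real \<theta> / 2) = complex_of_real (ln (cmod (z i)))"
      by (simp only:)
    then have "\<zeta> (of_real \<theta>) i = sgn (z i) * exp (complex_of_real (ln (cmod (z i))))"
      by (simp only: \<zeta>_def)
    also have "\<dots> = z i"
      by (cases "z i = 0") (simp_all add: exp_of_real sgn_eq)
    finally show "\<zeta> (of_real \<theta>) i = z i" .
  qed
  ultimately show ?thesis by (simp add: \<theta>_def)
qed

text \<open>The reciprocal of the exponent conjugate to \<open>t\<close>, without the cut at 2.
  Dividing in the extended reals gives 1 at \<open>t = \<infinity>\<close>. On the ball the supremum
  of the l1 norm is \<open>n\<close> to this power.\<close>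

definition inverse_conjugate_exponent :: "ereal \<Rightarrow> real" where
  "inverse_conjugate_exponent t = 1 - real_of_ereal (1 / t)"

text \<open>For \<open>t > 2\<close> the ball is contained in the Euclidean ball of radius
  \<open>n powr (1/2 - 1/t)\<close>.\<close>

lemma exists_small_sign_poly_lt_ball:
  assumes t: "1 \<le> t" and n: "n \<ge> 2"
  defines "m \<equiv> nat \<lceil>ln (real n)\<rceil>" and "s \<equiv> bohr_exponent t"
    and "u \<equiv> inverse_conjugate_exponent t"
  shows "\<exists>\<epsilon>. (\<forall>\<alpha>. \<epsilon> \<alpha> \<in> {-1, 1}) \<and>
    (\<forall>z\<in>lt_ball n t. cmod (sign_poly n m \<epsilon> z) \<le> (396 * m powr s * n powr (u - s)) ^ m)"
proof -
  obtain \<epsilon> where \<epsilon>: "\<forall>\<alpha>. \<epsilon> \<alpha> \<in> {-1, 1::real}"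
    and l2: "\<forall>z. (\<Sum>i<n. (cmod (z i))\<^sup>2) \<le> 1 \<longrightarrow> cmod (sign_poly n m \<epsilon> z) \<le> (396 * sqrt m) ^ m"
    using exists_small_sign_poly[OF n] unfolding m_def by (elim exE conjE)
  have "ln (real n) > 0" using n by simp
  then have m: "m \<ge> 1"
    unfolding m_def by linarith
  have large: "cmod (sign_poly n m \<epsilon> z) \<le> (396 * m powr (1/2) * n powr c) ^ m"
    if le: "(\<Sum>i<n. (cmod (z i))\<^sup>2) \<le> (n powr c)\<^sup>2" for z c
  proof -
    define d where "d = n powr c"
    have d: "d > 0" using n by (simp add: d_def)
    have "(\<Sum>i<n. (cmod (of_real (1 / d) * z i))\<^sup>2) = (\<Sum>i<n. (cmod (z i))\<^sup>2) / d\<^sup>2"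
      using d by (simp add: norm_mult norm_divide power_divide sum_divide_distrib)
    also have "\<dots> \<le> 1"
      using d le by (simp add: d_def divide_le_eq)
    finally have "cmod (sign_poly n m \<epsilon> (\<lambda>i. of_real (1 / d) * z i)) \<le> (396 * sqrt m) ^ m"
      by (rule l2[rule_format])
    moreover have "sign_poly n m \<epsilon> z = of_real d ^ m * sign_poly n m \<epsilon> (\<lambda>i. of_real (1 / d) * z i)"
      unfolding sign_poly_def homogeneous_part_scale using d by (simp add: power_divide)
    ultimately have "cmod (sign_poly n m \<epsilon> z) \<le> d ^ m * (396 * sqrt m) ^ m"
      using d by (simp add: norm_mult norm_power mult_left_mono)
    then show ?thesis
      by (simp add: d_def powr_half_sqrt power_mult_distrib mult_ac)
  qed
  have "cmod (sign_poly n m \<epsilon> z) \<le> (396 * m powr s * n powr (u - s)) ^ m" if z: "z \<in> lt_ball n t" for z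
  proof (cases t)
    case (real p)
    with t have p: "p \<ge> 1" by simp
    have S: "(\<Sum>i<n. cmod (z i) powr p) \<le> 1"
      using z p by (simp add: real lt_ball_real)
    have u: "u = 1 - 1 / p"
      using p by (simp add: u_def inverse_conjugate_exponent_def real one_ereal_def del: ereal_eq_1)
    show ?thesis
    proof (cases "p \<le> 2")
      case True
      have s: "s = 1 - 1 / p" "s = u"
        using True u by (simp_all add: s_def real bohr_exponent_real)
      have M: "(396 * sqrt m) ^ m \<ge> 1"
        using m by (intro one_le_power) (simp add: mult_ge1_I real_sqrt_ge_1_iff)
      have "cmod (sign_poly n m \<epsilon> z) \<le> ((396 * sqrt m) ^ m) powr (2 * (1 - 1 / p))"
        by (rule sign_poly_interpolation[OF _ M _ p True S]) (use \<epsilon> l2 in blast)+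
      also have "\<dots> = ((396 * sqrt m) powr (2 * s)) ^ m"
        unfolding s(1) by (rule power_powr) simp
      also have "\<dots> \<le> (396 * m powr s) ^ m"
      proof (rule power_mono)
        have "sqrt m powr (2 * s) = m powr s"
          using m by (simp add: powr_half_sqrt[symmetric] powr_powr)
        moreover have "(396::real) powr (2 * s) \<le> 396 powr 1"
          using bohr_exponent_bounds[OF t] by (intro powr_mono) (auto simp: s_def)
        ultimately show "(396 * sqrt m) powr (2 * s) \<le> 396 * m powr s"
          by (simp add: powr_mult mult_right_mono)
      qed auto
      finally show ?thesis
        using n s(2) by simp
    next
      case False
      have s: "s = 1 / 2"
        using False by (simp add: s_def real bohr_exponent_real)
      have sq: "(cmod (z i))\<^sup>2 powr (p / 2) = cmod (z i) powr p" for i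
        by (cases "z i = 0") (simp_all add: powr_powr flip: powr_numeral)
      have "(\<Sum>i<n. (cmod (z i))\<^sup>2) \<le> real (card {..<n}) powr (1 - 1 / (p / 2)) *
          (\<Sum>i<n. (cmod (z i))\<^sup>2 powr (p / 2)) powr (1 / (p / 2))"
        using False by (intro power_mean_sum) auto
      also have "\<dots> \<le> real n powr (1 - 1 / (p / 2)) * 1 powr (1 / (p / 2))"
        unfolding sq using S False by (intro mult_mono powr_mono2) (auto intro: sum_nonneg)
      also have "\<dots> = (n powr (u - s))\<^sup>2"
        using n by (simp add: u s power2_eq_square flip: powr_add)
      finally show ?thesis
        unfolding s by (rule large[unfolded s])
    qed
  next
    case PInf
    have s: "s = 1 / 2" and u: "u = 1"
      by (simp_all add: s_def PInf bohr_exponent_infinity u_def inverse_conjugate_exponent_def)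
    have "(\<Sum>i<n. (cmod (z i))\<^sup>2) \<le> (\<Sum>i<n. 1)"
      using z by (intro sum_mono power_le_one) (auto simp: PInf lt_ball_infinity less_imp_le)
    also have "\<dots> = (n powr (u - s))\<^sup>2"
      using n by (simp add: u s powr_half_sqrt)
    finally show ?thesis
      unfolding s by (rule large[unfolded s])
  qed (use t in auto)
  with \<epsilon> show ?thesis by blast
qed

subsection \<open>Polynomials are pluriharmonic\<close>

lemma Ck_on_entire:
  assumes "g holomorphic_on UNIV"
  shows "Ck_on k {move1 1, move1 \<i>} g S"
    and "partial_deriv (move1 u) g = (\<lambda>\<zeta>. u * deriv g \<zeta>)"
proof -
  have vd: "((\<lambda>s. g (move1 u s \<zeta>)) has_vector_derivative u * deriv g \<zeta>) (at 0)"
    if "g holomorphic_on UNIV" for g u \<zeta>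
  proof -
    have "(g has_field_derivative deriv g \<zeta>) (at (\<zeta> + 0 * u))"
      using that by (simp add: holomorphic_derivI)
    then have "((\<lambda>x. g (\<zeta> + x * u)) has_field_derivative deriv g \<zeta> * u) (at 0)"
      by (rule DERIV_chain2) (auto intro!: derivative_eq_intros)
    then have "((\<lambda>x. g (\<zeta> + x * u)) has_field_derivative u * deriv g \<zeta>) (at (of_real 0))"
      by (simp add: mult.commute)
    from has_vector_derivative_real_field[OF this] show ?thesis
      by (simp add: move1_def)
  qed
  have pd: "partial_deriv (move1 u) g = (\<lambda>\<zeta>. u * deriv g \<zeta>)" if "g holomorphic_on UNIV" for g u
    using vector_derivative_at[OF vd[OF that]] by (auto simp: partial_deriv_def)
  show "partial_deriv (move1 u) g = (\<lambda>\<zeta>. u * deriv g \<zeta>)"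
    by (rule pd[OF assms])
  show "Ck_on k {move1 1, move1 \<i>} g S"
    using assms
  proof (induction k arbitrary: g)
    case 0
    then show ?case
      unfolding Ck_on.simps by (meson continuous_on_subset holomorphic_on_imp_continuous_on subset_UNIV)
  next
    case (Suc k)
    have "continuous_on S g"
      using Suc.prems by (meson continuous_on_subset holomorphic_on_imp_continuous_on subset_UNIV)
    moreover have "(\<lambda>s. g (move1 u s \<zeta>)) differentiable (at 0)" for u \<zeta>
      using vd[OF Suc.prems] by (rule differentiableI_vector)
    moreover have "Ck_on k {move1 1, move1 \<i>} (partial_deriv (move1 u) g) S" for u
      unfolding pd[OF Suc.prems]
      by (intro Suc.IH holomorphic_intros holomorphic_deriv Suc.prems open_UNIV)
    ultimately show ?case by auto
  qed
qed

text \<open>Differentiating twice in direction \<open>u\<close> gives \<open>u\<^sup>2\<close> times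
  the second complex derivative, and the squares of 1 and \<open>\<i>\<close> add up to 0.\<close>

lemma harmonic_on_entire:
  assumes "g holomorphic_on UNIV"
  shows "harmonic_on g S"
proof -
  have hol: "(\<lambda>\<zeta>. u * deriv g \<zeta>) holomorphic_on UNIV" for u
    by (intro holomorphic_intros holomorphic_deriv assms open_UNIV)
  have "deriv (\<lambda>\<zeta>. u * deriv g \<zeta>) = (\<lambda>\<zeta>. u * deriv (deriv g) \<zeta>)" for u
    using holomorphic_on_imp_differentiable_at[OF holomorphic_deriv[OF assms open_UNIV] open_UNIV]
    by auto
  then have "partial_deriv (move1 u) (partial_deriv (move1 u) g) = (\<lambda>\<zeta>. u * (u * deriv (deriv g) \<zeta>))" for u
    unfolding Ck_on_entire(2)[OF assms] Ck_on_entire(2)[OF hol] by simp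
  then show ?thesis
    unfolding harmonic_on_def using Ck_on_entire(1)[OF assms] by simp
qed

lemma polynomial_move_has_vector_derivative:
  assumes "j < n"
  shows "((\<lambda>s. \<Sum>x\<in>A. c x * monomial n (e x) (move j u s z)) has_vector_derivative
    (\<Sum>x\<in>A. c x * u * of_nat (e x j) * monomial n ((e x)(j := e x j - 1)) z)) (at 0)"
proof -
  have split: "monomial n \<alpha> z = z j ^ \<alpha> j * (\<Prod>i\<in>{..<n} - {j}. z i ^ \<alpha> i)" for \<alpha> z
    using assms by (simp add: monomial_def prod.remove[of "{..<n}" j])
  have move: "monomial n \<alpha> (move j u s z) = (z j + of_real s * u) ^ \<alpha> j * (\<Prod>i\<in>{..<n} - {j}. z i ^ \<alpha> i)" for \<alpha> s
    unfolding split by (auto simp: move_def intro!: prod.cong)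
  have down: "monomial n (\<alpha>(j := k)) z = z j ^ k * (\<Prod>i\<in>{..<n} - {j}. z i ^ \<alpha> i)" for \<alpha> k
    unfolding split by (auto intro!: prod.cong)
  have "((\<lambda>\<zeta>. \<Sum>x\<in>A. c x * ((z j + \<zeta> * u) ^ e x j * (\<Prod>i\<in>{..<n} - {j}. z i ^ e x i))) has_field_derivative
      (\<Sum>x\<in>A. c x * u * of_nat (e x j) * monomial n ((e x)(j := e x j - 1)) z)) (at (of_real 0))"
    by (auto intro!: derivative_eq_intros sum.cong simp: down)
  from has_vector_derivative_real_field[OF this] show ?thesis
    by (simp add: move)
qed

text \<open>Stated for arbitrary finite families of exponents because this class, unlike the
  homogeneous polynomials of a fixed degree, is closed under partial derivatives; the induction on
  \<open>k\<close> relies on that.\<close>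

lemma Ck_on_polynomial:
  "Ck_on k {move j u | j u. j < n \<and> u \<in> {1, \<i>}} (\<lambda>z. \<Sum>x\<in>A. c x * monomial n (e x) z) S"
proof (induction k arbitrary: c e)
  case 0
  then show ?case
    unfolding Ck_on.simps monomial_def
    by (intro continuous_intros continuous_on_subset[OF continuous_on_product_coordinates]) auto
next
  case (Suc k)
  have "continuous_on S (\<lambda>z. \<Sum>x\<in>A. c x * monomial n (e x) z)"
    unfolding monomial_def
    by (intro continuous_intros continuous_on_subset[OF continuous_on_product_coordinates]) auto
  moreover have "(\<lambda>s. \<Sum>x\<in>A. c x * monomial n (e x) (move j u s z)) differentiable (at 0)" if "j < n" for j u z
    using polynomial_move_has_vector_derivative[OF that] by (rule differentiableI_vector)
  moreover have "Ck_on k {move j u | j u. j < n \<and> u \<in> {1, \<i>}}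
      (partial_deriv (move j u) (\<lambda>z. \<Sum>x\<in>A. c x * monomial n (e x) z)) S" if "j < n" for j u
  proof -
    have "partial_deriv (move j u) (\<lambda>z. \<Sum>x\<in>A. c x * monomial n (e x) z) =
        (\<lambda>z. \<Sum>x\<in>A. c x * u * of_nat (e x j) * monomial n ((e x)(j := e x j - 1)) z)"
      unfolding partial_deriv_def
      by (rule ext) (rule vector_derivative_at[OF polynomial_move_has_vector_derivative[OF that]])
    then show ?thesis by (simp only: Suc.IH)
  qed
  ultimately show ?case by auto
qed

lemma pluriharmonic_on_homogeneous_part: "pluriharmonic_on n (homogeneous_part n c m) \<Omega>"
proof -
  have "homogeneous_part n c m = (\<lambda>z. \<Sum>\<alpha>\<in>multi_indices n m. c \<alpha> * monomial n \<alpha> z)"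
    by (auto simp: homogeneous_part_def)
  moreover have "harmonic_on (\<lambda>\<zeta>. homogeneous_part n c m (\<lambda>i. z i + \<zeta> * w i)) S" for z w S
    unfolding homogeneous_part_def monomial_def by (intro harmonic_on_entire holomorphic_intros)
  ultimately show ?thesis
    unfolding pluriharmonic_on_def using Ck_on_polynomial[where e = "\<lambda>\<alpha>. \<alpha>"] by simp
qed

section \<open>Upper bound for the radius\<close>

text \<open>The polynomial divided by \<open>B\<close> is an admissible function with vanishing
  \<open>b\<close> series; at a radius \<open>r > R\<close> the single term of degree
  \<open>Suc m\<close> already pushes its Bohr sum above 1.\<close>

lemma R1_le_of_polynomial:
  assumes B: "B > 0" "\<And>z. z \<in> \<Omega> \<Longrightarrow> cmod (homogeneous_part n c (Suc m) z) \<le> B"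
    and z: "z \<in> \<Omega>"
    and large: "\<And>r. 0 \<le> r \<Longrightarrow> r > R \<Longrightarrow>
      r ^ Suc m * (\<Sum>\<alpha>\<in>multi_indices n (Suc m). cmod (c \<alpha>) * cmod (monomial n \<alpha> z)) > B"
  shows "R1 n \<Omega> \<le> R"
proof -
  define a where "a \<alpha> = (if \<alpha> \<in> multi_indices n (Suc m) then c \<alpha> / of_real B else 0)" for \<alpha>
  define f where "f = homogeneous_part n a (Suc m)"
  have f: "f z = homogeneous_part n c (Suc m) z / of_real B" for z
    by (simp add: f_def a_def homogeneous_part_def sum_divide_distrib)
  have range: "f ` \<Omega> \<subseteq> cball 0 1"
    using B by (auto simp: f norm_divide)
  have other: "homogeneous_part n a k z = 0" if "k \<noteq> Suc m" for k z
    unfolding homogeneous_part_def a_def using that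
    by (intro sum.neutral) (auto simp: multi_indices_def)
  have exp: "has_pluriharmonic_expansion n f a (\<lambda>_. 0) \<Omega>"
    unfolding has_pluriharmonic_expansion_def
  proof
    fix z
    have "(\<lambda>k. homogeneous_part n a k z) sums f z"
      using sums_If_finite_set'[OF sums_zero, of "{Suc m}"] sums_finite[of "{Suc m}" "\<lambda>k. homogeneous_part n a k z"] other
      by (simp add: f_def)
    moreover have "(\<lambda>k. homogeneous_part n (\<lambda>_. 0) (Suc k) z) sums 0"
      by (simp add: homogeneous_part_def)
    ultimately show "\<exists>u v. (\<lambda>k. homogeneous_part n a k z) sums u \<and>
        (\<lambda>k. homogeneous_part n (\<lambda>_. 0) (Suc k) z) sums v \<and> f z = u + cnj v"
      by (intro exI[of _ "f z"] exI[of _ 0]) simp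
  qed
  show ?thesis
    unfolding R1_def
  proof (rule cSup_least)
    \<comment> \<open>The radius 0 is always admissible, since only positive degrees enter
      \<open>bohr_sum\<close>; hence the set under the supremum is nonempty.\<close>
    have "bohr_sum n a b (\<lambda>i. of_real 0 * z i) \<le> 1" for a b z
    proof -
      have "(\<Sum>\<alpha>\<in>multi_indices n (Suc k). (cmod (a \<alpha>) + cmod (b \<alpha>)) * cmod (monomial n \<alpha> (\<lambda>i. of_real 0 * z i))) = 0" for k
        unfolding monomial_scale by (intro sum.neutral) (simp add: multi_indicesD(2))
      then show ?thesis by (simp add: bohr_sum_def del: of_real_0)
    qed
    then have "0 \<in> {r \<in> {0..1}. \<forall>f a b. pluriharmonic_on n f \<Omega> \<and> f ` \<Omega> \<subseteq> cball 0 1 \<and>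
        has_pluriharmonic_expansion n f a b \<Omega> \<longrightarrow>
        (SUP z\<in>(\<lambda>z i. complex_of_real r * z i) ` \<Omega>. bohr_sum n a b z) \<le> 1}"
      by (auto intro!: SUP_least simp del: of_real_0)
    then show "{r \<in> {0..1}. \<forall>f a b. pluriharmonic_on n f \<Omega> \<and> f ` \<Omega> \<subseteq> cball 0 1 \<and>
        has_pluriharmonic_expansion n f a b \<Omega> \<longrightarrow>
        (SUP z\<in>(\<lambda>z i. complex_of_real r * z i) ` \<Omega>. bohr_sum n a b z) \<le> 1} \<noteq> {}"
      by blast
  next
    fix r assume "r \<in> {r \<in> {0..1}. \<forall>f a b. pluriharmonic_on n f \<Omega> \<and> f ` \<Omega> \<subseteq> cball 0 1 \<and>
        has_pluriharmonic_expansion n f a b \<Omega> \<longrightarrow>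
        (SUP z\<in>(\<lambda>z i. complex_of_real r * z i) ` \<Omega>. bohr_sum n a b z) \<le> 1}"
    then have r: "0 \<le> r" and SUP: "(SUP z\<in>(\<lambda>z i. complex_of_real r * z i) ` \<Omega>. bohr_sum n a (\<lambda>_. 0) z) \<le> 1"
      using pluriharmonic_on_homogeneous_part[of n a "Suc m" \<Omega>] range exp unfolding f_def by auto
    have le: "bohr_sum n a (\<lambda>_. 0) (\<lambda>i. complex_of_real r * z i) \<le> 1"
      by (rule order_trans[OF SUP_upper[OF image_eqI[OF refl z]] SUP])
    let ?t = "\<lambda>k. ennreal (\<Sum>\<alpha>\<in>multi_indices n (Suc k).
        (cmod (a \<alpha>) + cmod 0) * cmod (monomial n \<alpha> (\<lambda>i. complex_of_real r * z i)))"
    have "sum ?t {m} \<le> (\<Sum>k. ?t k)"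
      by (intro sum_le_suminf) auto
    also have "\<dots> \<le> 1"
      using le by (simp add: bohr_sum_def)
    finally have "(\<Sum>\<alpha>\<in>multi_indices n (Suc m). cmod (a \<alpha>) * cmod (monomial n \<alpha> (\<lambda>i. complex_of_real r * z i))) \<le> 1"
      by (simp add: ennreal_le_1)
    moreover have "cmod (a \<alpha>) * cmod (monomial n \<alpha> (\<lambda>i. complex_of_real r * z i)) =
        r ^ Suc m * (cmod (c \<alpha>) * cmod (monomial n \<alpha> z)) / B" if \<alpha>: "\<alpha> \<in> multi_indices n (Suc m)" for \<alpha>
      unfolding monomial_scale multi_indicesD(2)[OF \<alpha>] norm_mult norm_power norm_of_real
      using \<alpha> B r by (simp add: a_def norm_divide)
    ultimately have "r ^ Suc m * (\<Sum>\<alpha>\<in>multi_indices n (Suc m). cmod (c \<alpha>) * cmod (monomial n \<alpha> z)) / B \<le> 1"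
      by (simp add: sum_distrib_left flip: sum_divide_distrib)
    then show "r \<le> R"
      using large[OF r] B by (force simp: divide_le_eq)
  qed
qed

text \<open>The test point has l1 norm \<open>n powr u / 2\<close>, so an admissible
  \<open>r\<close> satisfies \<open>r * n powr u / 2 \<le> 396 * m powr s * n powr (u - s)\<close>,
  that is \<open>r \<le> 792 * (m / n) powr s\<close>. Replacing \<open>m\<close> by
  \<open>3 * ln n\<close> gives 2376 = 3 * 792.\<close>

lemma R1_upper_bound:
  assumes t: "1 \<le> t" and n: "n \<ge> 2"
  shows "R1 n (lt_ball n t) \<le> 2376 * (ln (real n) / real n) powr bohr_exponent t"
proof -
  define s where "s = bohr_exponent t"
  define u where "u = inverse_conjugate_exponent t"
  define m where "m = nat \<lceil>ln (real n)\<rceil>"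
  have s: "0 \<le> s" "s \<le> 1 / 2"
    using bohr_exponent_bounds[OF t] by (auto simp: s_def)
  have "ln (2::real) \<le> ln (real n)" using n by simp
  then have ln: "ln (real n) \<ge> 1 / 2"
    using ln2_ge_two_thirds by simp
  \<comment> \<open>The ceiling adds at most 1, and \<open>1 \<le> 2 * ln n\<close>.\<close>
  then have m: "m \<ge> 1" "m \<le> 3 * ln (real n)"
    unfolding m_def by linarith+
  then obtain k where k: "m = Suc k"
    by (cases m) auto
  obtain \<epsilon> where \<epsilon>: "\<forall>\<alpha>. \<epsilon> \<alpha> \<in> {-1, 1::real}"
    and bound: "\<forall>z\<in>lt_ball n t. cmod (sign_poly n m \<epsilon> z) \<le> (396 * m powr s * n powr (u - s)) ^ m"
    using exists_small_sign_poly_lt_ball[OF t n] unfolding m_def s_def u_def by (elim exE conjE)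
  \<comment> \<open>Equal coordinates maximize the l1 norm for a given norm of the ball; the factor
    1/2 keeps the point in the open ball.\<close>
  define z where "z = (\<lambda>i. if i < n then complex_of_real (n powr (u - 1) / 2) else 0)"
  have z: "z \<in> lt_ball n t"
  proof (cases t)
    case (real p)
    with t have p: "p \<ge> 1" by simp
    have u: "u = 1 - 1 / p"
      using p by (simp add: u_def inverse_conjugate_exponent_def real one_ereal_def del: ereal_eq_1)
    have up: "(u - 1) * p = -1"
      using p by (simp add: u)
    have "(\<Sum>i<n. cmod (z i) powr p) = n * (n powr (u - 1) * (1 / 2)) powr p"
      by (simp add: z_def norm_divide)
    also have "(n powr (u - 1) * (1 / 2)) powr p = n powr ((u - 1) * p) * (1 / 2) powr p"
      by (simp only: powr_mult powr_powr)
    also have "n powr ((u - 1) * p) = 1 / n"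
      unfolding up using n by (simp add: powr_minus_divide)
    also have "n * ((1 / n) * (1 / 2) powr p) = (1 / 2) powr p"
      using n by simp
    also have "\<dots> < (1 / 2) powr 0"
      using p by (intro powr_less_mono') auto
    finally show ?thesis
      using p by (simp add: real lt_ball_real z_def cspace_def)
  next
    case PInf
    have "u = 1"
      by (simp add: u_def inverse_conjugate_exponent_def PInf)
    then show ?thesis
      using n by (simp add: PInf lt_ball_infinity z_def cspace_def)
  qed (use t in auto)
  have pos: "m powr s > 0" "n powr (u - s) > 0" "n powr u > 0"
    using m n by auto
  have zsum: "(\<Sum>i<n. cmod (z i)) = n powr u / 2"
  proof -
    have "(\<Sum>i<n. cmod (z i)) = n * n powr (u - 1) / 2"
      by (simp add: z_def norm_divide)
    also have "n * n powr (u - 1) = n powr u"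
      using n by (simp add: powr_diff)
    finally show ?thesis by simp
  qed
  have "R1 n (lt_ball n t) \<le> 792 * (m / n) powr s"
  proof (rule R1_le_of_polynomial)
    show "(396 * m powr s * n powr (u - s)) ^ m > 0"
      using pos by simp
    show "cmod (homogeneous_part n (\<lambda>\<alpha>. of_real (\<epsilon> \<alpha> * multinomial n m \<alpha>)) (Suc k) z)
        \<le> (396 * m powr s * n powr (u - s)) ^ m" if "z \<in> lt_ball n t" for z
      using bound that by (simp add: sign_poly_def k)
    show "z \<in> lt_ball n t" by (rule z)
    fix r :: real
    assume r: "0 \<le> r" "r > 792 * (m / n) powr s"
    have "396 * m powr s * n powr (u - s) = 792 * (m / n) powr s * (n powr u / 2)"
      using n by (simp add: powr_diff powr_divide)
    also have "\<dots> < r * (n powr u / 2)"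
      using r pos by (intro mult_strict_right_mono) auto
    finally have "(396 * m powr s * n powr (u - s)) ^ m < (r * (n powr u / 2)) ^ m"
      using m pos by (intro power_strict_mono) auto
    also have "\<dots> = r ^ m * (\<Sum>i<n. cmod (z i)) ^ m"
      by (simp only: zsum power_mult_distrib)
    also have "(\<Sum>i<n. cmod (z i)) ^ m = (\<Sum>\<alpha>\<in>multi_indices n m.
        cmod (of_real (\<epsilon> \<alpha> * multinomial n m \<alpha>)) * cmod (monomial n \<alpha> z))"
      using \<epsilon> by (intro sum_norm_sign_poly[symmetric]) blast
    finally show "r ^ Suc k * (\<Sum>\<alpha>\<in>multi_indices n (Suc k).
        cmod (of_real (\<epsilon> \<alpha> * multinomial n m \<alpha>)) * cmod (monomial n \<alpha> z)) >
        (396 * m powr s * n powr (u - s)) ^ m"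
      by (simp only: k)
  qed
  also have "\<dots> \<le> 792 * (3 * (ln (real n) / n)) powr s"
    using s m n by (intro mult_left_mono powr_mono2) (auto simp: divide_right_mono)
  also have "\<dots> \<le> 792 * (3 * (ln (real n) / n) powr s)"
  proof (rule mult_left_mono)
    have "(3::real) powr s \<le> 3 powr 1"
      using s by (intro powr_mono) auto
    then show "(3 * (ln (real n) / n)) powr s \<le> 3 * (ln (real n) / n) powr s"
      unfolding powr_mult[of 3] by (intro mult_right_mono) auto
  qed auto
  finally show ?thesis by (simp add: s_def)
qed

theorem corollary4:
  fixes t :: ereal
  assumes "1 \<le> t"
  shows "asymp_comparable
           (\<lambda>n. R1 n (lt_ball n t))
           (\<lambda>n. (ln (real n) / real n) powr (1 - 1 / real_of_ereal (min t 2)))"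
  unfolding asymp_comparable_def bohr_exponent_def[symmetric]
proof (intro exI conjI allI impI)
  fix n :: nat
  assume "n > 1"
  then have "n \<ge> 2" by simp
  then show "1 / 288 * (ln (real n) / real n) powr bohr_exponent t \<le> R1 n (lt_ball n t)"
    and "R1 n (lt_ball n t) \<le> 2376 * (ln (real n) / real n) powr bohr_exponent t"
    using R1_lower_bound[OF assms] R1_upper_bound[OF assms] by simp_all
qed auto

end
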